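(* Let $n,m\ge 1$. Let $G$ be any reductive group acting algebraically on $V=\mathrm{Mat}_n^m$ by linear transformations which preserve $\mathrm{SING}_{n,m}$ (i.e. $g\cdot \mathrm{SING}_{n,m}=\mathrm{SING}_{n,m}$ for all $g\in G$). Let $\mathcal{N}=\mathcal{N}_G(V)$ denote the null cone for this action. If $\mathcal{N}\subseteq \mathrm{SING}_{n,m}$, then $\mathcal{N}\subseteq \mathrm{NSING}_{n,m}$.
   Context: The ground field is $\mathbb{C}$. $\mathrm{Mat}_n$ is the space of $n\times n$ complex matrices and $\mathrm{Mat}_n^m$ is the space of $m$-tuples of such matrices. With commuting indeterminates $t_1,\dots,t_m$, $$\mathrm{SING}_{n,m}=\{(X_1,\dots,X_m)\in\mathrm{Mat}_n^m : \textstyle\sum_{i} t_iX_i \text{ is singular over } \mathbb{C}(t_1,\dots,t_m)\}.$$ With non-commuting indeterminates $t_1,\dots,t_m$, let $F$ denote the free skew field in $t_1,\dots,t_m$ over $\mathbb{C}$ (the universal skew field of fractions of the free algebra $\mathbb{C}\langle t_1,\dots,t_m\rangle$), and $$\mathrm{NSING}_{n,m}=\{(X_1,\dots,X_m)\in\mathrm{Mat}_n^m : \textstyle\sum_{i} t_iX_i \text{ is singular over } F\}.$$ It is a known fact that $\mathrm{NSING}_{n,m}$ equals the null cone of the left-right action of $\mathrm{SL}_n\times\mathrm{SL}_n$ on $\mathrm{Mat}_n^m$, $(P,Q)\cdot(X_1,\dots,X_m)=(PX_1Q^t,\dots,PX_mQ^t)$. An algebraic group means a linear algebraic group over $\mathbb{C}$.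 It is reductive if every rational representation of it is a direct sum of irreducible representations. "Acting algebraically by linear transformations on $V$" means that the action is given by a morphism of algebraic groups $G\to \mathrm{GL}(V)$. The null cone of the action of $G$ on $V$ is $\mathcal{N}_G(V)=\{v\in V : 0\in\overline{G\cdot v}\}$. *)

theory Defs
  imports
    "HOL-Library.Poly_Mapping"
    "HOL-Library.FuncSet"
    "HOL-Computational_Algebra.Fraction_Field"
    "HOL-Algebra.Group_Action"
    "HOL-Algebra.Subrings"
    "Jordan_Normal_Form.VS_Connect"
begin

section \<open>Matrices over rings and skew fields given by carriers\<close>

definition skew_field :: "('a, 'b) ring_scheme \<Rightarrow> bool" where
  "skew_field K \<longleftrightarrow> ring K \<and> Units K = carrier K - {\<zero>\<^bsub>K\<^esub>}"

definition singular_over :: "('a, 'b) ring_scheme \<Rightarrow> nat \<Rightarrow> (nat \<Rightarrow> nat \<Rightarrow> 'a) \<Rightarrow> bool" where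
  "singular_over K n A \<longleftrightarrow>
     \<not> (\<exists>B. (\<forall>i<n. \<forall>j<n. B i j \<in> carrier K) \<and>
          (\<forall>i<n. \<forall>j<n.
             (\<Oplus>\<^bsub>K\<^esub>k\<in>{..<n}. A i k \<otimes>\<^bsub>K\<^esub> B k j) = (if i = j then \<one>\<^bsub>K\<^esub> else \<zero>\<^bsub>K\<^esub>) \<and>
             (\<Oplus>\<^bsub>K\<^esub>k\<in>{..<n}. B i k \<otimes>\<^bsub>K\<^esub> A k j) = (if i = j then \<one>\<^bsub>K\<^esub> else \<zero>\<^bsub>K\<^esub>)))"


section \<open>Matrix tuples\<close>

definition mat_tuples :: "nat \<Rightarrow> nat \<Rightarrow> (nat \<Rightarrow> complex mat) set" where
  "mat_tuples n m = {..<m} \<rightarrow>\<^sub>E carrier_mat n n"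

definition tuple_zero :: "nat \<Rightarrow> nat \<Rightarrow> nat \<Rightarrow> complex mat" where
  "tuple_zero n m = (\<lambda>k\<in>{..<m}. 0\<^sub>m n n)"

definition tuple_add ::
    "nat \<Rightarrow> (nat \<Rightarrow> complex mat) \<Rightarrow> (nat \<Rightarrow> complex mat) \<Rightarrow> nat \<Rightarrow> complex mat" where
  "tuple_add m X Y = (\<lambda>k\<in>{..<m}. X k + Y k)"

definition tuple_smult :: "nat \<Rightarrow> complex \<Rightarrow> (nat \<Rightarrow> complex mat) \<Rightarrow> nat \<Rightarrow> complex mat" where
  "tuple_smult m c X = (\<lambda>k\<in>{..<m}. c \<cdot>\<^sub>m X k)"


section \<open>Commuting indeterminates\<close>

text \<open>The type below has indeterminates \<open>t\<^sub>0, t\<^sub>1, \<dots>\<close>; a monomial is its finitely supported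
  exponent function. The polynomials and rational functions in exactly \<open>m\<close> indeterminates
  are cut out as carriers.\<close>

type_synonym cpoly = "(nat \<Rightarrow>\<^sub>0 nat) \<Rightarrow>\<^sub>0 complex"

definition polys :: "nat \<Rightarrow> cpoly set" where
  "polys m = {p. \<forall>e \<in> Poly_Mapping.keys p. Poly_Mapping.keys e \<subseteq> {..<m}}"

definition rational_functions :: "nat \<Rightarrow> cpoly fract ring" where
  "rational_functions m =
     \<lparr>carrier = {Fract p q | p q. p \<in> polys m \<and> q \<in> polys m \<and> q \<noteq> 0},
      mult = (*), one = 1, zero = 0, add = (+)\<rparr>"

definition comm_pencil :: "nat \<Rightarrow> (nat \<Rightarrow> complex mat) \<Rightarrow> nat \<Rightarrow> nat \<Rightarrow> cpoly" where
  "comm_pencil m X i j =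
     (\<Sum>k<m. Poly_Mapping.single (Poly_Mapping.single k 1) (X k $$ (i, j)))"

definition SING :: "nat \<Rightarrow> nat \<Rightarrow> (nat \<Rightarrow> complex mat) set" where
  "SING n m = {X \<in> mat_tuples n m.
     singular_over (rational_functions m) n (\<lambda>i j. Fract (comm_pencil m X i j) 1)}"


section \<open>The free algebra and its universal skew field of fractions\<close>

datatype word = Word (letters: "nat list")

instantiation word :: monoid_add
begin

definition zero_word :: word where "0 = Word []"

definition plus_word :: "word \<Rightarrow> word \<Rightarrow> word" where
  "u + v = Word (letters u @ letters v)"

instance by standard (simp_all add: zero_word_def plus_word_def)

end

text \<open>The monoid algebra of the free monoid of words, written additively as
  \<^theory>\<open>HOL-Library.Poly_Mapping\<close> requires.\<close>

type_synonym ncpoly = "word \<Rightarrow>\<^sub>0 complex"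

definition free_algebra :: "nat \<Rightarrow> ncpoly ring" where
  "free_algebra m =
     \<lparr>carrier = {p. \<forall>w \<in> Poly_Mapping.keys p. set (letters w) \<subseteq> {..<m}},
      mult = (*), one = 1, zero = 0, add = (+)\<rparr>"

text \<open>Cohn's notions: an epic \<open>R\<close>-field is a skew field with a homomorphism from \<open>R\<close> whose image
  generates it as a skew field.\<close>

definition epic_field ::
    "('r, 'x) ring_scheme \<Rightarrow> ('a, 'y) ring_scheme \<Rightarrow> ('r \<Rightarrow> 'a) \<Rightarrow> bool" where
  "epic_field R K f \<longleftrightarrow> skew_field K \<and> f \<in> Ring.ring_hom R K \<and>
     (\<forall>S. subring S K \<longrightarrow> (\<forall>x \<in> S - {\<zero>\<^bsub>K\<^esub>}. inv\<^bsub>K\<^esub> x \<in> S) \<longrightarrow> f ` carrier R \<subseteq> S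
        \<longrightarrow> S = carrier K)"

text \<open>A specialization from \<open>K\<close> to \<open>L\<close> is an \<open>R\<close>-ring homomorphism into \<open>L\<close>, defined on a subring
  of \<open>K\<close> containing the image of \<open>R\<close>, such that every element outside the kernel has an inverse
  in that subring; two of them are identified if they agree on a smaller such domain. Any two are
  then identified: the subring on which they agree is again a domain of this kind. So uniqueness
  in the universal property is automatic and only existence is recorded.\<close>

definition has_specialization ::
    "('r, 'x) ring_scheme \<Rightarrow> ('a, 'y) ring_scheme \<Rightarrow> ('r \<Rightarrow> 'a)
      \<Rightarrow> ('b, 'z) ring_scheme \<Rightarrow> ('r \<Rightarrow> 'b) \<Rightarrow> bool" where
  "has_specialization R K f L g \<longleftrightarrow>
     (\<exists>S h. subring S K \<and> f ` carrier R \<subseteq> S \<and>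
        h \<in> Ring.ring_hom (K\<lparr>carrier := S\<rparr>) L \<and>
        (\<forall>r \<in> carrier R. h (f r) = g r) \<and>
        (\<forall>x \<in> S. h x \<noteq> \<zero>\<^bsub>L\<^esub> \<longrightarrow> x \<in> Units (K\<lparr>carrier := S\<rparr>)))"

text \<open>An epic field over the free algebra has the cardinality of the continuum, so up to isomorphism
  its carrier is a set of complex numbers. Letting \<open>L\<close> range over the type \<^typ>\<open>complex ring\<close>, whose
  operations are arbitrary, thus covers all epic fields.\<close>

definition free_skew_field :: "nat \<Rightarrow> ('f, 'y) ring_scheme \<Rightarrow> (ncpoly \<Rightarrow> 'f) \<Rightarrow> bool" where
  "free_skew_field m F f \<longleftrightarrow>
     epic_field (free_algebra m) F f \<and> inj_on f (carrier (free_algebra m)) \<and>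
     (\<forall>(L :: complex ring) g. epic_field (free_algebra m) L g
        \<longrightarrow> has_specialization (free_algebra m) F f L g)"

definition nc_pencil :: "nat \<Rightarrow> (nat \<Rightarrow> complex mat) \<Rightarrow> nat \<Rightarrow> nat \<Rightarrow> ncpoly" where
  "nc_pencil m X i j = (\<Sum>k<m. Poly_Mapping.single (Word [k]) (X k $$ (i, j)))"

definition NSING ::
    "('f, 'y) ring_scheme \<Rightarrow> (ncpoly \<Rightarrow> 'f) \<Rightarrow> nat \<Rightarrow> nat \<Rightarrow> (nat \<Rightarrow> complex mat) set" where
  "NSING F f n m = {X \<in> mat_tuples n m. singular_over F n (\<lambda>i j. f (nc_pencil m X i j))}"


section \<open>Linear algebraic groups and rational representations\<close>

text \<open>The algebra of functions generated by a set of coordinate functions.\<close>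

inductive_set poly_funs :: "('x \<Rightarrow> complex) set \<Rightarrow> ('x \<Rightarrow> complex) set"
  for C :: "('x \<Rightarrow> complex) set" where
  const: "(\<lambda>_. c) \<in> poly_funs C"
| coord: "f \<in> C \<Longrightarrow> f \<in> poly_funs C"
| add: "f \<in> poly_funs C \<Longrightarrow> g \<in> poly_funs C \<Longrightarrow> (\<lambda>x. f x + g x) \<in> poly_funs C"
| mult: "f \<in> poly_funs C \<Longrightarrow> g \<in> poly_funs C \<Longrightarrow> (\<lambda>x. f x * g x) \<in> poly_funs C"

definition zariski_closure :: "('x \<Rightarrow> complex) set \<Rightarrow> 'x set \<Rightarrow> 'x set \<Rightarrow> 'x set" where
  "zariski_closure C E S =
     {x \<in> E. \<forall>p \<in> poly_funs C. (\<forall>y \<in> S. p y = 0) \<longrightarrow> p x = 0}"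

definition GL :: "nat \<Rightarrow> complex mat monoid" where
  "GL N = units_of (ring_mat TYPE(complex) N ())"

definition GL_coords :: "nat \<Rightarrow> (complex mat \<Rightarrow> complex) set" where
  "GL_coords N = {\<lambda>A. A $$ (i, j) | i j. i < N \<and> j < N} \<union> {\<lambda>A. inverse (det A)}"

text \<open>A linear algebraic group is a Zariski closed subgroup of some \<open>GL\<^sub>N\<close>.\<close>

definition linear_algebraic_group :: "nat \<Rightarrow> complex mat set \<Rightarrow> bool" where
  "linear_algebraic_group N G \<longleftrightarrow>
     subgroup G (GL N) \<and> zariski_closure (GL_coords N) (carrier (GL N)) G = G"

definition regular_on :: "nat \<Rightarrow> complex mat set \<Rightarrow> (complex mat \<Rightarrow> complex) \<Rightarrow> bool" where
  "regular_on N G f \<longleftrightarrow> (\<exists>p \<in> poly_funs (GL_coords N). \<forall>g \<in> G. f g = p g)"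

text \<open>Morphisms of algebraic groups from \<open>G\<close> to \<open>GL\<^sub>d\<close>. Regularity of the matrix entries suffices:
  the inverse determinant at \<open>g\<close> is the determinant at the inverse of \<open>g\<close>.\<close>

definition rational_rep :: "nat \<Rightarrow> complex mat set \<Rightarrow> nat \<Rightarrow> (complex mat \<Rightarrow> complex mat) \<Rightarrow> bool" where
  "rational_rep N G d \<rho> \<longleftrightarrow>
     \<rho> \<in> hom (GL N\<lparr>carrier := G\<rparr>) (GL d) \<and>
     (\<forall>i<d. \<forall>j<d. regular_on N G (\<lambda>g. \<rho> g $$ (i, j)))"

definition subrep ::
    "complex mat set \<Rightarrow> nat \<Rightarrow> (complex mat \<Rightarrow> complex mat) \<Rightarrow> complex vec set \<Rightarrow> bool" where
  "subrep G d \<rho> W \<longleftrightarrow>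
     subspace class_ring W (module_vec TYPE(complex) d) \<and>
     (\<forall>g \<in> G. \<forall>w \<in> W. \<rho> g *\<^sub>v w \<in> W)"

definition irreducible_subrep ::
    "complex mat set \<Rightarrow> nat \<Rightarrow> (complex mat \<Rightarrow> complex mat) \<Rightarrow> complex vec set \<Rightarrow> bool" where
  "irreducible_subrep G d \<rho> W \<longleftrightarrow>
     subrep G d \<rho> W \<and> W \<noteq> {0\<^sub>v d} \<and>
     (\<forall>U. subrep G d \<rho> U \<longrightarrow> U \<subseteq> W \<longrightarrow> U = {0\<^sub>v d} \<or> U = W)"

definition direct_sum_of_irreducibles ::
    "complex mat set \<Rightarrow> nat \<Rightarrow> (complex mat \<Rightarrow> complex mat) \<Rightarrow> bool" where
  "direct_sum_of_irreducibles G d \<rho> \<longleftrightarrow>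
     (\<exists>(r :: nat) W. (\<forall>i<r. irreducible_subrep G d \<rho> (W i)) \<and>
        (\<forall>v \<in> carrier_vec d. \<exists>!w. w \<in> (\<Pi>\<^sub>E i\<in>{..<r}. W i) \<and>
           v = (\<Oplus>\<^bsub>module_vec TYPE(complex) d\<^esub>i\<in>{..<r}. w i)))"

definition reductive_group :: "nat \<Rightarrow> complex mat set \<Rightarrow> bool" where
  "reductive_group N G \<longleftrightarrow> linear_algebraic_group N G \<and>
     (\<forall>d \<rho>. rational_rep N G d \<rho> \<longrightarrow> direct_sum_of_irreducibles G d \<rho>)"


section \<open>Algebraic linear actions on matrix tuples\<close>

definition tuple_coords :: "nat \<Rightarrow> nat \<Rightarrow> ((nat \<Rightarrow> complex mat) \<Rightarrow> complex) set" where
  "tuple_coords n m = {\<lambda>X. X k $$ (i, j) | k i j. k < m \<and> i < n \<and> j < n}"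

text \<open>A morphism of algebraic groups from \<open>G\<close> to the general linear group of the space of tuples.
  The functions \<open>g \<mapsto> (g \<cdot> X)\<^sub>k\<^sub>i\<^sub>j\<close> with \<open>X\<close> in the standard basis are the matrix entries of the
  morphism; for general \<open>X\<close> they are linear combinations of these.\<close>

definition algebraic_linear_action ::
    "nat \<Rightarrow> complex mat set \<Rightarrow> nat \<Rightarrow> nat
      \<Rightarrow> (complex mat \<Rightarrow> (nat \<Rightarrow> complex mat) \<Rightarrow> nat \<Rightarrow> complex mat) \<Rightarrow> bool" where
  "algebraic_linear_action N G n m \<phi> \<longleftrightarrow>
     group_action (GL N\<lparr>carrier := G\<rparr>) (mat_tuples n m) \<phi> \<and>
     (\<forall>g \<in> G. \<forall>X \<in> mat_tuples n m. \<forall>Y \<in> mat_tuples n m.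
        \<phi> g (tuple_add m X Y) = tuple_add m (\<phi> g X) (\<phi> g Y)) \<and>
     (\<forall>g \<in> G. \<forall>c. \<forall>X \<in> mat_tuples n m.
        \<phi> g (tuple_smult m c X) = tuple_smult m c (\<phi> g X)) \<and>
     (\<forall>X \<in> mat_tuples n m. \<forall>k<m. \<forall>i<n. \<forall>j<n. regular_on N G (\<lambda>g. \<phi> g X k $$ (i, j)))"

text \<open>The closure of the orbit is taken in the Zariski topology; since orbits are constructible, it
  agrees with the Euclidean closure.\<close>

definition null_cone ::
    "nat \<Rightarrow> complex mat set \<Rightarrow> nat \<Rightarrow> nat
      \<Rightarrow> (complex mat \<Rightarrow> (nat \<Rightarrow> complex mat) \<Rightarrow> nat \<Rightarrow> complex mat)
      \<Rightarrow> (nat \<Rightarrow> complex mat) set" where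
  "null_cone N G n m \<phi> = {X \<in> mat_tuples n m.
     tuple_zero n m \<in>
       zariski_closure (tuple_coords n m) (mat_tuples n m) (orbit (GL N\<lparr>carrier := G\<rparr>) \<phi> X)}"

end

theory Submission
  imports Defs "HOL-Library.Function_Algebras" "HOL-Computational_Algebra.Fundamental_Theorem_Algebra"
    "HOL-Computational_Algebra.Polynomial_Factorial" "Jordan_Normal_Form.Column_Operations"
begin

text \<open>Let \<open>X\<close> lie in the null cone but not in \<open>NSING\<close>. A linear bijection preserving \<open>SING\<close> preserves
  the tuples \<open>u \<otimes> \<rho>\<close> with a common column or row factor, hence has the form
  \<open>X \<mapsto> (\<Sum>\<^sub>c R\<^sub>k\<^sub>c P X\<^sub>c Q)\<^sub>k\<close>, possibly followed by transposition. So every \<open>g \<in> G\<close> is given by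
  matrices \<open>P\<close>, \<open>Q\<close>, \<open>R\<close>, whose entries are functions of \<open>g\<close>.

  Since polynomials vanishing on the orbit of \<open>X\<close> vanish at \<open>0\<close>, the assignment
  \<open>p(g X) \<mapsto> p(0)\<close> is a partial homomorphism on the ring of all functions of \<open>g\<close>. A maximal extension is a place,
  and it replaces the one-parameter subgroup of the Hilbert-Mumford criterion: over it, \<open>P\<close>, \<open>Q\<close>, \<open>R\<close> have a
  Smith form, diagonal up to invertible matrices with values. As \<open>X \<notin> NSING\<close>, the tuple \<open>X\<close> has a transversal
  of nonzero entries in the bases given by these values, so certain products of diagonal entries have value \<open>0\<close>.
  Therefore a permutation matrix, put into the slot with the most divisible diagonal entry of \<open>R\<close>, is driven to
  \<open>0\<close> as well. Undoing the base changes yields a family of tuples \<open>Y(g)\<close> with value \<open>y\<close> such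
  that \<open>g Y(g)\<close> has value \<open>0\<close>. By reductivity invariants separate the points outside the null cone from \<open>0\<close>,
  so \<open>y\<close> lies in the null cone, hence in \<open>SING\<close>; but the matrices of \<open>y\<close> span an invertible matrix.\<close>

text \<open>The matrices \<open>P\<close>, \<open>Q\<close>, \<open>R\<close> and the transposition
  bit are picked for each \<open>g\<close> separately, with no regularity in \<open>g\<close>;
  therefore the place lives on the ring of all functions. Its zero divisors shape the first half:
  inverses are pointwise, indicators have value 0 or 1, and equations hold after multiplication by a
  function of value 1. Algebraic closedness keeps the values in the complex numbers. Rank one
  tensors are recognised from \<open>SING\<close> and addition alone, because the determinant is
  affine along a rank one direction. The skew field enters through a transversal of nonzero entries
  in every pair of constant bases. These entries may sit in different slots, whereas the invertible
  matrix has to come from a single one; the slot whose diagonal entry is a multiple of all the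
  others makes every product that is needed a multiple of one known to have value 0. As
  \<open>Y(g)\<close> varies with \<open>g\<close>, its value \<open>y\<close> cannot be reached
  along one orbit; invariant polynomials still compare it with 0.\<close>

text \<open>Induction and calculational steps leave eta-expanded goals, on which the pointwise rules
  would rewrite under the binder.\<close>

lemmas fun_apply = plus_fun_apply zero_fun_apply times_fun_apply one_fun_apply

declare fun_apply [simp del]

section \<open>Places on rings of functions\<close>

text \<open>A partial \<open>\<complex>\<close>-valued homomorphism on a ring of functions is kept as its graph \<open>H\<close>: the domain
  \<open>fst ` H\<close> is a subalgebra and \<open>(f, a) \<in> H\<close> says that \<open>f\<close> has the value \<open>a\<close>.\<close>

definition part_hom :: "(('a \<Rightarrow> complex) \<times> complex) set \<Rightarrow> bool" where
  "part_hom H \<longleftrightarrow> (\<forall>c. ((\<lambda>_. c), c) \<in> H) \<and>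
     (\<forall>f a g b. (f, a) \<in> H \<longrightarrow> (g, b) \<in> H \<longrightarrow> (f + g, a + b) \<in> H \<and> (f * g, a * b) \<in> H) \<and>
     (\<forall>c. (0, c) \<in> H \<longrightarrow> c = 0)"

lemma part_homI:
  assumes "\<And>c. ((\<lambda>_. c), c) \<in> H"
    and "\<And>f a g b. (f, a) \<in> H \<Longrightarrow> (g, b) \<in> H \<Longrightarrow> (f + g, a + b) \<in> H \<and> (f * g, a * b) \<in> H"
    and "\<And>c. (0, c) \<in> H \<Longrightarrow> c = 0"
  shows "part_hom H"
  unfolding part_hom_def using assms by blast

lemma part_hom_const: "part_hom H \<Longrightarrow> ((\<lambda>_. c), c) \<in> H"
  and part_hom_add: "part_hom H \<Longrightarrow> (f, a) \<in> H \<Longrightarrow> (g, b) \<in> H \<Longrightarrow> (f + g, a + b) \<in> H"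
  and part_hom_mult: "part_hom H \<Longrightarrow> (f, a) \<in> H \<Longrightarrow> (g, b) \<in> H \<Longrightarrow> (f * g, a * b) \<in> H"
  and part_hom_zero: "part_hom H \<Longrightarrow> (0, c) \<in> H \<Longrightarrow> c = 0"
  unfolding part_hom_def by blast+

lemma part_hom_0: "part_hom H \<Longrightarrow> (0, 0) \<in> H"
  and part_hom_1: "part_hom H \<Longrightarrow> (1, 1) \<in> H"
  using part_hom_const[of H 0] part_hom_const[of H 1] by (auto simp: zero_fun_def one_fun_def)

lemma part_hom_uminus:
  assumes "part_hom H" "(f, a) \<in> H" shows "(- f, - a) \<in> H"
proof -
  have "((\<lambda>_. - 1) * f, - 1 * a) \<in> H"
    using assms by (intro part_hom_mult part_hom_const)
  moreover have "(\<lambda>_. - 1) * f = - f" by (auto simp: fun_eq_iff fun_apply)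
  ultimately show ?thesis by simp
qed

lemma part_hom_diff:
  assumes "part_hom H" "(f, a) \<in> H" "(g, b) \<in> H" shows "(f - g, a - b) \<in> H"
  using part_hom_add[OF assms(1,2) part_hom_uminus[OF assms(1,3)]] by simp

lemma part_hom_unique:
  assumes "part_hom H" "(f, a) \<in> H" "(f, b) \<in> H" shows "a = b"
  using part_hom_zero[OF assms(1), of "a - b"] part_hom_diff[OF assms(1,2,3)] by simp

lemma part_hom_sum:
  assumes "part_hom H" "\<And>i. i \<in> I \<Longrightarrow> (f i, a i) \<in> H" shows "(sum f I, sum a I) \<in> H"
  using assms(2)
  by (induction I rule: infinite_finite_induct)
     (auto intro: part_hom_add part_hom_0 assms(1))

lemma part_hom_power:
  assumes "part_hom H" "(f, a) \<in> H" shows "(f ^ k, a ^ k) \<in> H"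
  by (induction k) (auto intro: part_hom_mult part_hom_1 assms)

section \<open>Reduction of polynomials with function coefficients\<close>

definition poly_rel :: "(('a \<Rightarrow> complex) \<times> complex) set \<Rightarrow> ('a \<Rightarrow> complex) poly \<Rightarrow> complex poly \<Rightarrow> bool" where
  "poly_rel H p q \<longleftrightarrow> (\<forall>i. (coeff p i, coeff q i) \<in> H)"

lemma poly_rel_add: "part_hom H \<Longrightarrow> poly_rel H p q \<Longrightarrow> poly_rel H p' q' \<Longrightarrow> poly_rel H (p + p') (q + q')"
  unfolding poly_rel_def by (simp add: part_hom_add)

lemma poly_rel_diff: "part_hom H \<Longrightarrow> poly_rel H p q \<Longrightarrow> poly_rel H p' q' \<Longrightarrow> poly_rel H (p - p') (q - q')"
  unfolding poly_rel_def by (simp add: part_hom_diff)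

lemma poly_rel_mult: "part_hom H \<Longrightarrow> poly_rel H p q \<Longrightarrow> poly_rel H p' q' \<Longrightarrow> poly_rel H (p * p') (q * q')"
  unfolding poly_rel_def coeff_mult by (auto intro!: part_hom_sum part_hom_mult)

lemma poly_rel_smult: "part_hom H \<Longrightarrow> (f, a) \<in> H \<Longrightarrow> poly_rel H p q \<Longrightarrow> poly_rel H (smult f p) (smult a q)"
  unfolding poly_rel_def by (simp add: part_hom_mult)

lemma poly_rel_pCons: "(f, a) \<in> H \<Longrightarrow> poly_rel H p q \<Longrightarrow> poly_rel H (pCons f p) (pCons a q)"
  unfolding poly_rel_def by (auto simp: coeff_pCons split: nat.split)

lemma poly_rel_0: "part_hom H \<Longrightarrow> poly_rel H 0 0"
  unfolding poly_rel_def by (simp add: part_hom_0)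

lemma poly_rel_const: "part_hom H \<Longrightarrow> (f, a) \<in> H \<Longrightarrow> poly_rel H [:f:] [:a:]"
  by (intro poly_rel_pCons poly_rel_0)

lemma poly_rel_monom: "part_hom H \<Longrightarrow> (f, a) \<in> H \<Longrightarrow> poly_rel H (monom f k) (monom a k)"
  unfolding poly_rel_def by (simp add: part_hom_0)

text \<open>Constant functions lift complex numbers. Hence the reductions of the polynomials killing
  \<open>f\<close> are closed under multiplication by any complex polynomial, as an ideal must
  be.\<close>

lemma poly_rel_lift:
  assumes "part_hom H" shows "\<exists>p. poly_rel H p q"
proof (induction q)
  case 0 then show ?case using poly_rel_0[OF assms] by blast
next
  case (pCons a q) then show ?case using poly_rel_pCons part_hom_const[OF assms] by blast
qed

text \<open>Maximality is with respect to inclusion of graphs. By \<open>place_dichotomy\<close> the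
  domain then behaves like a valuation ring with residue field the complex numbers.\<close>

definition place :: "(('a \<Rightarrow> complex) \<times> complex) set \<Rightarrow> bool" where
  "place H \<longleftrightarrow> part_hom H \<and> (\<forall>H'. part_hom H' \<longrightarrow> H \<subseteq> H' \<longrightarrow> H' = H)"

lemma place_part_hom: "place H \<Longrightarrow> part_hom H"
  unfolding place_def by blast

lemma place_extending:
  assumes "part_hom H0" shows "\<exists>H. place H \<and> H0 \<subseteq> H"
proof -
  define A where "A = {H. part_hom H \<and> H0 \<subseteq> H}"
  have "\<exists>U\<in>A. \<forall>X\<in>C. X \<subseteq> U" if C: "subset.chain A C" for C
  proof (cases "C = {}")
    case True then show ?thesis using assms A_def by blast
  next
    case False
    have CA: "C \<subseteq> A" and tot: "\<And>X Y. X \<in> C \<Longrightarrow> Y \<in> C \<Longrightarrow> X \<subseteq> Y \<or> Y \<subseteq> X"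
      using C by (auto simp: subset.chain_def)
    have "part_hom (\<Union>C)"
      unfolding part_hom_def
    proof (intro conjI allI impI)
      fix c show "((\<lambda>_. c), c) \<in> \<Union>C"
        using False CA part_hom_const unfolding A_def by blast
    next
      fix c assume "(0, c) \<in> \<Union>C" then show "c = 0"
        using CA part_hom_zero unfolding A_def by blast
    next
      fix f a g b assume "(f, a) \<in> \<Union>C" "(g, b) \<in> \<Union>C"
      then obtain X where X: "X \<in> C" "(f, a) \<in> X" "(g, b) \<in> X" using tot by blast
      then have "part_hom X" using CA A_def by blast
      then show "(f + g, a + b) \<in> \<Union>C" "(f * g, a * b) \<in> \<Union>C"
        using X part_hom_add part_hom_mult by blast+
    qed
    moreover have "H0 \<subseteq> \<Union>C" using False CA A_def by blast
    ultimately show ?thesis unfolding A_def by blast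
  qed
  then obtain M where "M \<in> A" "\<forall>X\<in>A. M \<subseteq> X \<longrightarrow> X = M"
    using subset_Zorn[of A] by blast
  then have "place M \<and> H0 \<subseteq> M" unfolding A_def place_def by auto
  then show ?thesis by blast
qed

text \<open>By maximality every complex number fails as a value at \<open>f\<close>, so the ideal of reductions of
  the polynomials killing \<open>f\<close> has no zero.\<close>

lemma place_relation:
  assumes H: "place H" and f: "f \<notin> fst ` H"
  shows "\<exists>p. poly_rel H p 1 \<and> poly p f = 0"
proof -
  have ph: "part_hom H" using H by (rule place_part_hom)
  define I where "I = {q. \<exists>p. poly_rel H p q \<and> poly p f = 0}"
  have nz: "\<exists>q\<in>I. poly q \<alpha> \<noteq> 0" for \<alpha>
  proof (rule ccontr)
    assume neg: "\<not> ?thesis"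
    \<comment> \<open>If all reductions vanished at \<alpha>, evaluation at \<open>f\<close> on one
      side and at \<alpha> on the other would be a partial homomorphism extending \<open>H\<close>,
      and \<open>f\<close> would receive the value \<alpha>.\<close>
    define H' where "H' = {(poly p f, poly q \<alpha>) | p q. poly_rel H p q}"
    have memI: "(poly p f, poly q \<alpha>) \<in> H'" if "poly_rel H p q" for p q
      unfolding H'_def using that by blast
    have sub: "(g, b) \<in> H'" if "(g, b) \<in> H" for g b
      using memI[OF poly_rel_const[OF ph that]] by simp
    have "part_hom H'" unfolding part_hom_def
    proof (intro conjI allI impI)
      fix c show "((\<lambda>_. c), c) \<in> H'" using sub part_hom_const[OF ph] by blast
    next
      fix c assume "(0, c) \<in> H'"
      then show "c = 0" using neg unfolding H'_def I_def by auto
    next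
      fix g a h b assume "(g, a) \<in> H'" "(h, b) \<in> H'"
      then obtain p q p' q' where *: "poly_rel H p q" "poly_rel H p' q'"
        "g = poly p f" "a = poly q \<alpha>" "h = poly p' f" "b = poly q' \<alpha>"
        unfolding H'_def by blast
      show "(g + h, a + b) \<in> H'" "(g * h, a * b) \<in> H'"
        using memI[OF poly_rel_add[OF ph *(1,2)]] memI[OF poly_rel_mult[OF ph *(1,2)]] *
        by simp_all
    qed
    then have "H' = H" using H sub unfolding place_def by auto
    moreover have "(f, \<alpha>) \<in> H'"
      using memI[OF poly_rel_pCons[OF part_hom_0[OF ph] poly_rel_const[OF ph part_hom_1[OF ph]]]]
      by simp
    ultimately show False using f by force
  qed
  have diff: "q - q' \<in> I" if qq: "q \<in> I" "q' \<in> I" for q q'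
  proof -
    obtain p p' where "poly_rel H p q" "poly p f = 0" "poly_rel H p' q'" "poly p' f = 0"
      using qq unfolding I_def by blast
    then have "poly_rel H (p - p') (q - q') \<and> poly (p - p') f = 0"
      using poly_rel_diff[OF ph] by simp
    then show ?thesis unfolding I_def by blast
  qed
  have mult: "r * q \<in> I" if "q \<in> I" for q r
  proof -
    obtain p where "poly_rel H p q" "poly p f = 0" using \<open>q \<in> I\<close> unfolding I_def by blast
    moreover obtain s where "poly_rel H s r" using poly_rel_lift[OF ph] by blast
    ultimately have "poly_rel H (s * p) (r * q) \<and> poly (s * p) f = 0"
      using poly_rel_mult[OF ph] by simp
    then show ?thesis unfolding I_def by blast
  qed
  obtain q0 where q0: "q0 \<in> I" "q0 \<noteq> 0" using nz[of 0] poly_0 by metis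
  \<comment> \<open>A nonzero element of least degree generates the ideal. A root of it would be a
    common zero, so it is constant and the ideal contains 1.\<close>
  define P where "P = (\<lambda>d. \<exists>q\<in>I. q \<noteq> 0 \<and> degree q = d)"
  have "P (degree q0)" using q0 P_def by blast
  then have "P (LEAST d. P d)" by (rule LeastI)
  then obtain q where q: "q \<in> I" "q \<noteq> 0" "degree q = (LEAST d. P d)" unfolding P_def by blast
  have min: "r = 0" if "r \<in> I" "degree r < degree q" for r
    using that q not_less_Least[of "degree r" P] unfolding P_def by auto
  have dvd: "q dvd r" if "r \<in> I" for r
  proof -
    have "r mod q = r - (r div q) * q" by (simp add: minus_div_mult_eq_mod)
    then have "r mod q \<in> I" using diff[OF that mult[OF q(1)]] by simp
    moreover have "r mod q = 0 \<or> degree (r mod q) < degree q" using degree_mod_less q(2) by blast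
    ultimately have "r mod q = 0" using min by blast
    then show ?thesis by (rule mod_0_imp_dvd)
  qed
  have "degree q = 0"
  proof (rule ccontr)
    assume "degree q \<noteq> 0"
    then obtain \<alpha> where "poly q \<alpha> = 0"
      using fundamental_theorem_of_algebra[of q] by (auto simp: constant_degree)
    then show False using nz[of \<alpha>] dvd by (metis dvdE mult_zero_left poly_mult)
  qed
  then obtain c where c: "q = [:c:]" "c \<noteq> 0" using q(2) degree_eq_zeroE by (metis pCons_0_0)
  have "[:1 / c:] * q \<in> I" using mult[OF q(1)] .
  then have "1 \<in> I" using c by (simp add: one_pCons)
  then show ?thesis unfolding I_def by blast
qed

lemma poly_altdef_ge:
  fixes p :: "'r::comm_semiring_1 poly"
  assumes "degree p \<le> d" shows "poly p x = (\<Sum>i\<le>d. coeff p i * x ^ i)"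
proof -
  have "(\<Sum>i\<le>d. coeff p i * x ^ i) = (\<Sum>i\<le>degree p. coeff p i * x ^ i)"
    using assms by (intro sum.mono_neutral_right) (auto simp: coeff_eq_0)
  then show ?thesis by (simp add: poly_altdef)
qed

lemma poly_rel_one_coeff:
  assumes "poly_rel H p 1"
  shows "(coeff p 0, 1) \<in> H" "i > 0 \<Longrightarrow> (coeff p i, 0) \<in> H"
  using assms[unfolded poly_rel_def, rule_format, of 0] assms[unfolded poly_rel_def, rule_format, of i]
  by auto

text \<open>All positive powers of \<open>e\<close> coincide, so a relation for \<open>e\<close> has
  the form c + r e = 0 with c of value 1 and r of value 0. Multiplying by c + r, which annihilates
  \<open>e\<close>, gives c (c + r) = 0, although this product has value 1.\<close>

lemma place_idempotent:
  assumes H: "place H" and e: "e * e = e"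
  shows "e \<in> fst ` H"
proof (rule ccontr)
  assume "e \<notin> fst ` H"
  then obtain p where p: "poly_rel H p 1" "poly p e = 0" using place_relation[OF H] by blast
  have ph: "part_hom H" using H by (rule place_part_hom)
  define r where "r = (\<Sum>i\<in>{1..degree p}. coeff p i)"
  have r: "(r, 0) \<in> H"
    unfolding r_def using part_hom_sum[OF ph, of "{1..degree p}" "coeff p" "\<lambda>_. 0"]
      poly_rel_one_coeff(2)[OF p(1)] by auto
  have p0: "(coeff p 0, 1) \<in> H" using poly_rel_one_coeff(1)[OF p(1)] .
  have pow: "e ^ i = e" if "i \<ge> 1" for i
    using that by (induction i rule: dec_induct) (auto simp: e)
  have "poly p e = (\<Sum>i\<in>{..degree p}. coeff p i * e ^ i)" by (simp add: poly_altdef)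
  also have "{..degree p} = insert 0 {1..degree p}" by auto
  also have "(\<Sum>i\<in>insert 0 {1..degree p}. coeff p i * e ^ i) = coeff p 0 + r * e"
    by (simp add: r_def sum_distrib_right pow)
  finally have 1: "coeff p 0 = - (r * e)" using p(2) by (simp add: eq_neg_iff_add_eq_0)
  have "coeff p 0 * (coeff p 0 + r) = 0"
  proof -
    have "(coeff p 0 + r) * e = - (r * (e * e)) + r * e"
      unfolding 1 by (simp add: algebra_simps)
    then have "(coeff p 0 + r) * e = 0" by (simp add: e)
    then have "- r * ((coeff p 0 + r) * e) = 0" by (simp only: mult_zero_right)
    moreover have "- (r * e) * (coeff p 0 + r) = - r * ((coeff p 0 + r) * e)"
      by (simp add: algebra_simps)
    ultimately show ?thesis using 1 by metis
  qed
  moreover have "(coeff p 0 * (coeff p 0 + r), 1 * (1 + 0)) \<in> H"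
    using ph p0 r by (intro part_hom_mult part_hom_add)
  ultimately show False using part_hom_zero[OF ph, of 1] by simp
qed

text \<open>As \<open>inverse 0 = 0\<close>, pointwise inversion is total, and
  \<open>f * pinv f\<close> is the indicator of the support of \<open>f\<close>.\<close>

definition pinv :: "('a \<Rightarrow> complex) \<Rightarrow> 'a \<Rightarrow> complex" where
  "pinv f = (\<lambda>x. inverse (f x))"

lemma pinv_pinv [simp]: "pinv (pinv f) = f"
  and pinv_mult: "pinv (f * g) = pinv f * pinv g"
  by (auto simp: pinv_def fun_apply)

lemma pinv_supp: "f * (f * pinv f) = f"
proof
  fix x show "(f * (f * pinv f)) x = f x"
    by (cases "f x = 0") (auto simp: pinv_def fun_apply)
qed

lemma pinv_supp': "pinv f * (f * pinv f) = pinv f"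
  using pinv_supp[of "pinv f"] by (simp add: mult.commute)

lemma pinv_idem: "(f * pinv f) * (f * pinv f) = f * pinv f"
  using pinv_supp[of f] by (metis mult.assoc mult.commute)

text \<open>A relation for \<open>f\<close> of degree d, multiplied by e^d, becomes an expression in
  \<open>e\<close> and \<open>e * f\<close>, which both have values. It is zero, but its value is
  that of the polynomial 1 at \<open>a\<close>.\<close>

lemma place_ae_value:
  assumes H: "place H" and e: "(e, 1) \<in> H" and ef: "(e * f, a) \<in> H"
  shows "(f, a) \<in> H"
proof -
  have ph: "part_hom H" using H by (rule place_part_hom)
  have "f \<in> fst ` H"
  proof (rule ccontr)
    assume "f \<notin> fst ` H"
    then obtain p where p: "poly_rel H p 1" "poly p f = 0" using place_relation[OF H] by blast
    define d where "d = degree p"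
    have "(\<Sum>i\<le>d. coeff p i * (e ^ (d - i) * (e * f) ^ i)) = e ^ d * poly p f"
      unfolding poly_altdef d_def[symmetric] sum_distrib_left
    proof (intro sum.cong refl)
      fix i assume "i \<in> {..d}"
      then have "e ^ d = e ^ (d - i) * e ^ i" by (simp flip: power_add)
      then show "coeff p i * (e ^ (d - i) * (e * f) ^ i) = e ^ d * (coeff p i * f ^ i)"
        by (simp add: power_mult_distrib ac_simps)
    qed
    moreover have "((\<Sum>i\<le>d. coeff p i * (e ^ (d - i) * (e * f) ^ i)),
        (\<Sum>i\<le>d. coeff (1 :: complex poly) i * (1 ^ (d - i) * a ^ i))) \<in> H"
      using p(1) unfolding poly_rel_def
      by (intro part_hom_sum part_hom_mult part_hom_power ph e ef) auto
    moreover have "(\<Sum>i\<le>d. coeff (1 :: complex poly) i * (1 ^ (d - i) * a ^ i)) = 1"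
    proof -
      have "(\<Sum>i\<le>d. coeff (1 :: complex poly) i * (1 ^ (d - i) * a ^ i)) = poly 1 a"
        by (subst poly_altdef_ge[of _ d]) simp_all
      then show ?thesis by simp
    qed
    ultimately show False using part_hom_zero[OF ph, of 1] p(2) by simp
  qed
  then obtain b where b: "(f, b) \<in> H" by force
  from part_hom_mult[OF ph e b] have "(e * f, b) \<in> H" by simp
  then show ?thesis using b part_hom_unique[OF ph _ ef] by blast
qed

text \<open>The degree descent of Chevalley's extension theorem, with \<open>g\<close> inverse to
  \<open>f\<close> only on a support of value 1. Relations for \<open>f\<close> and \<open>g\<close>
  that both reduce to 1 would yield one of smaller degree, by eliminating a leading term against the
  reversal of the other relation.\<close>

lemma part_hom_no_relations:
  assumes ph: "part_hom H" and w: "(f * g, 1) \<in> H" and fg: "f * (f * g) = f" "g * (f * g) = g"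
    and p: "poly_rel H p 1" "poly p f = 0" and q: "poly_rel H q 1" "poly q g = 0"
  shows False
  using w fg p q
proof (induction "degree p + degree q" arbitrary: f g p q rule: less_induct)
  case less
  have step: False if fg: "(f * g, 1) \<in> H" "f * (f * g) = f" "g * (f * g) = g"
      and p: "poly_rel H p 1" "poly p f = 0" and q: "poly_rel H q 1" "poly q g = 0"
      and deg: "degree q \<le> degree p"
      and IH: "\<And>p'. degree p' < degree p \<Longrightarrow> poly_rel H p' 1 \<Longrightarrow> poly p' f = 0 \<Longrightarrow> False"
    for f g p q
  proof (cases "degree p = 0")
    case True
    then have "coeff p 0 = 0" using p(2) by (simp add: poly_altdef)
    then show False using poly_rel_one_coeff(1)[OF p(1)] part_hom_zero[OF ph, of 1] by simp
  next
    case False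
    define d e w where "d = degree p" and "e = degree q" and "w = f * g"
    have ww: "w * w = w" using fg(2) unfolding w_def by (metis mult.assoc mult.commute)
    have wpow: "w ^ j * w = w" for j by (induction j) (simp_all add: ww mult.assoc)
    \<comment> \<open>The reversal of \<open>q\<close>: r(f) = f^e w q(g), where the idempotent
      \<open>w\<close> absorbs the products f^j g^j. Its coefficient at \<open>e\<close> has value
      1, the others have value 0.\<close>
    define r where "r = (\<Sum>j\<le>e. monom (w * coeff q j) (e - j))"
    have "poly_rel H r (\<Sum>j\<le>e. monom (1 * coeff (1 :: complex poly) j) (e - j))"
      unfolding r_def poly_rel_def coeff_sum
    proof (intro allI part_hom_sum[OF ph])
      fix i j
      have "(w * coeff q j, 1 * coeff 1 j) \<in> H"
        using fg(1) q(1) unfolding w_def poly_rel_def by (intro part_hom_mult[OF ph]) auto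
      then show "(coeff (monom (w * coeff q j) (e - j)) i,
          coeff (monom (1 * coeff (1 :: complex poly) j) (e - j)) i) \<in> H"
        using part_hom_0[OF ph] by simp
    qed
    moreover have "(\<Sum>j\<le>e. monom (1 * coeff (1 :: complex poly) j) (e - j)) = monom 1 e"
      by (simp add: atMost_atLeast0 sum.atLeast_Suc_atMost)
    ultimately have r: "poly_rel H r (monom 1 e)" by simp
    have "poly r f = (\<Sum>j\<le>e. w * coeff q j * f ^ (e - j))"
      unfolding r_def by (simp add: poly_sum poly_monom)
    also have "\<dots> = (\<Sum>j\<le>e. (f ^ e * w) * (coeff q j * g ^ j))"
    proof (intro sum.cong refl)
      fix j assume "j \<in> {..e}"
      then have "f ^ e = f ^ (e - j) * f ^ j" by (simp flip: power_add)
      then have "(f ^ e * w) * (coeff q j * g ^ j) = f ^ (e - j) * coeff q j * (w ^ j * w)"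
        by (simp add: w_def power_mult_distrib ac_simps)
      then show "w * coeff q j * f ^ (e - j) = (f ^ e * w) * (coeff q j * g ^ j)"
        unfolding wpow by (simp only: ac_simps)
    qed
    also have "\<dots> = (f ^ e * w) * poly q g"
      by (simp add: poly_altdef sum_distrib_left e_def)
    finally have rf: "poly r f = 0" using q(2) by simp
    have degr: "degree r \<le> e"
      unfolding r_def by (intro degree_sum_le) (auto intro: order.trans[OF degree_monom_le])
    \<comment> \<open>The leading coefficient of \<open>p\<close> has value 0, so removing the top
      term with a multiple of \<open>r\<close> leaves the reduction equal to 1.\<close>
    define p' where "p' = smult (coeff r e) p - monom (coeff p d) (d - e) * r"
    have "(coeff r e, 1) \<in> H" using r[unfolded poly_rel_def, rule_format, of e] by simp
    moreover have "(coeff p d, 0) \<in> H"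
      using poly_rel_one_coeff(2)[OF p(1)] False d_def by blast
    ultimately have "poly_rel H p' (smult 1 1 - monom 0 (d - e) * monom 1 e)"
      unfolding p'_def
      by (intro poly_rel_diff poly_rel_smult poly_rel_mult poly_rel_monom ph p(1) r)
    then have 1: "poly_rel H p' 1" by (simp add: one_pCons)
    have 2: "poly p' f = 0" unfolding p'_def by (simp add: p(2) rf)
    have "degree (smult (coeff r e) p) \<le> d" unfolding d_def by (rule degree_smult_le)
    moreover have "degree (monom (coeff p d) (d - e) * r) \<le> d"
    proof -
      have "degree (monom (coeff p d) (d - e) * r) \<le> degree (monom (coeff p d) (d - e)) + degree r"
        by (rule degree_mult_le)
      also have "\<dots> \<le> (d - e) + e" using degr by (intro add_mono degree_monom_le)
      finally show ?thesis using deg d_def e_def by simp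
    qed
    ultimately have "degree p' \<le> d" unfolding p'_def by (intro degree_diff_le)
    moreover have "coeff p' d = 0"
      using deg unfolding p'_def by (simp add: coeff_monom_mult d_def e_def)
    ultimately have "degree p' < d" using eq_zero_or_degree_less False d_def
      by (metis degree_0 gr0I)
    then show False using IH[of p'] 1 2 d_def by blast
  qed
  show ?case
  proof (cases "degree q \<le> degree p")
    case True
    show ?thesis
    proof (rule step[of f g p q])
      fix p' assume "degree p' < degree p" "poly_rel H p' 1" "poly p' f = 0"
      then show False using less.hyps[of p' q f g] less.prems by simp
    qed (use less.prems True in auto)
  next
    case False
    show ?thesis
    proof (rule step[of g f q p])
      fix p' assume "degree p' < degree q" "poly_rel H p' 1" "poly p' g = 0"
      then show False using less.hyps[of p p' f g] less.prems by simp
    qed (use less.prems False in \<open>auto simp: mult.commute\<close>)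
  qed
qed

text \<open>The support indicator of \<open>f\<close> has value 0 or 1. With value 0,
  \<open>f\<close> itself has value 0. With value 1, a value b of \<open>pinv f\<close> satisfies
  b^d = 0, by multiplying a relation for \<open>f\<close> with the d-th power of
  \<open>pinv f\<close>; if neither function has a value, \<open>part_hom_no_relations\<close>
  applies.\<close>

theorem place_dichotomy:
  assumes H: "place H"
  shows "f \<in> fst ` H \<or> (pinv f, 0) \<in> H"
proof (rule ccontr)
  assume "\<not> ?thesis"
  then have f: "f \<notin> fst ` H" and g: "(pinv f, 0) \<notin> H" by auto
  have ph: "part_hom H" using H by (rule place_part_hom)
  define w where "w = f * pinv f"
  have ww: "w * w = w" unfolding w_def by (rule pinv_idem)
  obtain c where c: "(w, c) \<in> H" using place_idempotent[OF H ww] by force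
  have "c * c = c" using part_hom_unique[OF ph] part_hom_mult[OF ph c c] c ww by metis
  then consider "c = 0" | "c = 1" by (metis mult_cancel_right1)
  then show False
  proof cases
    case 1
    have "(1 - w, 1) \<in> H" using part_hom_diff[OF ph part_hom_1[OF ph] c] 1 by simp
    moreover have "(1 - w) * f = 0"
      using pinv_supp[of f] by (simp add: left_diff_distrib w_def mult.commute[of "f * pinv f" f])
    ultimately have "(f, 0) \<in> H" using place_ae_value[OF H, of "1 - w" f 0] part_hom_0[OF ph] by simp
    then show False using f by force
  next
    case 2
    obtain p where p: "poly_rel H p 1" "poly p f = 0" using place_relation[OF H f] by blast
    show False
    proof (cases "pinv f \<in> fst ` H")
      case True
      then obtain b where b: "(pinv f, b) \<in> H" by force
      define d where "d = degree p"
      have wpow: "w ^ j * w = w" for j by (induction j) (simp_all add: ww mult.assoc)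
      have "(\<Sum>i\<le>d. coeff p i * (pinv f ^ (d - i) * w)) = (pinv f ^ d * w) * poly p f"
        unfolding poly_altdef d_def[symmetric] sum_distrib_left
      proof (intro sum.cong refl)
        fix i assume "i \<in> {..d}"
        then have "pinv f ^ d = pinv f ^ (d - i) * pinv f ^ i" by (simp flip: power_add)
        then have "(pinv f ^ d * w) * (coeff p i * f ^ i)
            = coeff p i * (pinv f ^ (d - i) * (w ^ i * w))"
          by (simp add: w_def power_mult_distrib ac_simps)
        then show "coeff p i * (pinv f ^ (d - i) * w) = (pinv f ^ d * w) * (coeff p i * f ^ i)"
          unfolding wpow by simp
      qed
      moreover have "((\<Sum>i\<le>d. coeff p i * (pinv f ^ (d - i) * w)),
          (\<Sum>i\<le>d. coeff (1 :: complex poly) i * (b ^ (d - i) * 1))) \<in> H"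
        using p(1) c 2 unfolding poly_rel_def
        by (intro part_hom_sum part_hom_mult part_hom_power ph b) auto
      moreover have "(\<Sum>i\<le>d. coeff (1 :: complex poly) i * (b ^ (d - i) * 1)) = b ^ d"
        by (simp add: atMost_atLeast0 sum.atLeast_Suc_atMost)
      ultimately have "(0, b ^ d) \<in> H" using p(2) by simp
      then have "b = 0" using part_hom_zero[OF ph] power_not_zero by blast
      then show False using b g by simp
    next
      case False
      then obtain q where q: "poly_rel H q 1" "poly q (pinv f) = 0" using place_relation[OF H] by blast
      show False
        using part_hom_no_relations[OF ph, of f "pinv f" p q] c 2 p q pinv_supp pinv_supp'
        unfolding w_def by metis
    qed
  qed
qed

text \<open>The function \<open>e\<close> plays the role of the indicator of a large set: the ring has zero divisors, and the
  place sees a function only up to such sets.\<close>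

definition ae_eq :: "(('a \<Rightarrow> complex) \<times> complex) set \<Rightarrow> ('a \<Rightarrow> complex) \<Rightarrow> ('a \<Rightarrow> complex) \<Rightarrow> bool" where
  "ae_eq H f g \<longleftrightarrow> (\<exists>e. (e, 1) \<in> H \<and> e * f = e * g)"

lemma ae_eq_refl: "part_hom H \<Longrightarrow> ae_eq H f f"
  unfolding ae_eq_def using part_hom_1 by blast

lemma ae_eq_sym: "ae_eq H f g \<Longrightarrow> ae_eq H g f"
  unfolding ae_eq_def by metis

lemma ae_eq_combine:
  assumes ph: "part_hom H" and "ae_eq H f g" "ae_eq H f' g'"
  shows "ae_eq H (f + f') (g + g')" "ae_eq H (f * f') (g * g')"
    "g = f' \<Longrightarrow> ae_eq H f g'"
proof -
  obtain e e' where e: "(e, 1) \<in> H" "(e', 1) \<in> H" "e * f = e * g" "e' * f' = e' * g'"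
    using assms unfolding ae_eq_def by blast
  have ee: "(e * e', 1) \<in> H" using part_hom_mult[OF ph e(1,2)] by simp
  have 1: "(e * e') * f = (e * e') * g" using e(3) by (metis mult.commute mult.assoc)
  have 2: "(e * e') * f' = (e * e') * g'" using e(4) by (metis mult.assoc)
  show "ae_eq H (f + f') (g + g')"
    unfolding ae_eq_def using ee 1 2 by (metis distrib_left)
  have "(e * e') * (f * f') = (e * e') * (g * g')"
  proof -
    have "(e * e') * (f * f') = (e * f) * (e' * f')" by (simp add: ac_simps)
    also have "\<dots> = (e * e') * (g * g')" unfolding e by (simp add: ac_simps)
    finally show ?thesis .
  qed
  then show "ae_eq H (f * f') (g * g')" unfolding ae_eq_def using ee by blast
  show "ae_eq H f g'" if "g = f'"
    unfolding ae_eq_def using ee 1 2 that by metis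
qed

lemmas ae_eq_add = ae_eq_combine(1)
  and ae_eq_mult = ae_eq_combine(2)

lemma ae_eq_trans: "part_hom H \<Longrightarrow> ae_eq H f g \<Longrightarrow> ae_eq H g h \<Longrightarrow> ae_eq H f h"
  using ae_eq_combine(3) by blast

lemma ae_eq_sum:
  assumes "part_hom H" "\<And>i. i \<in> I \<Longrightarrow> ae_eq H (f i) (g i)"
  shows "ae_eq H (sum f I) (sum g I)"
  using assms(2)
  by (induction I rule: infinite_finite_induct)
     (auto intro: ae_eq_refl ae_eq_add assms(1))

lemma ae_eq_value:
  assumes "place H" "ae_eq H f g" "(g, a) \<in> H" shows "(f, a) \<in> H"
proof -
  obtain e where e: "(e, 1) \<in> H" "e * f = e * g" using assms(2) unfolding ae_eq_def by blast
  have "(e * g, a) \<in> H"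
    using part_hom_mult[OF place_part_hom[OF assms(1)] e(1) assms(3)] by simp
  then show ?thesis using place_ae_value[OF assms(1) e(1)] e(2) by simp
qed

text \<open>An idempotent value is 0 or 1. Thus the sets whose indicator has value 1 form an
  ultrafilter.\<close>

lemma place_indicator:
  assumes "place H"
  shows "((\<lambda>x. if P x then 1 else 0), 1) \<in> H \<or> ((\<lambda>x. if P x then 0 else 1), 1) \<in> H"
proof -
  have ph: "part_hom H" using assms by (rule place_part_hom)
  define e where "e = (\<lambda>x. if P x then 1 else 0 :: complex)"
  have ee: "e * e = e" by (auto simp: e_def fun_eq_iff fun_apply)
  obtain c where c: "(e, c) \<in> H" using place_idempotent[OF assms ee] by force
  have "c * c = c" using part_hom_unique[OF ph] part_hom_mult[OF ph c c] c ee by metis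
  then consider "c = 0" | "c = 1" by (metis mult_cancel_right1)
  then show ?thesis
  proof cases
    case 1
    have "(1 - e, 1) \<in> H" using part_hom_diff[OF ph part_hom_1[OF ph] c] 1 by simp
    moreover have "1 - e = (\<lambda>x. if P x then 0 else 1)" by (auto simp: e_def fun_eq_iff fun_apply)
    ultimately show ?thesis by simp
  next
    case 2 then show ?thesis using c e_def by simp
  qed
qed

text \<open>The dichotomy for \<open>pinv f\<close> leaves only one alternative, since
  \<open>f\<close> does not have value 0. The product \<open>f * pinv f\<close> has value 1 but need
  not equal 1, as \<open>f\<close> may vanish at some points.\<close>

lemma place_unit:
  assumes H: "place H" and f: "(f, a) \<in> H" "a \<noteq> 0"
  shows "(pinv f, inverse a) \<in> H" "(f * pinv f, 1) \<in> H"
proof -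
  have ph: "part_hom H" using H by (rule place_part_hom)
  have "pinv f \<in> fst ` H"
    using place_dichotomy[OF H, of "pinv f"] part_hom_unique[OF ph f(1), of 0] f(2) by auto
  then obtain b where b: "(pinv f, b) \<in> H" by force
  have 1: "(f * pinv f, a * b) \<in> H" using part_hom_mult[OF ph f(1) b] .
  have "(f * (f * pinv f), a * (a * b)) \<in> H" using part_hom_mult[OF ph f(1) 1] .
  then have "a * (a * b) = a" using part_hom_unique[OF ph f(1)] pinv_supp[of f] by metis
  then have ab: "a * b = 1" using f(2) by simp
  then show "(f * pinv f, 1) \<in> H" using 1 by simp
  show "(pinv f, inverse a) \<in> H" using b ab by (metis inverse_unique)
qed

text \<open>The dichotomy for \<open>f * pinv g\<close> compares the two functions when both
  supports have value 1; a function that vanishes almost everywhere is a multiple of any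
  other.\<close>

lemma place_divides_total:
  assumes H: "place H"
  shows "(\<exists>c\<in>fst ` H. ae_eq H f (c * g)) \<or> (\<exists>c\<in>fst ` H. ae_eq H g (c * f))"
proof -
  have ph: "part_hom H" using H by (rule place_part_hom)
  have supp: "(g * pinv g, 1) \<in> H \<or> ae_eq H g 0" for g
  proof -
    \<comment> \<open>\<open>P\<close> stands for the condition that \<open>g\<close> is nonzero:
      its indicator is \<open>g * pinv g\<close>, and the complementary indicator kills
      \<open>g\<close>.\<close>
    have "\<And>P. (\<lambda>x. if P x then 1 else 0) = g * pinv g \<Longrightarrow> (\<lambda>x. if P x then 0 else 1) * g = 0 \<Longrightarrow> ?thesis"
      using place_indicator[OF H] unfolding ae_eq_def by (metis mult_zero_right)
    from this[of "\<lambda>x. g x \<noteq> 0"] show ?thesis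
      by (auto simp: fun_eq_iff fun_apply pinv_def)
  qed
  have zero: "0 \<in> fst ` H" using part_hom_0[OF ph] by force
  have main: "\<exists>c\<in>fst ` H. ae_eq H f (c * g)"
    if "f * pinv g \<in> fst ` H" "(g * pinv g, 1) \<in> H" for f g
  proof -
    have "(g * pinv g) * f = (g * pinv g) * ((f * pinv g) * g)"
      using arg_cong[OF pinv_supp'[of g], of "\<lambda>h. h * g * f"] by (simp add: ac_simps)
    then show ?thesis unfolding ae_eq_def using that by blast
  qed
  consider "ae_eq H g 0" | "ae_eq H f 0" | "(g * pinv g, 1) \<in> H" "(f * pinv f, 1) \<in> H"
    using supp by blast
  then show ?thesis
  proof cases
    case 1
    then have "ae_eq H g (0 * f)" by simp
    then show ?thesis using zero by blast
  next
    case 2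
    then have "ae_eq H f (0 * g)" by simp
    then show ?thesis using zero by blast
  next
    case 3
    have "f * pinv g \<in> fst ` H \<or> g * pinv f \<in> fst ` H"
      using place_dichotomy[OF H, of "f * pinv g"] by (force simp: pinv_mult mult.commute)
    then show ?thesis using main 3 by blast
  qed
qed

section \<open>Diagonalisation over a place\<close>

definition mat_rel :: "(('a \<Rightarrow> complex) \<times> complex) set \<Rightarrow> ('a \<Rightarrow> complex) mat \<Rightarrow> complex mat \<Rightarrow> bool" where
  "mat_rel H A a \<longleftrightarrow> dim_row A = dim_row a \<and> dim_col A = dim_col a \<and>
     (\<forall>i<dim_row A. \<forall>j<dim_col A. (A $$ (i, j), a $$ (i, j)) \<in> H)"

lemma mat_rel_index:
  "mat_rel H A a \<Longrightarrow> A \<in> carrier_mat n k \<Longrightarrow> i < n \<Longrightarrow> j < k \<Longrightarrow> (A $$ (i, j), a $$ (i, j)) \<in> H"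
  unfolding mat_rel_def by auto

lemma mat_rel_carrier: "mat_rel H A a \<Longrightarrow> A \<in> carrier_mat n k \<Longrightarrow> a \<in> carrier_mat n k"
  unfolding mat_rel_def by auto

lemma mat_rel_mult:
  assumes ph: "part_hom H" and A: "mat_rel H A a" "A \<in> carrier_mat n k"
    and B: "mat_rel H B b" "B \<in> carrier_mat k r"
  shows "mat_rel H (A * B) (a * b)"
proof -
  have ab: "a \<in> carrier_mat n k" "b \<in> carrier_mat k r" using A B mat_rel_carrier by blast+
  have "((A * B) $$ (i, j), (a * b) $$ (i, j)) \<in> H" if "i < n" "j < r" for i j
  proof -
    have "((\<Sum>l\<in>{0..<k}. A $$ (i, l) * B $$ (l, j)), (\<Sum>l\<in>{0..<k}. a $$ (i, l) * b $$ (l, j))) \<in> H"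
      using that mat_rel_index[OF A(1,2)] mat_rel_index[OF B(1,2)]
      by (intro part_hom_sum[OF ph] part_hom_mult[OF ph]) auto
    then show ?thesis using that A(2) B(2) ab by (simp add: scalar_prod_def)
  qed
  then show ?thesis using A(2) B(2) ab unfolding mat_rel_def by auto
qed

lemma mat_rel_one: "part_hom H \<Longrightarrow> mat_rel H (1\<^sub>m n) (1\<^sub>m n)"
  unfolding mat_rel_def by (auto simp: part_hom_0 part_hom_1)

lemma mat_rel_unique:
  assumes "part_hom H" "mat_rel H A a" "mat_rel H A b" shows "a = b"
proof (rule eq_matI)
  fix i j assume "i < dim_row b" "j < dim_col b"
  then have "(A $$ (i, j), a $$ (i, j)) \<in> H" "(A $$ (i, j), b $$ (i, j)) \<in> H"
    using assms(2,3) unfolding mat_rel_def by auto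
  then show "a $$ (i, j) = b $$ (i, j)" by (rule part_hom_unique[OF assms(1)])
qed (use assms(2,3) in \<open>auto simp: mat_rel_def\<close>)

text \<open>The inverse is carried along and is exact. A matrix whose value is invertible could
  still be singular at some points, so invertibility of \<open>l\<close> alone would not give
  it.\<close>

definition rel_inverses ::
    "(('a \<Rightarrow> complex) \<times> complex) set \<Rightarrow> nat \<Rightarrow> ('a \<Rightarrow> complex) mat \<Rightarrow> ('a \<Rightarrow> complex) mat
      \<Rightarrow> complex mat \<Rightarrow> complex mat \<Rightarrow> bool" where
  "rel_inverses H n L L' l l' \<longleftrightarrow> L \<in> carrier_mat n n \<and> L' \<in> carrier_mat n n \<and>
     mat_rel H L l \<and> mat_rel H L' l' \<and> L * L' = 1\<^sub>m n \<and> L' * L = 1\<^sub>m n"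

lemma rel_inverses_value:
  assumes ph: "part_hom H" and L: "rel_inverses H n L L' l l'"
  shows "l \<in> carrier_mat n n" "l' \<in> carrier_mat n n" "l * l' = 1\<^sub>m n" "l' * l = 1\<^sub>m n"
proof -
  note L = L[unfolded rel_inverses_def]
  show "l \<in> carrier_mat n n" "l' \<in> carrier_mat n n" using L mat_rel_carrier by blast+
  have "mat_rel H (1\<^sub>m n) (l * l')" "mat_rel H (1\<^sub>m n) (l' * l)"
    using L mat_rel_mult[OF ph, of L l n n L' l' n] mat_rel_mult[OF ph, of L' l' n n L l n] by auto
  then show "l * l' = 1\<^sub>m n" "l' * l = 1\<^sub>m n"
    using mat_rel_unique[OF ph] mat_rel_one[OF ph] by blast+
qed

lemma rel_inverses_mult:
  assumes ph: "part_hom H" and L: "rel_inverses H n L L' l l'" and M: "rel_inverses H n M M' m m'"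
  shows "rel_inverses H n (L * M) (M' * L') (l * m) (m' * l')"
proof -
  note L = L[unfolded rel_inverses_def] and M = M[unfolded rel_inverses_def]
  have c: "L \<in> carrier_mat n n" "L' \<in> carrier_mat n n" "M \<in> carrier_mat n n" "M' \<in> carrier_mat n n"
    using L M by auto
  have "(L * M) * (M' * L') = L * ((M * M') * L')"
    using c by (simp add: assoc_mult_mat[of _ n n _ n _ n])
  moreover have "(M' * L') * (L * M) = M' * ((L' * L) * M)"
    using c by (simp add: assoc_mult_mat[of _ n n _ n _ n])
  ultimately show ?thesis
    using L M c mat_rel_mult[OF ph] unfolding rel_inverses_def by auto
qed

lemma rel_inverses_transpose:
  assumes "rel_inverses H n L L' l l'"
  shows "rel_inverses H n L\<^sup>T L'\<^sup>T l\<^sup>T l'\<^sup>T"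
proof -
  note L = assms[unfolded rel_inverses_def]
  have "L\<^sup>T * L'\<^sup>T = (L' * L)\<^sup>T" using L by (intro transpose_mult[symmetric]) auto
  moreover have "L'\<^sup>T * L\<^sup>T = (L * L')\<^sup>T" using L by (intro transpose_mult[symmetric]) auto
  moreover have "mat_rel H A\<^sup>T a\<^sup>T" if "mat_rel H A a" for A a
    using that unfolding mat_rel_def by auto
  ultimately show ?thesis using L unfolding rel_inverses_def by simp
qed

lemma rel_inverses_one: "part_hom H \<Longrightarrow> rel_inverses H n (1\<^sub>m n) (1\<^sub>m n) (1\<^sub>m n) (1\<^sub>m n)"
  unfolding rel_inverses_def by (auto simp: mat_rel_one)

lemma rel_inverses_swaprows:
  assumes "part_hom H" "k < n" "l < n"
  shows "rel_inverses H n (swaprows_mat n k l) (swaprows_mat n k l) (swaprows_mat n k l) (swaprows_mat n k l)"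
  unfolding rel_inverses_def mat_rel_def
  using assms by (auto simp: swaprows_mat_inv part_hom_0 part_hom_1)

text \<open>Left multiplication adds \<open>c i\<close> times row \<open>r\<close> to every other
  row \<open>i\<close> at once; the number \<open>c r\<close> is never read.\<close>

definition elim_mat :: "nat \<Rightarrow> nat \<Rightarrow> (nat \<Rightarrow> 'r) \<Rightarrow> 'r::comm_ring_1 mat" where
  "elim_mat n r c = mat n n (\<lambda>(i, j). if i = j then 1 else if j = r then c i else 0)"

lemma elim_mat_carrier: "elim_mat n r c \<in> carrier_mat n n"
  unfolding elim_mat_def by simp

lemma elim_mat_mult:
  assumes Z: "Z \<in> carrier_mat n k" and r: "r < n" and i: "i < n" and j: "j < k"
  shows "(elim_mat n r c * Z) $$ (i, j) = Z $$ (i, j) + (if i = r then 0 else c i * Z $$ (r, j))"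
proof -
  have "(elim_mat n r c * Z) $$ (i, j)
      = (\<Sum>l\<in>{0..<n}. (if i = l then 1 else if l = r then c i else 0) * Z $$ (l, j))"
    using Z i j unfolding elim_mat_def by (simp add: scalar_prod_def)
  also have "\<dots> = (\<Sum>l\<in>{0..<n}. (if l = i then Z $$ (i, j) else 0)
      + (if l = r then (if i = r then 0 else c i * Z $$ (r, j)) else 0))"
    by (intro sum.cong) auto
  also have "\<dots> = Z $$ (i, j) + (if i = r then 0 else c i * Z $$ (r, j))"
    using i r by (simp add: sum.distrib)
  finally show ?thesis .
qed

lemma elim_mat_inverse:
  assumes "r < n"
  shows "elim_mat n r c * elim_mat n r (\<lambda>i. - c i) = 1\<^sub>m n"
proof (rule eq_matI)
  fix i j assume "i < dim_row (1\<^sub>m n :: 'a mat)" "j < dim_col (1\<^sub>m n :: 'a mat)"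
  then have ij: "i < n" "j < n" by auto
  then have "(elim_mat n r c * elim_mat n r (\<lambda>i. - c i)) $$ (i, j)
      = elim_mat n r (\<lambda>i. - c i) $$ (i, j)
        + (if i = r then 0 else c i * elim_mat n r (\<lambda>i. - c i) $$ (r, j))"
    using assms by (intro elim_mat_mult[where k = n] elim_mat_carrier)
  then show "(elim_mat n r c * elim_mat n r (\<lambda>i. - c i)) $$ (i, j) = 1\<^sub>m n $$ (i, j)"
    using ij assms by (auto simp: elim_mat_def)
qed (simp_all add: elim_mat_def)

lemma rel_inverses_elim:
  assumes ph: "part_hom H" and r: "r < n" and c: "\<And>i. i < n \<Longrightarrow> (c i, d i) \<in> H"
  shows "rel_inverses H n (elim_mat n r c) (elim_mat n r (\<lambda>i. - c i))
    (elim_mat n r d) (elim_mat n r (\<lambda>i. - d i))"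
proof -
  have "elim_mat n r (\<lambda>i. - c i) * elim_mat n r c = 1\<^sub>m n"
    using elim_mat_inverse[OF r, of "\<lambda>i. - c i"] by simp
  moreover have "mat_rel H (elim_mat n r c) (elim_mat n r d)" if "\<And>i. i < n \<Longrightarrow> (c i, d i) \<in> H" for c d
    unfolding mat_rel_def elim_mat_def using that by (auto simp: part_hom_0[OF ph] part_hom_1[OF ph])
  ultimately show ?thesis
    unfolding rel_inverses_def
    using elim_mat_inverse[OF r] c part_hom_uminus[OF ph c] by (auto simp: elim_mat_carrier)
qed

section \<open>Equivalence under base changes with values, and pivots\<close>

definition rel_equiv :: "(('a \<Rightarrow> complex) \<times> complex) set \<Rightarrow> nat \<Rightarrow> ('a \<Rightarrow> complex) mat \<Rightarrow> ('a \<Rightarrow> complex) mat \<Rightarrow> bool" where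
  "rel_equiv H n P Z \<longleftrightarrow> (\<exists>L L' l l' M M' m m'. rel_inverses H n L L' l l' \<and>
     rel_inverses H n M M' m m' \<and> Z = L * P * M)"

lemma rel_equiv_refl: "part_hom H \<Longrightarrow> P \<in> carrier_mat n n \<Longrightarrow> rel_equiv H n P P"
  unfolding rel_equiv_def using rel_inverses_one by (metis left_mult_one_mat right_mult_one_mat)

lemma rel_equiv_left:
  assumes ph: "part_hom H" and P: "P \<in> carrier_mat n n" and Z: "rel_equiv H n P Z"
    and K: "rel_inverses H n K K' k k'"
  shows "rel_equiv H n P (K * Z)"
proof -
  obtain L L' l l' M M' m m' where *: "rel_inverses H n L L' l l'"
    "rel_inverses H n M M' m m'" "Z = L * P * M" using Z unfolding rel_equiv_def by blast
  have "L \<in> carrier_mat n n" "M \<in> carrier_mat n n" "K \<in> carrier_mat n n"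
    using * K unfolding rel_inverses_def by auto
  then have "K * Z = (K * L) * P * M"
    using P * by (simp add: assoc_mult_mat[of _ n n _ n _ n])
  then show ?thesis using rel_inverses_mult[OF ph K *(1)] *(2) unfolding rel_equiv_def by blast
qed

lemma rel_equiv_right:
  assumes ph: "part_hom H" and P: "P \<in> carrier_mat n n" and Z: "rel_equiv H n P Z"
    and K: "rel_inverses H n K K' k k'"
  shows "rel_equiv H n P (Z * K)"
proof -
  obtain L L' l l' M M' m m' where *: "rel_inverses H n L L' l l'"
    "rel_inverses H n M M' m m'" "Z = L * P * M" using Z unfolding rel_equiv_def by blast
  have "L \<in> carrier_mat n n" "M \<in> carrier_mat n n" "K \<in> carrier_mat n n"
    using * K unfolding rel_inverses_def by auto
  then have "Z * K = L * P * (M * K)"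
    using P * by (simp add: assoc_mult_mat[of _ n n _ n _ n])
  then show ?thesis using rel_inverses_mult[OF ph *(2) K] *(1) unfolding rel_equiv_def by blast
qed

lemma rel_equiv_carrier: "P \<in> carrier_mat n n \<Longrightarrow> rel_equiv H n P Z \<Longrightarrow> Z \<in> carrier_mat n n"
  unfolding rel_equiv_def rel_inverses_def by auto

text \<open>Used in two directions of divisibility: for a pivot that divides all entries, and later
  for a diagonal entry that is a multiple of all the others.\<close>

lemma total_preorder_minimum:
  assumes S: "finite S" "S \<noteq> {}" and tot: "\<And>a b. r a b \<or> r b a"
    and trans: "\<And>a b c. r a b \<Longrightarrow> r b c \<Longrightarrow> r a c"
  shows "\<exists>p\<in>S. \<forall>s\<in>S. r p s"
  using S
proof (induction S rule: finite_ne_induct)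
  case (singleton x) then show ?case using tot by blast
next
  case (insert x S)
  then obtain p where p: "p \<in> S" "\<forall>s\<in>S. r p s" by blast
  show ?case
  proof (cases "r p x")
    case True then show ?thesis using p by blast
  next
    case False
    then have "r x p" using tot by blast
    then have "\<forall>s\<in>insert x S. r x s" using p(2) trans tot by blast
    then show ?thesis by blast
  qed
qed

lemma place_divides_trans:
  assumes ph: "part_hom H"
    and ab: "\<exists>c\<in>fst ` H. ae_eq H a (c * b)" and bg: "\<exists>c\<in>fst ` H. ae_eq H b (c * g)"
  shows "\<exists>c\<in>fst ` H. ae_eq H a (c * g)"
proof -
  obtain c u d v where c: "(c, u) \<in> H" "ae_eq H a (c * b)" "(d, v) \<in> H" "ae_eq H b (d * g)"
    using ab bg by force
  have "ae_eq H (c * b) (c * (d * g))" using ae_eq_mult[OF ph ae_eq_refl[OF ph] c(4)] .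
  then have "ae_eq H a ((c * d) * g)" using ae_eq_trans[OF ph c(2)] by (simp add: mult.assoc)
  then show ?thesis using part_hom_mult[OF ph c(1,3)] by force
qed

lemma place_pivot:
  assumes H: "place H" and S: "finite S" "S \<noteq> {}"
  shows "\<exists>p\<in>S. \<forall>s\<in>S. \<exists>c\<in>fst ` H. ae_eq H (z s) (c * z p)"
proof (rule total_preorder_minimum[OF S])
  show "(\<exists>c\<in>fst ` H. ae_eq H (z b) (c * z a)) \<or> (\<exists>c\<in>fst ` H. ae_eq H (z a) (c * z b))" for a b
    by (rule place_divides_total[OF H])
  show "\<exists>c\<in>fst ` H. ae_eq H (z d) (c * z a)"
    if "\<exists>c\<in>fst ` H. ae_eq H (z b) (c * z a)" "\<exists>c\<in>fst ` H. ae_eq H (z d) (c * z b)" for a b d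
    using place_divides_trans[OF place_part_hom[OF H] that(2,1)] .
qed

lemma choice_less:
  assumes "\<forall>i<n. \<exists>x. Q i x"
  shows "\<exists>f. \<forall>i<(n::nat). Q i (f i)"
  using assms by metis

definition diag_upto :: "(('a \<Rightarrow> complex) \<times> complex) set \<Rightarrow> nat \<Rightarrow> nat \<Rightarrow> ('a \<Rightarrow> complex) mat \<Rightarrow> bool" where
  "diag_upto H n r Z \<longleftrightarrow> (\<forall>i<n. \<forall>j<n. i \<noteq> j \<longrightarrow> i < r \<or> j < r \<longrightarrow> ae_eq H (Z $$ (i, j)) 0)"

text \<open>Because divisibility is total, the remaining block contains an entry that divides all of
  it; moved to the corner, it clears its row and column with multipliers that have values. The base
  changes are exact, the zeros hold almost everywhere.\<close>

theorem place_smith: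
  assumes H: "place H" and P: "P \<in> carrier_mat n n"
  shows "\<exists>Z. rel_equiv H n P Z \<and> diag_upto H n n Z"
proof -
  have ph: "part_hom H" using H by (rule place_part_hom)
  have zero: "0 \<in> fst ` H" using part_hom_0[OF ph] by force
  have ae_elim: "ae_eq H (x + (- c) * y) 0" if "ae_eq H x (c * y)" for x c y
    using that unfolding ae_eq_def by (auto simp: algebra_simps)
  have ae_0: "ae_eq H (x + c * y) 0" if "ae_eq H x 0" "ae_eq H y 0" for x c y
    using ae_eq_add[OF ph that(1) ae_eq_mult[OF ph ae_eq_refl[OF ph, of c] that(2)]] by simp
  have "r \<le> n \<Longrightarrow> \<exists>Z. rel_equiv H n P Z \<and> diag_upto H n r Z" for r
  proof (induction r)
    case 0
    then show ?case using rel_equiv_refl[OF ph P] unfolding diag_upto_def by blast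
  next
    case (Suc r)
    then have r: "r < n" by simp
    obtain Z where Z: "rel_equiv H n P Z" "diag_upto H n r Z" using Suc by auto
    have cZ: "Z \<in> carrier_mat n n" using rel_equiv_carrier[OF P Z(1)] .
    obtain p where "p \<in> {r..<n} \<times> {r..<n}" and piv: "\<forall>s\<in>{r..<n} \<times> {r..<n}. \<exists>c\<in>fst ` H. ae_eq H (Z $$ s) (c * Z $$ p)"
      using place_pivot[OF H, of "{r..<n} \<times> {r..<n}" "\<lambda>s. Z $$ s"] r by auto
    then obtain i0 j0 where p: "p = (i0, j0)" "r \<le> i0" "i0 < n" "r \<le> j0" "j0 < n" by force
    define S T where "S = (swaprows_mat n r i0 :: ('a \<Rightarrow> complex) mat)"
      and "T = (swaprows_mat n r j0 :: ('a \<Rightarrow> complex) mat)"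
    define Y where "Y = S * Z * T"
    have cS: "S * Z \<in> carrier_mat n n" using cZ unfolding S_def by (metis mult_carrier_mat swaprows_mat_carrier)
    have Y: "rel_equiv H n P Y"
      unfolding Y_def S_def T_def
      by (rule rel_equiv_right[OF ph P rel_equiv_left[OF ph P Z(1)]])
        (rule rel_inverses_swaprows[OF ph]; use r p in simp)+
    have Yeq: "Y = swapcols r j0 (swaprows r i0 Z)"
      using swapcols_mat[OF cS r p(5)] swaprows_mat[OF cZ r p(3)] unfolding Y_def S_def T_def by simp
    have cY: "Y \<in> carrier_mat n n" using rel_equiv_carrier[OF P Y] .
    \<comment> \<open>The transpositions of row and column indices performed by the two swaps. They
      fix the indices below \<open>r\<close>, so the part already diagonalised survives.\<close>
    define s t where "s = (\<lambda>i. if i = r then i0 else if i = i0 then r else i)"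
      and "t = (\<lambda>j. if j = r then j0 else if j = j0 then r else j)"
    have Yij: "Y $$ (i, j) = Z $$ (s i, t j)" if "i < n" "j < n" for i j
      using that cZ p r unfolding Yeq s_def t_def by auto
    have st: "s i < n" "t i < n" "s i < r \<longleftrightarrow> i < r" "t i < r \<longleftrightarrow> i < r"
      "i < r \<Longrightarrow> s i = i" "i < r \<Longrightarrow> t i = i" if "i < n" for i
      using that p r unfolding s_def t_def by auto
    have str: "s r = i0" "t r = j0" unfolding s_def t_def by auto
    have Yd: "ae_eq H (Y $$ (i, j)) 0" if "i < n" "j < n" "i \<noteq> j" "i < r \<or> j < r" for i j
    proof -
      have "s i \<noteq> t j" using that st by (metis)
      then show ?thesis using Z(2) that st unfolding diag_upto_def Yij[OF that(1,2)] by blast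
    qed
    have Yp: "\<exists>c\<in>fst ` H. ae_eq H (Y $$ (i, j)) (c * Y $$ (r, r))"
      if "i < n" "j < n" "i \<ge> r" "j \<ge> r" for i j
      using piv[rule_format, of "(s i, t j)"] st[OF that(1)] st[OF that(2)] that(3,4) r
      unfolding Yij[OF that(1,2)] Yij[OF r r] p(1) str by auto
    \<comment> \<open>Multipliers 0 above the pivot leave the finished rows alone; below it they
      come from divisibility by the pivot.\<close>
    have "\<forall>i<n. \<exists>c. c \<in> fst ` H \<and> (i > r \<longrightarrow> ae_eq H (Y $$ (i, r)) (c * Y $$ (r, r))) \<and> (i < r \<longrightarrow> c = 0)"
    proof (intro allI impI)
      fix i assume i_n: "i < n"
      show "\<exists>c. c \<in> fst ` H \<and> (i > r \<longrightarrow> ae_eq H (Y $$ (i, r)) (c * Y $$ (r, r))) \<and> (i < r \<longrightarrow> c = 0)"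
      proof (cases "i < r")
      case True then show ?thesis using zero by (intro exI[of _ 0]) simp
    next
      case False
      then have "r \<le> i" by simp
      from Yp[OF i_n r this order_refl] obtain c
        where "c \<in> fst ` H" "ae_eq H (Y $$ (i, r)) (c * Y $$ (r, r))" by blast
      then show ?thesis using False by blast
      qed
    qed
    from choice_less[OF this] obtain c
      where "\<forall>i<n. c i \<in> fst ` H \<and> (i > r \<longrightarrow> ae_eq H (Y $$ (i, r)) (c i * Y $$ (r, r))) \<and> (i < r \<longrightarrow> c i = 0)"
      by (elim exE)
    note c = this[rule_format, THEN conjunct1] this[rule_format, THEN conjunct2, THEN conjunct1, rule_format]
      this[rule_format, THEN conjunct2, THEN conjunct2, rule_format]
    have "\<forall>i<n. \<exists>x. (c i, x) \<in> H" using c(1) by force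
    from choice_less[OF this] obtain d where "\<forall>i<n. (c i, d i) \<in> H" by (elim exE)
    note d = this[rule_format]
    define W where "W = elim_mat n r (\<lambda>i. - c i) * Y"
    have W: "rel_equiv H n P W"
      unfolding W_def by (rule rel_equiv_left[OF ph P Y rel_inverses_elim])
        (auto intro: ph r part_hom_uminus d)
    have cW: "W \<in> carrier_mat n n" using rel_equiv_carrier[OF P W] .
    have Wij: "W $$ (i, j) = Y $$ (i, j) + (if i = r then 0 else - c i * Y $$ (r, j))"
      if "i < n" "j < n" for i j
      unfolding W_def using elim_mat_mult[OF cY r that] .
    have Wd: "ae_eq H (W $$ (i, j)) 0" if ij: "i < n" "j < n" "i \<noteq> j" "i < r \<or> j < Suc r" for i j
    proof -
      consider "i = r" | "i < r" | "i > r" "j = r" | "i > r" "j < r" using ij by linarith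
      then show ?thesis
      proof cases
        case 1 then show ?thesis using ij Yd[of i j] by (auto simp: Wij)
      next
        case 2 then show ?thesis using ij Yd[of i j] c(3)[of i] by (auto simp: Wij)
      next
        case 3 then show ?thesis using ij ae_elim[OF c(2)[OF ij(1)]] by (simp add: Wij)
      next
        case 4
        then have "ae_eq H (Y $$ (i, j) + (- c i) * Y $$ (r, j)) 0"
          using ij r by (intro ae_0 Yd) auto
        then show ?thesis using 4 ij by (simp add: Wij)
      qed
    qed
    have "\<forall>j<n. \<exists>c. c \<in> fst ` H \<and> (j > r \<longrightarrow> ae_eq H (Y $$ (r, j)) (c * Y $$ (r, r))) \<and> (j < r \<longrightarrow> c = 0)"
    proof (intro allI impI)
      fix j assume j_n: "j < n"
      show "\<exists>c. c \<in> fst ` H \<and> (j > r \<longrightarrow> ae_eq H (Y $$ (r, j)) (c * Y $$ (r, r))) \<and> (j < r \<longrightarrow> c = 0)"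
      proof (cases "j < r")
      case True then show ?thesis using zero by (intro exI[of _ 0]) simp
    next
      case False
      then have "r \<le> j" by simp
      from Yp[OF r j_n order_refl this] obtain c
        where "c \<in> fst ` H" "ae_eq H (Y $$ (r, j)) (c * Y $$ (r, r))" by blast
      then show ?thesis using False by blast
      qed
    qed
    from choice_less[OF this] obtain c'
      where "\<forall>j<n. c' j \<in> fst ` H \<and> (j > r \<longrightarrow> ae_eq H (Y $$ (r, j)) (c' j * Y $$ (r, r))) \<and> (j < r \<longrightarrow> c' j = 0)"
      by (elim exE)
    note c' = this[rule_format, THEN conjunct1] this[rule_format, THEN conjunct2, THEN conjunct1, rule_format]
      this[rule_format, THEN conjunct2, THEN conjunct2, rule_format]
    have "\<forall>i<n. \<exists>x. (c' i, x) \<in> H" using c'(1) by force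
    from choice_less[OF this] obtain d' where "\<forall>i<n. (c' i, d' i) \<in> H" by (elim exE)
    note d' = this[rule_format]
    \<comment> \<open>Column operations are the transposes of row operations. Row \<open>r\<close>
      of \<open>W\<close> is still that of \<open>Y\<close>, so the divisibility statements for
      \<open>Y\<close> remain usable.\<close>
    define E where "E = elim_mat n r (\<lambda>i. - c' i)"
    have cE: "E \<in> carrier_mat n n" unfolding E_def by (rule elim_mat_carrier)
    define V where "V = W * E\<^sup>T"
    have V: "rel_equiv H n P V"
      unfolding V_def E_def
      by (rule rel_equiv_right[OF ph P W rel_inverses_transpose[OF rel_inverses_elim]])
         (auto intro: ph r part_hom_uminus d')
    have Vij: "V $$ (i, j) = W $$ (i, j) + (if j = r then 0 else - c' j * W $$ (i, r))"
      if "i < n" "j < n" for i j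
    proof -
      have "V = (E * W\<^sup>T)\<^sup>T"
        unfolding V_def using transpose_mult[OF cE, of "W\<^sup>T" n] cW by simp
      then have "V $$ (i, j) = (E * W\<^sup>T) $$ (j, i)"
        using that cE cW by simp
      then show ?thesis
        unfolding E_def using elim_mat_mult[OF _ r that(2,1), of "W\<^sup>T"] cW that r by simp
    qed
    have "ae_eq H (V $$ (i, j)) 0" if ij: "i < n" "j < n" "i \<noteq> j" "i < Suc r \<or> j < Suc r" for i j
    proof -
      consider "j = r" | "j < r" | "j > r" "i = r" | "j > r" "i < r" using ij by linarith
      then show ?thesis
      proof cases
        case 1 then show ?thesis using ij Wd[of i j] by (auto simp: Vij)
      next
        case 2 then show ?thesis using ij Wd[of i j] c'(3)[of j] by (auto simp: Vij)
      next
        case 3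
        then show ?thesis using ij ae_elim[OF c'(2)[OF ij(2)]] by (simp add: Vij Wij)
      next
        case 4
        then have "ae_eq H (W $$ (i, j) + (- c' j) * W $$ (i, r)) 0"
          using ij r by (intro ae_0 Wd) auto
        then show ?thesis using 4 ij by (simp add: Vij)
      qed
    qed
    then show ?case using V unfolding diag_upto_def by blast
  qed
  from this[of n] show ?thesis by simp
qed

section \<open>Invariants separating points from zero\<close>

lemma finsum_vec_eq:
  assumes "\<And>i. i < (r::nat) \<Longrightarrow> w i \<in> carrier_vec d"
  shows "(\<Oplus>\<^bsub>module_vec TYPE(complex) d\<^esub>i\<in>{..<r}. w i) = vec d (\<lambda>j. \<Sum>i<r. w i $ j)"
  using assms
proof (induction r)
  case 0
  interpret V: vec_space "TYPE(complex)" d .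
  have "(\<Oplus>\<^bsub>module_vec TYPE(complex) d\<^esub>i\<in>{..<0}. w i) = 0\<^sub>v d"
    by (simp add: module_vec_simps)
  then show ?case by auto
next
  case (Suc r)
  interpret V: vec_space "TYPE(complex)" d .
  have "(\<Oplus>\<^bsub>module_vec TYPE(complex) d\<^esub>i\<in>{..<Suc r}. w i)
      = w r + (\<Oplus>\<^bsub>module_vec TYPE(complex) d\<^esub>i\<in>{..<r}. w i)"
    unfolding lessThan_Suc using Suc.prems
    by (subst V.finsum_insert) (auto simp: module_vec_simps)
  also have "\<dots> = vec d (\<lambda>j. \<Sum>i<Suc r. w i $ j)"
    using Suc by (auto simp: add.commute)
  finally show ?case .
qed

lemma subspace_memD:
  fixes W :: "complex vec set"
  assumes "subspace class_ring W (module_vec TYPE(complex) d)"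
  shows "W \<subseteq> carrier_vec d" "0\<^sub>v d \<in> W" "v \<in> W \<Longrightarrow> w \<in> W \<Longrightarrow> v + w \<in> W" "v \<in> W \<Longrightarrow> c \<cdot>\<^sub>v v \<in> W"
proof -
  interpret s: submodule class_ring W "module_vec TYPE(complex) d"
    using assms unfolding VectorSpace.subspace_def by blast
  show "W \<subseteq> carrier_vec d" "0\<^sub>v d \<in> W" "v \<in> W \<Longrightarrow> w \<in> W \<Longrightarrow> v + w \<in> W" "v \<in> W \<Longrightarrow> c \<cdot>\<^sub>v v \<in> W"
    using s.subset s.zero_closed s.m_closed[of v w] s.smult_closed[of c v]
    by (simp_all add: module_vec_simps)
qed

lemma subspace_line:
  fixes x :: "complex vec"
  assumes x: "x \<in> carrier_vec d"
  shows "subspace class_ring (range (\<lambda>c. c \<cdot>\<^sub>v x)) (module_vec TYPE(complex) d)"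
  unfolding VectorSpace.subspace_def
proof
  show "vectorspace class_ring (module_vec TYPE(complex) d)" by (rule vec_vs)
  show "submodule class_ring (range (\<lambda>c. c \<cdot>\<^sub>v x)) (module_vec TYPE(complex) d)"
  proof (rule submodule.intro)
    show "module class_ring (module_vec TYPE(complex) d)" by (rule vec_module)
    show "\<zero>\<^bsub>module_vec TYPE(complex) d\<^esub> \<in> range (\<lambda>c. c \<cdot>\<^sub>v x)"
      using x by (auto simp: module_vec_simps intro!: image_eqI[of _ _ 0])
  next
    fix v w assume "v \<in> range (\<lambda>c. c \<cdot>\<^sub>v x)" "w \<in> range (\<lambda>c. c \<cdot>\<^sub>v x)"
    then obtain a b where "v = a \<cdot>\<^sub>v x" "w = b \<cdot>\<^sub>v x" by blast
    then have "v + w = (a + b) \<cdot>\<^sub>v x" by (simp add: add_smult_distrib_vec)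
    then show "v \<oplus>\<^bsub>module_vec TYPE(complex) d\<^esub> w \<in> range (\<lambda>c. c \<cdot>\<^sub>v x)"
      by (simp add: module_vec_simps)
  next
    fix c v assume "v \<in> range (\<lambda>c. c \<cdot>\<^sub>v x)"
    then obtain a where "v = a \<cdot>\<^sub>v x" by blast
    then have "c \<cdot>\<^sub>v v = (c * a) \<cdot>\<^sub>v x" by (simp add: smult_smult_assoc)
    then show "c \<odot>\<^bsub>module_vec TYPE(complex) d\<^esub> v \<in> range (\<lambda>c. c \<cdot>\<^sub>v x)"
      by (simp add: module_vec_simps)
  qed (use x in \<open>auto simp: module_vec_simps\<close>)
qed

lemma linear_functional_coeffs:
  fixes l :: "complex vec \<Rightarrow> complex"
  assumes add: "\<And>v w. v \<in> carrier_vec d \<Longrightarrow> w \<in> carrier_vec d \<Longrightarrow> l (v + w) = l v + l w"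
    and smult: "\<And>c v. v \<in> carrier_vec d \<Longrightarrow> l (c \<cdot>\<^sub>v v) = c * l v"
    and v: "v \<in> carrier_vec d"
  shows "l v = (\<Sum>j<d. l (unit_vec d j) * v $ j)"
proof -
  have "k \<le> d \<Longrightarrow> l (vec d (\<lambda>j. if j < k then v $ j else 0)) = (\<Sum>j<k. l (unit_vec d j) * v $ j)" for k
  proof (induction k)
    case 0
    have "vec d (\<lambda>j. if j < 0 then v $ j else 0) = 0 \<cdot>\<^sub>v v" using v by auto
    then show ?case using smult[OF v, of 0] by simp
  next
    case (Suc k)
    have "vec d (\<lambda>j. if j < Suc k then v $ j else 0)
        = vec d (\<lambda>j. if j < k then v $ j else 0) + (v $ k) \<cdot>\<^sub>v unit_vec d k"
      using Suc.prems by (auto simp: unit_vec_def less_Suc_eq)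
    then show ?case using Suc by (simp add: add smult)
  qed
  from this[of d] have "l (vec d (\<lambda>j. if j < d then v $ j else 0)) = (\<Sum>j<d. l (unit_vec d j) * v $ j)"
    by simp
  moreover have "vec d (\<lambda>j. if j < d then v $ j else 0) = v" using v by auto
  ultimately show ?thesis by simp
qed

text \<open>A nonzero component of the fixed vector spans its irreducible summand, so the projection to
  that summand is an invariant functional.\<close>

lemma fixed_vector_functional:
  assumes ds: "direct_sum_of_irreducibles G d \<rho>"
    and \<rho>: "\<And>g. g \<in> G \<Longrightarrow> \<rho> g \<in> carrier_mat d d"
    and e: "e \<in> carrier_vec d" "e \<noteq> 0\<^sub>v d" "\<And>g. g \<in> G \<Longrightarrow> \<rho> g *\<^sub>v e = e"
  shows "\<exists>a :: nat \<Rightarrow> complex.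
    (\<forall>g\<in>G. \<forall>v\<in>carrier_vec d. (\<Sum>j<d. a j * (\<rho> g *\<^sub>v v) $ j) = (\<Sum>j<d. a j * v $ j)) \<and>
    (\<Sum>j<d. a j * e $ j) \<noteq> 0"
proof -
  obtain r :: nat and W where rW: "(\<forall>i<r. irreducible_subrep G d \<rho> (W i)) \<and>
        (\<forall>v \<in> carrier_vec d. \<exists>!w. w \<in> (\<Pi>\<^sub>E i\<in>{..<r}. W i) \<and>
           v = (\<Oplus>\<^bsub>module_vec TYPE(complex) d\<^esub>i\<in>{..<r}. w i))"
    using ds unfolding direct_sum_of_irreducibles_def by (elim exE)
  note irr = conjunct1[OF rW, rule_format] and ex1 = conjunct2[OF rW, rule_format]
  have sub: "subspace class_ring (W i) (module_vec TYPE(complex) d)"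
    and inv: "\<And>g w. g \<in> G \<Longrightarrow> w \<in> W i \<Longrightarrow> \<rho> g *\<^sub>v w \<in> W i" if "i < r" for i
    using irr[OF that] unfolding irreducible_subrep_def subrep_def by blast+
  note W = subspace_memD[OF sub]
  define isum where "isum w = vec d (\<lambda>j. \<Sum>i<r. w i $ j)" for w :: "nat \<Rightarrow> complex vec"
  define PW where "PW = (\<Pi>\<^sub>E i\<in>{..<r}. W i)"
  have PWc: "w i \<in> carrier_vec d" if "w \<in> PW" "i < r" for w i
    using W(1)[OF that(2)] that unfolding PW_def by blast
  have isum: "(\<Oplus>\<^bsub>module_vec TYPE(complex) d\<^esub>i\<in>{..<r}. w i) = isum w" if "w \<in> PW" for w
    unfolding isum_def using that PWc by (intro finsum_vec_eq) auto
  define dec where "dec v = (THE w. w \<in> PW \<and> v = isum w)" for v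
  have ex1': "\<exists>!w. w \<in> PW \<and> v = isum w" if "v \<in> carrier_vec d" for v
    using ex1[OF that] isum unfolding PW_def[symmetric] by metis
  have dec: "dec v \<in> PW" "isum (dec v) = v" if "v \<in> carrier_vec d" for v
    using theI'[OF ex1'[OF that]] unfolding dec_def by auto
  have dec_eq: "dec v = w" if "w \<in> PW" "v = isum w" for v w
  proof -
    have "v \<in> carrier_vec d" using that unfolding isum_def by simp
    then show ?thesis using ex1' dec that by metis
  qed
  \<comment> \<open>By uniqueness of the decomposition, any operation that preserves each summand
    and is compatible with the sum acts componentwise. Additivity, scaling and the group action are
    the three instances.\<close>
  have map_dec: "dec v' i = h i (dec v i)"
    if v: "v \<in> carrier_vec d" and hW: "\<And>i. i < r \<Longrightarrow> h i (dec v i) \<in> W i"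
      and eq: "v' = isum (\<lambda>i. h i (dec v i))" and i: "i < r" for v v' h i
  proof -
    have "dec v' = (\<lambda>i\<in>{..<r}. h i (dec v i))"
    proof (rule dec_eq)
      show "(\<lambda>i\<in>{..<r}. h i (dec v i)) \<in> PW" using hW unfolding PW_def by auto
      show "v' = isum (\<lambda>i\<in>{..<r}. h i (dec v i))" unfolding eq isum_def by auto
    qed
    then show ?thesis using i by simp
  qed
  have decW: "dec v i \<in> W i" "dec v i \<in> carrier_vec d" if "v \<in> carrier_vec d" "i < r" for v i
    using dec(1)[OF that(1)] that(2) PWc unfolding PW_def by auto
  have dec_add: "dec (v + w) i = dec v i + dec w i"
    if "v \<in> carrier_vec d" "w \<in> carrier_vec d" "i < r" for v w i
  proof (rule map_dec[of v "\<lambda>i x. x + dec w i"])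
    have "v + w = isum (dec v) + isum (dec w)" using dec that by simp
    also have "\<dots> = isum (\<lambda>i. dec v i + dec w i)"
    proof (rule eq_vecI)
      fix j assume "j < dim_vec (isum (\<lambda>i. dec v i + dec w i))"
      then have j: "j < d" by (simp add: isum_def)
      have "(\<Sum>i<r. (dec v i + dec w i) $ j) = (\<Sum>i<r. dec v i $ j + dec w i $ j)"
        using carrier_vecD[OF decW(2)[OF that(2)]] j by (intro sum.cong) auto
      then show "(isum (dec v) + isum (dec w)) $ j = isum (\<lambda>i. dec v i + dec w i) $ j"
        using j by (simp add: isum_def sum.distrib)
    qed (simp add: isum_def)
    finally show "v + w = isum (\<lambda>i. dec v i + dec w i)" .
  qed (use that decW W(3) in auto)
  have dec_smult: "dec (c \<cdot>\<^sub>v v) i = c \<cdot>\<^sub>v dec v i" if "v \<in> carrier_vec d" "i < r" for v c i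
  proof (rule map_dec[of v "\<lambda>i x. c \<cdot>\<^sub>v x"])
    have "c \<cdot>\<^sub>v v = c \<cdot>\<^sub>v isum (dec v)" using dec that by simp
    also have "\<dots> = isum (\<lambda>i. c \<cdot>\<^sub>v dec v i)"
    proof (rule eq_vecI)
      fix j assume "j < dim_vec (isum (\<lambda>i. c \<cdot>\<^sub>v dec v i))"
      then have j: "j < d" by (simp add: isum_def)
      have "(\<Sum>i<r. (c \<cdot>\<^sub>v dec v i) $ j) = (\<Sum>i<r. c * dec v i $ j)"
        using carrier_vecD[OF decW(2)[OF that(1)]] j by (intro sum.cong) auto
      then show "(c \<cdot>\<^sub>v isum (dec v)) $ j = isum (\<lambda>i. c \<cdot>\<^sub>v dec v i) $ j"
        using j by (simp add: isum_def sum_distrib_left)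
    qed (simp add: isum_def)
    finally show "c \<cdot>\<^sub>v v = isum (\<lambda>i. c \<cdot>\<^sub>v dec v i)" .
  qed (use that decW W(4) in auto)
  have dec_\<rho>: "dec (\<rho> g *\<^sub>v v) i = \<rho> g *\<^sub>v dec v i"
    if "v \<in> carrier_vec d" "i < r" "g \<in> G" for v g i
  proof (rule map_dec[of v "\<lambda>i x. \<rho> g *\<^sub>v x"])
    have "\<rho> g *\<^sub>v v = \<rho> g *\<^sub>v isum (dec v)" using dec that by simp
    also have "\<dots> = isum (\<lambda>i. \<rho> g *\<^sub>v dec v i)"
    proof (rule eq_vecI)
      fix j assume "j < dim_vec (isum (\<lambda>i. \<rho> g *\<^sub>v dec v i))"
      then have j: "j < d" by (simp add: isum_def)
      have "(\<rho> g *\<^sub>v isum (dec v)) $ j = (\<Sum>k<d. \<rho> g $$ (j, k) * (\<Sum>i<r. dec v i $ k))"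
        using \<rho>[OF that(3)] j unfolding isum_def
        by (auto simp: scalar_prod_def lessThan_atLeast0 intro!: sum.cong)
      also have "\<dots> = (\<Sum>i<r. \<Sum>k<d. \<rho> g $$ (j, k) * dec v i $ k)"
        unfolding sum_distrib_left by (rule sum.swap)
      also have "\<dots> = (\<Sum>i<r. (\<rho> g *\<^sub>v dec v i) $ j)"
      proof (intro sum.cong refl)
        fix i assume "i \<in> {..<r}"
        then have "dec v i \<in> carrier_vec d" using decW(2)[OF that(1)] by simp
        then show "(\<Sum>k<d. \<rho> g $$ (j, k) * dec v i $ k) = (\<rho> g *\<^sub>v dec v i) $ j"
          using \<rho>[OF that(3)] j by (auto simp: scalar_prod_def lessThan_atLeast0 intro!: sum.cong)
      qed
      finally show "(\<rho> g *\<^sub>v isum (dec v)) $ j = isum (\<lambda>i. \<rho> g *\<^sub>v dec v i) $ j"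
        using j by (simp add: isum_def)
    qed (use \<rho>[OF that(3)] in \<open>simp add: isum_def\<close>)
    finally show "\<rho> g *\<^sub>v v = isum (\<lambda>i. \<rho> g *\<^sub>v dec v i)" .
  qed (use that decW inv in auto)
  have "\<exists>i<r. dec e i \<noteq> 0\<^sub>v d"
  proof (rule ccontr)
    assume "\<not> ?thesis"
    then have "isum (dec e) = 0\<^sub>v d" unfolding isum_def by auto
    then show False using dec(2)[OF e(1)] e(2) by simp
  qed
  then obtain i where i: "i < r" "dec e i \<noteq> 0\<^sub>v d" by blast
  define x where "x = dec e i"
  have x: "x \<in> W i" "x \<in> carrier_vec d" "x \<noteq> 0\<^sub>v d" using decW e(1) i x_def by auto
  have xfix: "\<rho> g *\<^sub>v x = x" if "g \<in> G" for g
    using dec_\<rho>[OF e(1) i(1) that] e(3)[OF that] x_def by simp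
  \<comment> \<open>The line through the fixed component is a nonzero subrepresentation of an
    irreducible summand, hence all of it.\<close>
  have "range (\<lambda>c. c \<cdot>\<^sub>v x) = W i"
  proof -
    have "subrep G d \<rho> (range (\<lambda>c. c \<cdot>\<^sub>v x))"
      unfolding subrep_def using subspace_line[OF x(2)] xfix x(2) \<rho>
      by (auto simp: mult_mat_vec[of _ d d])
    moreover have "range (\<lambda>c. c \<cdot>\<^sub>v x) \<subseteq> W i" using W(4)[OF i(1) x(1)] by auto
    moreover have "range (\<lambda>c. c \<cdot>\<^sub>v x) \<noteq> {0\<^sub>v d}"
    proof
      assume "range (\<lambda>c. c \<cdot>\<^sub>v x) = {0\<^sub>v d}"
      then have "1 \<cdot>\<^sub>v x = 0\<^sub>v d" by blast
      then show False using x by simp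
    qed
    ultimately show ?thesis using irr[OF i(1)] unfolding irreducible_subrep_def by blast
  qed
  then have "\<forall>v. v \<in> carrier_vec d \<longrightarrow> (\<exists>c. dec v i = c \<cdot>\<^sub>v x)"
    using decW(1) i(1) by blast
  then obtain l where l: "\<And>v. v \<in> carrier_vec d \<Longrightarrow> dec v i = l v \<cdot>\<^sub>v x" by metis
  have inj: "a = b" if "a \<cdot>\<^sub>v x = b \<cdot>\<^sub>v x" for a b
  proof -
    obtain j where j: "j < d" "x $ j \<noteq> 0" using x(2,3) by (metis eq_vecI carrier_vecD index_zero_vec)
    have "(a \<cdot>\<^sub>v x) $ j = (b \<cdot>\<^sub>v x) $ j" using that by simp
    then show ?thesis using j x(2) by simp
  qed
  have l_add: "l (v + w) = l v + l w" if "v \<in> carrier_vec d" "w \<in> carrier_vec d" for v w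
    using dec_add[OF that i(1)] l that by (intro inj) (simp add: add_smult_distrib_vec)
  have l_smult: "l (c \<cdot>\<^sub>v v) = c * l v" if "v \<in> carrier_vec d" for c v
    using dec_smult[OF that i(1), of c] l that by (intro inj) (simp add: smult_smult_assoc)
  have l_\<rho>: "l (\<rho> g *\<^sub>v v) = l v" if "v \<in> carrier_vec d" "g \<in> G" for g v
  proof -
    have "\<rho> g *\<^sub>v v \<in> carrier_vec d"
      using mult_mat_vec_carrier[OF \<rho>[OF that(2)] that(1)] .
    then have "l (\<rho> g *\<^sub>v v) \<cdot>\<^sub>v x = \<rho> g *\<^sub>v (l v \<cdot>\<^sub>v x)"
      using dec_\<rho>[OF that(1) i(1) that(2)] l that by simp
    also have "\<dots> = l v \<cdot>\<^sub>v x"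
      using mult_mat_vec[OF \<rho>[OF that(2)] x(2)] xfix[OF that(2)] by simp
    finally show ?thesis by (rule inj)
  qed
  have "l e \<cdot>\<^sub>v x = 1 \<cdot>\<^sub>v x" using l[OF e(1)] x_def by simp
  then have "l e = 1" by (rule inj)
  moreover note lc = linear_functional_coeffs[of d l, OF l_add l_smult]
  have "(\<Sum>j<d. l (unit_vec d j) * v $ j) = l v" if "v \<in> carrier_vec d" for v
    using lc[OF _ _ _ that] by simp
  ultimately show ?thesis
    using l_\<rho> mult_mat_vec_carrier[OF \<rho>] e(1) by (intro exI[of _ "\<lambda>j. l (unit_vec d j)"]) simp
qed

section \<open>Linear actions on tuples, in coordinates\<close>

locale lin_action =
  fixes N :: nat and G :: "complex mat set" and n m :: nat
    and \<phi> :: "complex mat \<Rightarrow> (nat \<Rightarrow> complex mat) \<Rightarrow> nat \<Rightarrow> complex mat"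
  assumes group: "subgroup G (GL N)"
    and action: "algebraic_linear_action N G n m \<phi>"
begin

lemma ga: "group_action (GL N\<lparr>carrier := G\<rparr>) (mat_tuples n m) \<phi>"
  using action unfolding algebraic_linear_action_def by blast

lemma act_closed: "g \<in> G \<Longrightarrow> X \<in> mat_tuples n m \<Longrightarrow> \<phi> g X \<in> mat_tuples n m"
  using group_action.element_image[OF ga] by fastforce

lemma act_mult:
  "g \<in> G \<Longrightarrow> h \<in> G \<Longrightarrow> X \<in> mat_tuples n m \<Longrightarrow> \<phi> g (\<phi> h X) = \<phi> (g * h) X"
  using group_action.composition_rule[OF ga, of X g h]
  by (simp add: GL_def units_of_def ring_mat_def)

lemma one_mem: "1\<^sub>m N \<in> G"
  using subgroup.one_closed[OF group] by (simp add: GL_def units_of_def ring_mat_def)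

lemma mult_mem: "g \<in> G \<Longrightarrow> h \<in> G \<Longrightarrow> g * h \<in> G"
  using subgroup.m_closed[OF group] by (simp add: GL_def units_of_def ring_mat_def)

lemma act_one: "X \<in> mat_tuples n m \<Longrightarrow> \<phi> (1\<^sub>m N) X = X"
  using fun_cong[OF group_action.id_eq_one[OF ga], of X]
  by (simp add: GL_def units_of_def ring_mat_def)

lemma inv_mem: "g \<in> G \<Longrightarrow> \<exists>h\<in>G. g * h = 1\<^sub>m N \<and> h * g = 1\<^sub>m N"
proof -
  assume g: "g \<in> G"
  have grp: "group (GL N)"
    unfolding GL_def by (rule monoid.units_group[OF ring.is_monoid[OF ring_mat]])
  have "inv\<^bsub>GL N\<^esub> g \<in> G" using subgroup.m_inv_closed[OF group g] .
  moreover have "g \<in> carrier (GL N)" using subgroup.subset[OF group] g by blast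
  then have "g \<otimes>\<^bsub>GL N\<^esub> inv\<^bsub>GL N\<^esub> g = \<one>\<^bsub>GL N\<^esub>" "inv\<^bsub>GL N\<^esub> g \<otimes>\<^bsub>GL N\<^esub> g = \<one>\<^bsub>GL N\<^esub>"
    using group.r_inv[OF grp] group.l_inv[OF grp] by blast+
  then show ?thesis using \<open>inv\<^bsub>GL N\<^esub> g \<in> G\<close> by (auto simp: GL_def units_of_def ring_mat_def)
qed

lemma act_inverse:
  assumes "g \<in> G" shows "\<exists>h\<in>G. \<forall>X\<in>mat_tuples n m. \<phi> g (\<phi> h X) = X \<and> \<phi> h (\<phi> g X) = X"
  using inv_mem[OF assms] act_mult act_one assms by metis

lemma act_add:
  "g \<in> G \<Longrightarrow> X \<in> mat_tuples n m \<Longrightarrow> Y \<in> mat_tuples n m \<Longrightarrow>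
    \<phi> g (tuple_add m X Y) = tuple_add m (\<phi> g X) (\<phi> g Y)"
  using action unfolding algebraic_linear_action_def by blast

lemma act_smult:
  "g \<in> G \<Longrightarrow> X \<in> mat_tuples n m \<Longrightarrow> \<phi> g (tuple_smult m c X) = tuple_smult m c (\<phi> g X)"
  using action unfolding algebraic_linear_action_def by blast

lemma act_regular:
  "X \<in> mat_tuples n m \<Longrightarrow> k < m \<Longrightarrow> i < n \<Longrightarrow> j < n \<Longrightarrow> regular_on N G (\<lambda>g. \<phi> g X k $$ (i, j))"
  using action unfolding algebraic_linear_action_def by blast

end

definition idx :: "nat \<Rightarrow> nat \<Rightarrow> (nat \<times> nat \<times> nat) set" where
  "idx n m = {..<m} \<times> {..<n} \<times> {..<n}"

definition entry :: "(nat \<Rightarrow> complex mat) \<Rightarrow> nat \<times> nat \<times> nat \<Rightarrow> complex" where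
  "entry X b = X (fst b) $$ snd b"

definition tuple_of :: "nat \<Rightarrow> nat \<Rightarrow> (nat \<times> nat \<times> nat \<Rightarrow> complex) \<Rightarrow> nat \<Rightarrow> complex mat" where
  "tuple_of n m x = (\<lambda>k\<in>{..<m}. mat n n (\<lambda>ij. x (k, ij)))"

lemma finite_idx [simp]: "finite (idx n m)"
  by (simp add: idx_def)

lemma tuple_of_mem [simp]: "tuple_of n m x \<in> mat_tuples n m"
  unfolding tuple_of_def mat_tuples_def by auto

lemma entry_tuple_of [simp]: "b \<in> idx n m \<Longrightarrow> entry (tuple_of n m x) b = x b"
  unfolding tuple_of_def entry_def idx_def by auto

lemma mat_tuples_eqI:
  assumes "X \<in> mat_tuples n m" "Y \<in> mat_tuples n m" "\<And>b. b \<in> idx n m \<Longrightarrow> entry X b = entry Y b"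
  shows "X = Y"
proof
  fix k
  show "X k = Y k"
  proof (cases "k < m")
    case True
    then have XY: "X k \<in> carrier_mat n n" "Y k \<in> carrier_mat n n"
      using assms(1,2) unfolding mat_tuples_def by auto
    show ?thesis
    proof (rule eq_matI)
      fix i j assume "i < dim_row (Y k)" "j < dim_col (Y k)"
      then show "X k $$ (i, j) = Y k $$ (i, j)"
        using assms(3)[of "(k, i, j)"] XY True unfolding entry_def idx_def by auto
    qed (use XY in auto)
  next
    case False
    then show ?thesis using assms(1,2) unfolding mat_tuples_def by (auto simp: PiE_def extensional_def)
  qed
qed

lemma mat_tuples_carrier: "X \<in> mat_tuples n m \<Longrightarrow> k < m \<Longrightarrow> X k \<in> carrier_mat n n"
  unfolding mat_tuples_def by auto

lemma tuple_add_mem: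
  assumes "X \<in> mat_tuples n m" "Y \<in> mat_tuples n m" shows "tuple_add m X Y \<in> mat_tuples n m"
  unfolding mat_tuples_def tuple_add_def restrict_PiE_iff
  using mat_tuples_carrier[OF assms(1)] mat_tuples_carrier[OF assms(2)] by (simp add: add_carrier_mat)

lemma tuple_smult_mem:
  assumes "X \<in> mat_tuples n m" shows "tuple_smult m c X \<in> mat_tuples n m"
  unfolding mat_tuples_def tuple_smult_def restrict_PiE_iff
  using mat_tuples_carrier[OF assms] by simp

lemma tuple_zero_mem: "tuple_zero n m \<in> mat_tuples n m"
  unfolding mat_tuples_def tuple_zero_def restrict_PiE_iff by simp

lemma entry_tuple_add:
  "X \<in> mat_tuples n m \<Longrightarrow> Y \<in> mat_tuples n m \<Longrightarrow> b \<in> idx n m \<Longrightarrow>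
    entry (tuple_add m X Y) b = entry X b + entry Y b"
  unfolding entry_def tuple_add_def idx_def
  using mat_tuples_carrier[of X n m "fst b"] mat_tuples_carrier[of Y n m "fst b"] by auto

lemma entry_tuple_smult:
  "X \<in> mat_tuples n m \<Longrightarrow> b \<in> idx n m \<Longrightarrow> entry (tuple_smult m c X) b = c * entry X b"
  unfolding entry_def tuple_smult_def idx_def
  using mat_tuples_carrier[of X n m "fst b"] by auto

lemma entry_tuple_zero: "b \<in> idx n m \<Longrightarrow> entry (tuple_zero n m) b = 0"
  unfolding entry_def tuple_zero_def idx_def by auto

definition basis_tuple :: "nat \<Rightarrow> nat \<Rightarrow> nat \<times> nat \<times> nat \<Rightarrow> nat \<Rightarrow> complex mat" where
  "basis_tuple n m b = tuple_of n m (\<lambda>c. if c = b then 1 else 0)"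

lemma basis_tuple_mem [simp]: "basis_tuple n m b \<in> mat_tuples n m"
  by (simp add: basis_tuple_def)

context lin_action
begin

lemma act_zero: "g \<in> G \<Longrightarrow> \<phi> g (tuple_zero n m) = tuple_zero n m"
proof -
  assume g: "g \<in> G"
  have "tuple_smult m 0 X = tuple_zero n m" if "X \<in> mat_tuples n m" for X
    using that by (intro mat_tuples_eqI[of _ n m])
      (auto simp: tuple_smult_mem tuple_zero_mem entry_tuple_smult[of _ n] entry_tuple_zero)
  then show ?thesis using act_smult[OF g tuple_zero_mem, of 0] act_closed[OF g tuple_zero_mem] tuple_zero_mem
    by metis
qed

lemma act_expand:
  assumes g: "g \<in> G" and X: "X \<in> mat_tuples n m" and c: "c \<in> idx n m"
  shows "entry (\<phi> g X) c = (\<Sum>b\<in>idx n m. entry X b * entry (\<phi> g (basis_tuple n m b)) c)"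
proof -
  have "finite S \<Longrightarrow> S \<subseteq> idx n m \<Longrightarrow>
      entry (\<phi> g (tuple_of n m (\<lambda>b. if b \<in> S then entry X b else 0))) c
      = (\<Sum>b\<in>S. entry X b * entry (\<phi> g (basis_tuple n m b)) c)" for S
  proof (induction S rule: finite_induct)
    case empty
    have "tuple_of n m (\<lambda>b. if b \<in> {} then entry X b else 0) = tuple_zero n m"
      by (intro mat_tuples_eqI[of _ n m]) (auto simp: tuple_zero_mem entry_tuple_zero)
    then show ?case using act_zero[OF g] c by (simp add: entry_tuple_zero)
  next
    case (insert b S)
    let ?Y = "tuple_of n m (\<lambda>b. if b \<in> S then entry X b else 0)"
    let ?Z = "tuple_smult m (entry X b) (basis_tuple n m b)"
    have "tuple_of n m (\<lambda>a. if a \<in> insert b S then entry X a else 0) = tuple_add m ?Y ?Z"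
      using insert by (intro mat_tuples_eqI[of _ n m])
        (auto simp: tuple_add_mem tuple_smult_mem entry_tuple_add[of _ n] entry_tuple_smult[of _ n] basis_tuple_def)
    then have "\<phi> g (tuple_of n m (\<lambda>a. if a \<in> insert b S then entry X a else 0))
        = tuple_add m (\<phi> g ?Y) (tuple_smult m (entry X b) (\<phi> g (basis_tuple n m b)))"
      using act_add[OF g, of ?Y ?Z] act_smult[OF g, of "basis_tuple n m b" "entry X b"]
      by (simp add: tuple_smult_mem)
    then show ?case using insert c
      by (simp add: entry_tuple_add[of _ n] entry_tuple_smult[of _ n] act_closed[OF g] tuple_smult_mem)
  qed
  from this[of "idx n m"]
  have "entry (\<phi> g (tuple_of n m (\<lambda>b. if b \<in> idx n m then entry X b else 0))) c
      = (\<Sum>b\<in>idx n m. entry X b * entry (\<phi> g (basis_tuple n m b)) c)" by simp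
  moreover have "tuple_of n m (\<lambda>b. if b \<in> idx n m then entry X b else 0) = X"
    using X by (intro mat_tuples_eqI[of _ n m]) auto
  ultimately show ?thesis by simp
qed

end

lemma tuple_coords_eq: "tuple_coords n m = (\<lambda>b X. entry X b) ` idx n m"
proof -
  have "tuple_coords n m = {(\<lambda>X. entry X b) | b. b \<in> idx n m}"
    unfolding tuple_coords_def idx_def entry_def by auto
  then show ?thesis by blast
qed

lemma entry_poly_funs: "b \<in> idx n m \<Longrightarrow> (\<lambda>X. entry X b) \<in> poly_funs (tuple_coords n m)"
  unfolding tuple_coords_eq by (rule poly_funs.coord) (rule imageI)

lemma poly_funs_sum:
  "finite I \<Longrightarrow> (\<And>i. i \<in> I \<Longrightarrow> f i \<in> poly_funs C) \<Longrightarrow> (\<lambda>x. \<Sum>i\<in>I. f i x) \<in> poly_funs C"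
  by (induction I rule: finite_induct) (auto intro: poly_funs.intros)

lemma regular_on_const: "regular_on N G (\<lambda>_. c)"
  unfolding regular_on_def by (auto intro: poly_funs.const)

lemma regular_on_add: "regular_on N G f \<Longrightarrow> regular_on N G h \<Longrightarrow> regular_on N G (\<lambda>g. f g + h g)"
  unfolding regular_on_def
proof (elim bexE)
  fix p q assume "p \<in> poly_funs (GL_coords N)" "q \<in> poly_funs (GL_coords N)"
    "\<forall>g\<in>G. f g = p g" "\<forall>g\<in>G. h g = q g"
  then show "\<exists>p\<in>poly_funs (GL_coords N). \<forall>g\<in>G. f g + h g = p g"
    by (intro bexI[OF _ poly_funs.add[of p _ q]]) auto
qed

lemma regular_on_mult: "regular_on N G f \<Longrightarrow> regular_on N G h \<Longrightarrow> regular_on N G (\<lambda>g. f g * h g)"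
  unfolding regular_on_def
proof (elim bexE)
  fix p q assume "p \<in> poly_funs (GL_coords N)" "q \<in> poly_funs (GL_coords N)"
    "\<forall>g\<in>G. f g = p g" "\<forall>g\<in>G. h g = q g"
  then show "\<exists>p\<in>poly_funs (GL_coords N). \<forall>g\<in>G. f g * h g = p g"
    by (intro bexI[OF _ poly_funs.mult[of p _ q]]) auto
qed

lemma regular_on_sum:
  "finite I \<Longrightarrow> (\<And>i. i \<in> I \<Longrightarrow> regular_on N G (f i)) \<Longrightarrow> regular_on N G (\<lambda>g. \<Sum>i\<in>I. f i g)"
  by (induction I rule: finite_induct) (auto intro: regular_on_const regular_on_add)

lemma regular_on_cong: "(\<And>g. g \<in> G \<Longrightarrow> f g = h g) \<Longrightarrow> regular_on N G f \<longleftrightarrow> regular_on N G h"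
  unfolding regular_on_def by auto

text \<open>Expansions of sums and products are naturally indexed by disjoint unions and cartesian
  products; this returns to an initial segment of the natural numbers.\<close>

lemma finite_rank_reindex:
  fixes q :: "'x \<Rightarrow> complex" and a :: "'i \<Rightarrow> 'g \<Rightarrow> complex"
  assumes fI: "finite I" and qI: "\<And>g X. g \<in> G \<Longrightarrow> X \<in> V \<Longrightarrow> q (\<phi> g X) = (\<Sum>l\<in>I. a l g * b l X)"
  shows "\<exists>(r::nat) a b. \<forall>g\<in>G. \<forall>X\<in>V. q (\<phi> g X) = (\<Sum>l<r. a l g * b l X)"
proof -
  obtain h where h: "bij_betw h {0..<card I} I" using ex_bij_betw_nat_finite[OF fI] by blast
  have "q (\<phi> g X) = (\<Sum>l<card I. a (h l) g * b (h l) X)" if "g \<in> G" "X \<in> V" for g X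
    using qI[OF that] sum.reindex_bij_betw[OF h, of "\<lambda>l. a l g * b l X"]
    by (simp add: atLeast0LessThan)
  then show ?thesis by (intro exI[of _ "card I"] exI[of _ "\<lambda>l. a (h l)"] exI[of _ "\<lambda>l. b (h l)"]) simp
qed

context lin_action
begin

lemma poly_funs_translate:
  assumes g: "g \<in> G" and p: "p \<in> poly_funs (tuple_coords n m)"
  shows "\<exists>q\<in>poly_funs (tuple_coords n m). \<forall>X\<in>mat_tuples n m. q X = p (\<phi> g X)"
  using p
proof (induction rule: poly_funs.induct)
  case (const c)
  then show ?case by (intro bexI[of _ "\<lambda>_. c"]) (auto intro: poly_funs.const)
next
  case (coord f)
  then obtain c where c: "c \<in> idx n m" "f = (\<lambda>X. entry X c)" unfolding tuple_coords_eq by blast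
  have "(\<lambda>X. \<Sum>b\<in>idx n m. entry X b * entry (\<phi> g (basis_tuple n m b)) c) \<in> poly_funs (tuple_coords n m)"
    by (intro poly_funs_sum finite_idx poly_funs.mult[OF entry_poly_funs poly_funs.const])
  then show ?case by (rule bexI[rotated]) (unfold c(2), intro ballI act_expand[OF g _ c(1), symmetric])
next
  case (add f h)
  then obtain f' h' where "f' \<in> poly_funs (tuple_coords n m)" "h' \<in> poly_funs (tuple_coords n m)"
    "\<forall>X\<in>mat_tuples n m. f' X = f (\<phi> g X)" "\<forall>X\<in>mat_tuples n m. h' X = h (\<phi> g X)" by blast
  then show ?case by (intro bexI[OF _ poly_funs.add[of f' _ h']]) auto
next
  case (mult f h)
  then obtain f' h' where "f' \<in> poly_funs (tuple_coords n m)" "h' \<in> poly_funs (tuple_coords n m)"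
    "\<forall>X\<in>mat_tuples n m. f' X = f (\<phi> g X)" "\<forall>X\<in>mat_tuples n m. h' X = h (\<phi> g X)" by blast
  then show ?case by (intro bexI[OF _ poly_funs.mult[of f' _ h']]) auto
qed

lemma poly_funs_orbit_regular:
  assumes X: "X \<in> mat_tuples n m" and p: "p \<in> poly_funs (tuple_coords n m)"
  shows "regular_on N G (\<lambda>g. p (\<phi> g X))"
  using p
proof (induction rule: poly_funs.induct)
  case (coord f)
  then show ?case using act_regular[OF X] unfolding tuple_coords_def by auto
qed (auto intro: regular_on_const regular_on_add regular_on_mult)

text \<open>For coordinates this is the matrix of the action, and expansions combine under sums and
  products. The number \<open>r\<close> bounds the dimension of the span of the translates of
  \<open>p\<close>.\<close>

lemma poly_funs_finite_rank:
  assumes p: "p \<in> poly_funs (tuple_coords n m)"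
  shows "\<exists>(r::nat) a b. \<forall>g\<in>G. \<forall>X\<in>mat_tuples n m. p (\<phi> g X) = (\<Sum>l<r. a l g * b l X)"
proof -
  show ?thesis using p
  proof (induction rule: poly_funs.induct)
    case (const c)
    show ?case by (intro exI[of _ 1] exI[of _ "\<lambda>_ _. c"] exI[of _ "\<lambda>_ _. 1"]) simp
  next
    case (coord f)
    then obtain c where c: "c \<in> idx n m" "f = (\<lambda>X. entry X c)" unfolding tuple_coords_eq by blast
    show ?case
    proof (rule finite_rank_reindex)
      fix g X assume "g \<in> G" "X \<in> mat_tuples n m"
      then show "f (\<phi> g X) = (\<Sum>b\<in>idx n m. entry (\<phi> g (basis_tuple n m b)) c * entry X b)"
        unfolding c(2) by (subst mult.commute) (rule act_expand[OF _ _ c(1)])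
    qed simp
  next
    case (add f h)
    then obtain r a b r' a' b' where *:
      "\<forall>g\<in>G. \<forall>X\<in>mat_tuples n m. f (\<phi> g X) = (\<Sum>l<(r::nat). a l g * b l X)"
      "\<forall>g\<in>G. \<forall>X\<in>mat_tuples n m. h (\<phi> g X) = (\<Sum>l<(r'::nat). a' l g * b' l X)" by (elim exE) (rule that)
    show ?case
    proof (rule finite_rank_reindex)
      fix g X assume "g \<in> G" "X \<in> mat_tuples n m"
      then show "f (\<phi> g X) + h (\<phi> g X)
          = (\<Sum>l\<in>{..<r} <+> {..<r'}. case_sum a a' l g * case_sum b b' l X)"
        using * by (simp add: sum.Plus)
    qed simp
  next
    case (mult f h)
    then obtain r a b r' a' b' where *:
      "\<forall>g\<in>G. \<forall>X\<in>mat_tuples n m. f (\<phi> g X) = (\<Sum>l<(r::nat). a l g * b l X)"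
      "\<forall>g\<in>G. \<forall>X\<in>mat_tuples n m. h (\<phi> g X) = (\<Sum>l<(r'::nat). a' l g * b' l X)" by (elim exE) (rule that)
    show ?case
    proof (rule finite_rank_reindex)
      fix g X assume "g \<in> G" "X \<in> mat_tuples n m"
      then have "f (\<phi> g X) * h (\<phi> g X) = (\<Sum>l<r. a l g * b l X) * (\<Sum>l<r'. a' l g * b' l X)"
        using * by simp
      also have "\<dots> = (\<Sum>l\<in>{..<r} \<times> {..<r'}. (a (fst l) g * b (fst l) X) * (a' (snd l) g * b' (snd l) X))"
        unfolding sum_product sum.cartesian_product by (intro sum.cong refl) (auto simp: case_prod_beta)
      also have "\<dots> = (\<Sum>l\<in>{..<r} \<times> {..<r'}. (a (fst l) g * a' (snd l) g) * (b (fst l) X * b' (snd l) X))"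
        by (intro sum.cong refl) (simp only: ac_simps)
      finally show "f (\<phi> g X) * h (\<phi> g X)
        = (\<Sum>l\<in>{..<r} \<times> {..<r'}. (a (fst l) g * a' (snd l) g) * (b (fst l) X * b' (snd l) X))" .
    qed simp
  qed
qed

end

section \<open>Determinants of low rank and of bordered matrices\<close>

lemma mult_mat_vec_index:
  assumes "A \<in> carrier_mat n k" "v \<in> carrier_vec k" "i < n"
  shows "(A *\<^sub>v v) $ i = (\<Sum>j<k. A $$ (i, j) * v $ j)"
  using assms by (auto simp: scalar_prod_def lessThan_atLeast0 intro!: sum.cong)

lemma det_zero_of_low_rank:
  fixes a :: "nat \<Rightarrow> nat \<Rightarrow> complex"
  assumes "r < d" and M: "M \<in> carrier_mat d d"
    and fac: "\<And>i j. i < d \<Longrightarrow> j < d \<Longrightarrow> M $$ (i, j) = (\<Sum>l<r. a l i * b l j)"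
  shows "det M = 0"
proof -
  define A where "A = mat d d (\<lambda>(i, l). if l < r then a l i else 0)"
  define B where "B = mat d d (\<lambda>(l, j). if l < r then b l j else 0)"
  have "A *\<^sub>v unit_vec d r = 0\<^sub>v d"
  proof (rule eq_vecI)
    fix i assume "i < dim_vec (0\<^sub>v d :: complex vec)"
    then show "(A *\<^sub>v unit_vec d r) $ i = 0\<^sub>v d $ i"
      using assms(1) by (simp add: A_def)
  qed (simp add: A_def)
  moreover have "unit_vec d r \<noteq> (0\<^sub>v d :: complex vec)" using assms(1) by (simp add: unit_vec_nonzero)
  ultimately have "det A = 0"
    using det_0_iff_vec_prod_zero[of A d] by (auto simp: A_def intro!: exI[of _ "unit_vec d r"])
  moreover have "M = A * B"
  proof (rule eq_matI)
    fix i j assume "i < dim_row (A * B)" "j < dim_col (A * B)"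
    then have ij: "i < d" "j < d" by (auto simp: A_def B_def)
    have "(A * B) $$ (i, j) = (\<Sum>l\<in>{0..<d}. A $$ (i, l) * B $$ (l, j))"
      using ij by (simp add: scalar_prod_def A_def B_def)
    also have "\<dots> = (\<Sum>l\<in>{..<r}. a l i * b l j)"
      using ij assms(1) by (intro sum.mono_neutral_cong_right) (auto simp: A_def B_def)
    finally show "M $$ (i, j) = (A * B) $$ (i, j)" using fac[OF ij] by simp
  qed (use M in \<open>auto simp: A_def B_def\<close>)
  ultimately show ?thesis by (simp add: det_mult[of _ d] A_def B_def)
qed

text \<open>The Schur complement of an invertible block in a singular bordered matrix vanishes. A
  kernel vector shows it: its last coordinate is nonzero, since otherwise invertibility of
  \<open>M\<close> would make the whole vector zero.\<close>

lemma bordered_det_zero: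
  fixes c :: "nat \<Rightarrow> complex"
  assumes M: "M \<in> carrier_mat d d" and M': "M' \<in> carrier_mat d d" "M' * M = 1\<^sub>m d"
    and det0: "det (mat (Suc d) (Suc d) (\<lambda>(i, j). if i < d then (if j < d then M $$ (i, j) else u i)
                 else (if j < d then c j else s))) = 0"
  shows "s = (\<Sum>i<d. (\<Sum>j<d. c j * M' $$ (j, i)) * u i)"
proof -
  let ?N = "mat (Suc d) (Suc d) (\<lambda>(i, j). if i < d then (if j < d then M $$ (i, j) else u i)
                 else (if j < d then c j else s))"
  obtain v where v: "v \<in> carrier_vec (Suc d)" "v \<noteq> 0\<^sub>v (Suc d)" "?N *\<^sub>v v = 0\<^sub>v (Suc d)"
    using det0 det_0_iff_vec_prod_zero[of ?N "Suc d"] by auto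
  have row: "(\<Sum>j<d. ?N $$ (i, j) * v $ j) + ?N $$ (i, d) * v $ d = 0" if "i < Suc d" for i
  proof -
    have "(?N *\<^sub>v v) $ i = (\<Sum>j<Suc d. ?N $$ (i, j) * v $ j)"
      using that v(1) by (intro mult_mat_vec_index[of _ "Suc d"]) auto
    then show ?thesis using v(3) that by simp
  qed
  define w where "w = v $ d"
  have r1: "(\<Sum>j<d. M $$ (i, j) * v $ j) = - (u i * w)" if "i < d" for i
  proof -
    have "(\<Sum>j<d. ?N $$ (i, j) * v $ j) = (\<Sum>j<d. M $$ (i, j) * v $ j)"
      using that by (intro sum.cong) auto
    then show ?thesis using row[of i] that by (simp add: w_def eq_neg_iff_add_eq_0)
  qed
  have r2: "(\<Sum>j<d. c j * v $ j) + s * w = 0"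
  proof -
    have "(\<Sum>j<d. ?N $$ (d, j) * v $ j) = (\<Sum>j<d. c j * v $ j)" by (intro sum.cong) auto
    then show ?thesis using row[of d] by (simp add: w_def)
  qed
  have vk: "v $ k = - (\<Sum>i<d. M' $$ (k, i) * u i) * w" if "k < d" for k
  proof -
    have "(\<Sum>i<d. M' $$ (k, i) * (\<Sum>j<d. M $$ (i, j) * v $ j))
        = (\<Sum>j<d. (\<Sum>i<d. M' $$ (k, i) * M $$ (i, j)) * v $ j)"
      unfolding sum_distrib_left sum_distrib_right mult.assoc by (rule sum.swap)
    also have "\<dots> = (\<Sum>j<d. (M' * M) $$ (k, j) * v $ j)"
      using that M M'(1) by (intro sum.cong) (auto simp: scalar_prod_def atLeast0LessThan)
    also have "\<dots> = (\<Sum>j<d. (if j = k then v $ k else 0))"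
      using that unfolding M'(2) by (intro sum.cong) auto
    also have "\<dots> = v $ k" using that by simp
    finally have "v $ k = (\<Sum>i<d. M' $$ (k, i) * (\<Sum>j<d. M $$ (i, j) * v $ j))" by simp
    also have "\<dots> = (\<Sum>i<d. M' $$ (k, i) * (- (u i * w)))" using r1 by (intro sum.cong) auto
    finally have "v $ k = (\<Sum>i<d. M' $$ (k, i) * (- (u i * w)))" .
    then show ?thesis by (simp add: sum_distrib_right sum_negf mult.assoc)
  qed
  have "w \<noteq> 0"
  proof
    assume "w = 0"
    then have "v $ k = 0" if "k < Suc d" for k using vk that w_def by (cases "k = d") auto
    then show False using v(1,2) by auto
  qed
  have "(\<Sum>j<d. c j * v $ j) = - (\<Sum>j<d. c j * (\<Sum>i<d. M' $$ (j, i) * u i)) * w"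
  proof -
    have "(\<Sum>j<d. c j * v $ j) = (\<Sum>j<d. c j * (- (\<Sum>i<d. M' $$ (j, i) * u i) * w))"
      using vk by (intro sum.cong) auto
    also have "\<dots> = (\<Sum>j<d. (- w) * (c j * (\<Sum>i<d. M' $$ (j, i) * u i)))"
      by (intro sum.cong) simp_all
    finally show ?thesis by (simp only: sum_distrib_left[symmetric]) simp
  qed
  also have "(\<Sum>j<d. c j * (\<Sum>i<d. M' $$ (j, i) * u i)) = (\<Sum>i<d. (\<Sum>j<d. c j * M' $$ (j, i)) * u i)"
    unfolding sum_distrib_left sum_distrib_right mult.assoc by (rule sum.swap)
  finally have "(s - (\<Sum>i<d. (\<Sum>j<d. c j * M' $$ (j, i)) * u i)) * w = 0"
    using r2 by (simp add: algebra_simps)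
  then show ?thesis using \<open>w \<noteq> 0\<close> by simp
qed

context lin_action
begin

text \<open>Take a largest nonsingular matrix of samples p(g_i x_j); finite rank bounds its size.
  Every larger matrix of samples is singular, and the vanishing of bordered determinants expresses
  all translates of \<open>p\<close> through the chosen ones.\<close>

lemma translates_basis:
  assumes p: "p \<in> poly_funs (tuple_coords n m)"
  shows "\<exists>d gs xs M'. (\<forall>i<(d::nat). gs i \<in> G \<and> xs i \<in> mat_tuples n m) \<and> M' \<in> carrier_mat d d \<and>
     mat d d (\<lambda>(i, j). p (\<phi> (gs i) (xs j))) * M' = 1\<^sub>m d \<and>
     (\<forall>g\<in>G. \<forall>X\<in>mat_tuples n m.
       p (\<phi> g X) = (\<Sum>i<d. (\<Sum>j<d. p (\<phi> g (xs j)) * M' $$ (j, i)) * p (\<phi> (gs i) X)))"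
proof -
  define P where "P d \<longleftrightarrow> (\<exists>gs xs. (\<forall>i<(d::nat). gs i \<in> G \<and> xs i \<in> mat_tuples n m) \<and>
    det (mat d d (\<lambda>(i, j). p (\<phi> (gs i) (xs j)))) \<noteq> 0)" for d
  obtain r a b where r: "\<forall>g\<in>G. \<forall>X\<in>mat_tuples n m. p (\<phi> g X) = (\<Sum>l<(r::nat). a l g * b l X)"
    using poly_funs_finite_rank[OF p] by (elim exE)
  have "d \<le> r" if "P d" for d
  proof (rule ccontr)
    assume "\<not> d \<le> r"
    then have "r < d" by simp
    obtain gs xs where *: "\<forall>i<d. gs i \<in> G \<and> xs i \<in> mat_tuples n m"
      "det (mat d d (\<lambda>(i, j). p (\<phi> (gs i) (xs j)))) \<noteq> 0" using \<open>P d\<close> unfolding P_def by (elim exE conjE)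
    show False
      using * r det_zero_of_low_rank[OF \<open>r < d\<close>, of "mat d d (\<lambda>(i, j). p (\<phi> (gs i) (xs j)))"
          "\<lambda>l i. a l (gs i)" "\<lambda>l j. b l (xs j)"] by simp
  qed
  moreover have "P 0" unfolding P_def by simp
  ultimately obtain d where d: "P d" "\<And>e. P e \<Longrightarrow> e \<le> d"
    using Greatest_le_nat[of P _ r] GreatestI_nat[of P 0 r] by metis
  obtain gs xs where *: "\<forall>i<d. gs i \<in> G \<and> xs i \<in> mat_tuples n m"
      "det (mat d d (\<lambda>(i, j). p (\<phi> (gs i) (xs j)))) \<noteq> 0"
    using d(1) unfolding P_def by (elim exE conjE)
  define M where "M = mat d d (\<lambda>(i, j). p (\<phi> (gs i) (xs j)))"
  have cM: "M \<in> carrier_mat d d" unfolding M_def by simp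
  obtain M' where M': "M' \<in> carrier_mat d d" "M * M' = 1\<^sub>m d" "M' * M = 1\<^sub>m d"
    using det_non_zero_imp_unit[OF cM, of "()"] *(2) unfolding M_def[symmetric] Units_def ring_mat_def
    by auto
  have "p (\<phi> g X) = (\<Sum>i<d. (\<Sum>j<d. p (\<phi> g (xs j)) * M' $$ (j, i)) * p (\<phi> (gs i) X))"
    if gX: "g \<in> G" "X \<in> mat_tuples n m" for g X
  proof -
    \<comment> \<open>Adjoining \<open>g\<close> and \<open>X\<close> to the samples gives a
      determinant of size \<open>Suc d\<close>, which vanishes by maximality of
      \<open>d\<close>.\<close>
    define gs' xs' where "gs' = gs(d := g)" and "xs' = xs(d := X)"
    have "\<not> P (Suc d)" using d(2)[of "Suc d"] by auto
    moreover have "\<forall>i<Suc d. gs' i \<in> G \<and> xs' i \<in> mat_tuples n m"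
      using *(1) gX unfolding gs'_def xs'_def by (simp add: less_Suc_eq)
    ultimately have "det (mat (Suc d) (Suc d) (\<lambda>(i, j). p (\<phi> (gs' i) (xs' j)))) = 0"
      unfolding P_def by blast
    moreover have "mat (Suc d) (Suc d) (\<lambda>(i, j). p (\<phi> (gs' i) (xs' j)))
      = mat (Suc d) (Suc d) (\<lambda>(i, j). if i < d then (if j < d then M $$ (i, j) else p (\<phi> (gs i) X))
                 else (if j < d then p (\<phi> g (xs j)) else p (\<phi> g X)))"
      by (rule eq_matI) (auto simp: gs'_def xs'_def M_def)
    ultimately show ?thesis using bordered_det_zero[OF cM M'(1,3)] by simp
  qed
  then show ?thesis using *(1) M' unfolding M_def by blast
qed

text \<open>The vectors \<open>u Y\<close> of values of finitely many translates of \<open>p\<close>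
  carry a rational representation. The zero tuple gives a nonzero fixed vector, and complete
  reducibility an invariant functional that is nonzero on it. Composed with \<open>u\<close>, this
  is an invariant polynomial; it is 0 at \<open>X\<close> because all translates of \<open>p\<close>
  vanish there.\<close>

theorem separating_invariant:
  assumes red: "reductive_group N G" and X: "X \<in> mat_tuples n m" "X \<notin> null_cone N G n m \<phi>"
  shows "\<exists>q\<in>poly_funs (tuple_coords n m).
    (\<forall>g\<in>G. \<forall>Y\<in>mat_tuples n m. q (\<phi> g Y) = q Y) \<and> q X \<noteq> q (tuple_zero n m)"
proof -
  let ?O = "tuple_zero n m"
  have "?O \<notin> zariski_closure (tuple_coords n m) (mat_tuples n m) (orbit (GL N\<lparr>carrier := G\<rparr>) \<phi> X)"
    using X unfolding null_cone_def by blast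
  then obtain p where p: "p \<in> poly_funs (tuple_coords n m)"
    "\<forall>Y \<in> orbit (GL N\<lparr>carrier := G\<rparr>) \<phi> X. p Y = 0" "p ?O \<noteq> 0"
    unfolding zariski_closure_def using tuple_zero_mem by blast
  have pX: "p (\<phi> g X) = 0" if "g \<in> G" for g
    using p(2) that unfolding orbit_def by auto
  obtain d gs xs M' where gs: "\<forall>i<(d::nat). gs i \<in> G \<and> xs i \<in> mat_tuples n m" and M': "M' \<in> carrier_mat d d"
     and MM': "mat d d (\<lambda>(i, j). p (\<phi> (gs i) (xs j))) * M' = 1\<^sub>m d"
     and exp: "\<forall>g\<in>G. \<forall>X\<in>mat_tuples n m.
       p (\<phi> g X) = (\<Sum>i<d. (\<Sum>j<d. p (\<phi> g (xs j)) * M' $$ (j, i)) * p (\<phi> (gs i) X))"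
    using translates_basis[OF p(1)] by (elim exE conjE)
  define M where "M = mat d d (\<lambda>(i, j). p (\<phi> (gs i) (xs j)))"
  define u where "u Y = vec d (\<lambda>i. p (\<phi> (gs i) Y))" for Y
  \<comment> \<open>The coefficients that expand the translate by \<open>gs i * g\<close> in the
    translates by the \<open>gs k\<close>, as provided by \<open>translates_basis\<close>.\<close>
  define \<rho> where "\<rho> g = mat d d (\<lambda>(i, k). \<Sum>j<d. p (\<phi> (gs i) (\<phi> g (xs j))) * M' $$ (j, k))" for g
  have c\<rho>: "\<rho> g \<in> carrier_mat d d" for g unfolding \<rho>_def by simp
  have cu: "u Y \<in> carrier_vec d" for Y unfolding u_def by simp
  have cM: "M \<in> carrier_mat d d" unfolding M_def by simp
  have M'M: "M * M' = 1\<^sub>m d" "M' * M = 1\<^sub>m d"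
    using MM' mat_mult_left_right_inverse[OF cM M'] unfolding M_def by auto
  have \<rho>u: "\<rho> g *\<^sub>v u Y = u (\<phi> g Y)" if "g \<in> G" "Y \<in> mat_tuples n m" for g Y
  proof (rule eq_vecI)
    fix i assume "i < dim_vec (u (\<phi> g Y))"
    then have i: "i < d" by (simp add: u_def)
    have gi: "gs i \<in> G" "gs i * g \<in> G" using gs i that mult_mem by auto
    have "u (\<phi> g Y) $ i = p (\<phi> (gs i * g) Y)"
      using i act_mult[OF gi(1) that] by (simp add: u_def)
    also have "\<dots> = (\<Sum>k<d. (\<Sum>j<d. p (\<phi> (gs i * g) (xs j)) * M' $$ (j, k)) * p (\<phi> (gs k) Y))"
      using exp gi(2) that(2) by blast
    also have "\<dots> = (\<Sum>k<d. \<rho> g $$ (i, k) * u Y $ k)"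
    proof (intro sum.cong refl)
      fix k assume "k \<in> {..<d}"
      then have k: "k < d" by simp
      have "(\<Sum>j<d. p (\<phi> (gs i * g) (xs j)) * M' $$ (j, k)) = \<rho> g $$ (i, k)"
        using i k gs act_mult[OF gi(1) that(1)] by (auto simp: \<rho>_def intro!: sum.cong)
      then show "(\<Sum>j<d. p (\<phi> (gs i * g) (xs j)) * M' $$ (j, k)) * p (\<phi> (gs k) Y)
          = \<rho> g $$ (i, k) * u Y $ k" using k by (simp add: u_def)
    qed
    also have "\<dots> = (\<rho> g *\<^sub>v u Y) $ i"
      using mult_mat_vec_index[OF c\<rho> cu i] by simp
    finally show "(\<rho> g *\<^sub>v u Y) $ i = u (\<phi> g Y) $ i" by simp
  qed (simp add: u_def \<rho>_def)
  have colM: "col M j = u (xs j)" if "j < d" for j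
    using that unfolding M_def u_def by (intro eq_vecI) auto
  \<comment> \<open>The vectors \<open>u (xs j)\<close> are the columns of the invertible matrix
    \<open>M\<close>, so matrix identities may be tested on them.\<close>
  have \<rho>_eqI: "A = B" if "A \<in> carrier_mat d d" "B \<in> carrier_mat d d"
    "\<And>j. j < d \<Longrightarrow> A *\<^sub>v u (xs j) = B *\<^sub>v u (xs j)" for A B
  proof -
    have "A * M = B * M"
    proof (rule eq_matI)
      fix i j assume "i < dim_row (B * M)" "j < dim_col (B * M)"
      then have ij: "i < d" "j < d" using that cM by auto
      have "(A * M) $$ (i, j) = (A *\<^sub>v col M j) $ i" using ij that cM by simp
      also have "\<dots> = (B *\<^sub>v col M j) $ i" using that(3)[OF ij(2)] colM[OF ij(2)] by simp
      also have "\<dots> = (B * M) $$ (i, j)" using ij that cM by simp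
      finally show "(A * M) $$ (i, j) = (B * M) $$ (i, j)" .
    qed (use that cM in auto)
    then have "A * (M * M') = B * (M * M')"
      using assoc_mult_mat[OF that(1) cM M'] assoc_mult_mat[OF that(2) cM M'] by simp
    then show ?thesis using M'M that by simp
  qed
  have \<rho>_mult: "\<rho> (g * h) = \<rho> g * \<rho> h" if "g \<in> G" "h \<in> G" for g h
  proof (rule \<rho>_eqI)
    fix j assume "j < d"
    then have x: "xs j \<in> mat_tuples n m" using gs by blast
    have "\<rho> (g * h) *\<^sub>v u (xs j) = u (\<phi> g (\<phi> h (xs j)))"
      using \<rho>u[OF mult_mem[OF that] x] act_mult[OF that x] by simp
    also have "\<dots> = \<rho> g *\<^sub>v (\<rho> h *\<^sub>v u (xs j))"
      using \<rho>u[OF that(1) act_closed[OF that(2) x]] \<rho>u[OF that(2) x] by simp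
    finally show "\<rho> (g * h) *\<^sub>v u (xs j) = (\<rho> g * \<rho> h) *\<^sub>v u (xs j)"
      using assoc_mult_mat_vec[OF c\<rho> c\<rho> cu] by simp
  qed (auto simp: c\<rho> mult_carrier_mat[OF c\<rho> c\<rho>])
  have \<rho>_one: "\<rho> (1\<^sub>m N) = 1\<^sub>m d"
    by (rule \<rho>_eqI) (use gs \<rho>u[OF one_mem] act_one c\<rho> cu in auto)
  have \<rho>_GL: "\<rho> g \<in> carrier (GL d)" if gG: "g \<in> G" for g
  proof -
    obtain h where "h \<in> G" "g * h = 1\<^sub>m N" "h * g = 1\<^sub>m N" using inv_mem[OF gG] by blast
    then have "\<rho> g * \<rho> h = 1\<^sub>m d" "\<rho> h * \<rho> g = 1\<^sub>m d"
      using \<rho>_mult[of g h] \<rho>_mult[of h g] \<rho>_one gG by auto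
    then show ?thesis using c\<rho> unfolding GL_def units_of_def Units_def ring_mat_def by auto
  qed
  have "rational_rep N G d \<rho>"
    unfolding rational_rep_def
  proof (intro conjI allI impI)
    show "\<rho> \<in> hom (GL N\<lparr>carrier := G\<rparr>) (GL d)"
      using \<rho>_GL \<rho>_mult unfolding hom_def by (auto simp: GL_def units_of_def ring_mat_def)
    fix i k assume ik: "i < d" "k < d"
    obtain q where q: "q \<in> poly_funs (tuple_coords n m)" "\<forall>X\<in>mat_tuples n m. q X = p (\<phi> (gs i) X)"
      using poly_funs_translate[OF _ p(1)] gs ik by blast
    have "regular_on N G (\<lambda>g. \<Sum>j<d. q (\<phi> g (xs j)) * M' $$ (j, k))"
      using gs by (intro regular_on_sum regular_on_mult regular_on_const poly_funs_orbit_regular q) auto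
    moreover have "\<rho> g $$ (i, k) = (\<Sum>j<d. q (\<phi> g (xs j)) * M' $$ (j, k))" if "g \<in> G" for g
      using that gs ik q(2) act_closed unfolding \<rho>_def by simp
    ultimately show "regular_on N G (\<lambda>g. \<rho> g $$ (i, k))" by (subst regular_on_cong) auto
  qed
  then have ds: "direct_sum_of_irreducibles G d \<rho>" using red unfolding reductive_group_def by blast
  \<comment> \<open>If all chosen translates vanished at the zero tuple, so would \<open>p\<close>,
    being the translate by the identity.\<close>
  have uO: "u ?O \<noteq> 0\<^sub>v d"
  proof
    assume "u ?O = 0\<^sub>v d"
    then have "u ?O $ i = 0" if "i < d" for i using that by simp
    then have z: "p (\<phi> (gs i) ?O) = 0" if "i < d" for i using that unfolding u_def by simp
    have "p ?O = p (\<phi> (1\<^sub>m N) ?O)" using act_one[OF tuple_zero_mem] by simp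
    also have "\<dots> = (\<Sum>i<d. (\<Sum>j<d. p (\<phi> (1\<^sub>m N) (xs j)) * M' $$ (j, i)) * p (\<phi> (gs i) ?O))"
      using exp one_mem tuple_zero_mem by blast
    also have "\<dots> = 0" using z by simp
    finally show False using p(3) by simp
  qed
  have \<rho>O: "\<rho> g *\<^sub>v u ?O = u ?O" if "g \<in> G" for g
    using \<rho>u[OF that tuple_zero_mem] act_zero[OF that] by simp
  have "\<exists>a :: nat \<Rightarrow> complex.
    (\<forall>g\<in>G. \<forall>v\<in>carrier_vec d. (\<Sum>j<d. a j * (\<rho> g *\<^sub>v v) $ j) = (\<Sum>j<d. a j * v $ j)) \<and>
    (\<Sum>j<d. a j * u ?O $ j) \<noteq> 0"
    by (rule fixed_vector_functional[OF ds c\<rho> cu uO \<rho>O])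
  then
  obtain a :: "nat \<Rightarrow> complex" where a: "(\<forall>g\<in>G. \<forall>v\<in>carrier_vec d. (\<Sum>j<d. a j * (\<rho> g *\<^sub>v v) $ j) = (\<Sum>j<d. a j * v $ j)) \<and>
    (\<Sum>j<d. a j * u ?O $ j) \<noteq> 0" by (elim exE)
  have "\<forall>j<d. \<exists>q. q \<in> poly_funs (tuple_coords n m) \<and> (\<forall>X\<in>mat_tuples n m. q X = p (\<phi> (gs j) X))"
    using poly_funs_translate[OF _ p(1)] gs by blast
  then obtain q where q: "\<forall>j<d. q j \<in> poly_funs (tuple_coords n m) \<and> (\<forall>X\<in>mat_tuples n m. q j X = p (\<phi> (gs j) X))"
    by metis
  define Q where "Q Y = (\<Sum>j<d. a j * q j Y)" for Y
  have "Q \<in> poly_funs (tuple_coords n m)"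
    unfolding Q_def using q by (intro poly_funs_sum poly_funs.mult poly_funs.const) auto
  moreover have Qu: "Q Y = (\<Sum>j<d. a j * u Y $ j)" if "Y \<in> mat_tuples n m" for Y
    unfolding Q_def u_def using q that by simp
  have "Q (\<phi> g Y) = Q Y" if "g \<in> G" "Y \<in> mat_tuples n m" for g Y
    using Qu[OF act_closed[OF that]] Qu[OF that(2)] \<rho>u[OF that, symmetric] a that(1) cu by simp
  moreover have "Q X = 0" using Qu[OF X(1)] pX gs by (simp add: u_def)
  moreover have "Q ?O \<noteq> 0" using Qu[OF tuple_zero_mem] a by simp
  ultimately show ?thesis by (intro bexI[of _ Q]) auto
qed

end

section \<open>Singularity over the rational functions\<close>

definition mon_val :: "(nat \<Rightarrow> complex) \<Rightarrow> (nat \<Rightarrow>\<^sub>0 nat) \<Rightarrow> complex" where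
  "mon_val c e = (\<Prod>k\<in>Poly_Mapping.keys e. c k ^ Poly_Mapping.lookup e k)"

definition poly_eval :: "(nat \<Rightarrow> complex) \<Rightarrow> cpoly \<Rightarrow> complex" where
  "poly_eval c p = (\<Sum>e\<in>Poly_Mapping.keys p. Poly_Mapping.lookup p e * mon_val c e)"

lemma mon_val_superset:
  assumes "finite S" "Poly_Mapping.keys e \<subseteq> S"
  shows "mon_val c e = (\<Prod>k\<in>S. c k ^ Poly_Mapping.lookup e k)"
  unfolding mon_val_def using assms
  by (intro prod.mono_neutral_left) (auto simp: in_keys_iff)

lemma mon_val_add: "mon_val c (e + f) = mon_val c e * mon_val c f"
proof -
  let ?S = "Poly_Mapping.keys e \<union> Poly_Mapping.keys f"
  have "Poly_Mapping.keys (e + f) \<subseteq> ?S" by (rule keys_add)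
  then have "mon_val c (e + f) = (\<Prod>k\<in>?S. c k ^ Poly_Mapping.lookup (e + f) k)"
    by (intro mon_val_superset) auto
  also have "\<dots> = (\<Prod>k\<in>?S. c k ^ Poly_Mapping.lookup e k * c k ^ Poly_Mapping.lookup f k)"
    by (simp add: lookup_add power_add)
  also have "\<dots> = mon_val c e * mon_val c f"
    by (simp add: prod.distrib mon_val_superset[of ?S])
  finally show ?thesis .
qed

lemma poly_eval_superset:
  assumes "finite S" "Poly_Mapping.keys p \<subseteq> S"
  shows "poly_eval c p = (\<Sum>e\<in>S. Poly_Mapping.lookup p e * mon_val c e)"
  unfolding poly_eval_def using assms
  by (intro sum.mono_neutral_left) (auto simp: in_keys_iff)

lemma poly_eval_add: "poly_eval c (p + q) = poly_eval c p + poly_eval c q"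
proof -
  let ?S = "Poly_Mapping.keys p \<union> Poly_Mapping.keys q"
  have "Poly_Mapping.keys (p + q) \<subseteq> ?S" by (rule keys_add)
  then have "poly_eval c (p + q) = (\<Sum>e\<in>?S. Poly_Mapping.lookup (p + q) e * mon_val c e)"
    by (intro poly_eval_superset) auto
  also have "\<dots> = (\<Sum>e\<in>?S. Poly_Mapping.lookup p e * mon_val c e + Poly_Mapping.lookup q e * mon_val c e)"
    by (simp add: lookup_add distrib_right)
  also have "\<dots> = poly_eval c p + poly_eval c q"
    by (simp add: sum.distrib poly_eval_superset[of ?S])
  finally show ?thesis .
qed

lemma poly_eval_0: "poly_eval c 0 = 0"
  by (simp add: poly_eval_def)

lemma poly_eval_sum: "poly_eval c (\<Sum>i\<in>I. p i) = (\<Sum>i\<in>I. poly_eval c (p i))"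
  by (induction I rule: infinite_finite_induct) (auto simp: poly_eval_0 poly_eval_add)

lemma poly_eval_single: "poly_eval c (Poly_Mapping.single e a) = a * mon_val c e"
  by (simp add: poly_eval_def)

lemma cpoly_expand: "p = (\<Sum>e\<in>Poly_Mapping.keys p. Poly_Mapping.single e (Poly_Mapping.lookup p e))"
proof (rule poly_mapping_eqI)
  fix k
  have "(\<Sum>e\<in>Poly_Mapping.keys p. Poly_Mapping.lookup (Poly_Mapping.single e (Poly_Mapping.lookup p e)) k)
      = (\<Sum>e\<in>Poly_Mapping.keys p. if e = k then Poly_Mapping.lookup p k else 0)"
    by (intro sum.cong) (auto simp: lookup_single when_def)
  then show "Poly_Mapping.lookup p k = Poly_Mapping.lookup
      (\<Sum>e\<in>Poly_Mapping.keys p. Poly_Mapping.single e (Poly_Mapping.lookup p e)) k"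
    by (simp add: lookup_sum in_keys_iff)
qed

lemma poly_eval_mult: "poly_eval c (p * q) = poly_eval c p * poly_eval c q"
proof -
  let ?s = "\<lambda>p e. Poly_Mapping.single e (Poly_Mapping.lookup p e)"
  have "p * q = (\<Sum>e\<in>Poly_Mapping.keys p. ?s p e) * (\<Sum>f\<in>Poly_Mapping.keys q. ?s q f)"
    using cpoly_expand[of p] cpoly_expand[of q] by simp
  also have "\<dots> = (\<Sum>e\<in>Poly_Mapping.keys p. \<Sum>f\<in>Poly_Mapping.keys q.
      Poly_Mapping.single (e + f) (Poly_Mapping.lookup p e * Poly_Mapping.lookup q f))"
    by (simp add: sum_product mult_single)
  finally have "poly_eval c (p * q) = (\<Sum>e\<in>Poly_Mapping.keys p. \<Sum>f\<in>Poly_Mapping.keys q.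
      (Poly_Mapping.lookup p e * mon_val c e) * (Poly_Mapping.lookup q f * mon_val c f))"
    by (simp add: poly_eval_sum poly_eval_single mon_val_add ac_simps)
  then show ?thesis by (simp add: poly_eval_def sum_product)
qed

lemma poly_eval_1: "poly_eval c 1 = 1"
proof -
  have "poly_eval c (Poly_Mapping.single 0 1) = 1"
    unfolding poly_eval_single by (simp add: mon_val_def)
  then show ?thesis by simp
qed

lemma poly_eval_hom: "comm_ring_hom (poly_eval c)"
  by standard (simp_all add: poly_eval_0 poly_eval_1 poly_eval_add poly_eval_mult)

section \<open>Separating monomials by digits\<close>

lemma digits_less:
  fixes e :: "nat \<Rightarrow> nat"
  assumes "\<And>k. k < K \<Longrightarrow> e k < B" shows "(\<Sum>k<K. e k * B ^ k) < B ^ K"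
  using assms
proof (induction K)
  case (Suc K)
  have "(\<Sum>k<Suc K. e k * B ^ k) < B ^ K + e K * B ^ K" using Suc by simp
  also have "\<dots> = Suc (e K) * B ^ K" by simp
  also have "\<dots> \<le> B * B ^ K" using Suc.prems[of K] by (intro mult_right_mono) auto
  finally show ?case by simp
qed simp

lemma digits_unique:
  fixes e f :: "nat \<Rightarrow> nat"
  assumes "\<And>k. k < K \<Longrightarrow> e k < B" "\<And>k. k < K \<Longrightarrow> f k < B"
    and "(\<Sum>k<K. e k * B ^ k) = (\<Sum>k<K. f k * B ^ k)" and "k < K"
  shows "e k = f k"
  using assms
proof (induction K)
  case (Suc K)
  let ?a = "\<Sum>k<K. e k * B ^ k" and ?b = "\<Sum>k<K. f k * B ^ k"
  have lt: "?a < B ^ K" "?b < B ^ K" using Suc.prems by (intro digits_less; simp)+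
  have eq: "?a + e K * B ^ K = ?b + f K * B ^ K" using Suc.prems(3) by simp
  have "(?a + e K * B ^ K) div B ^ K = e K" "(?b + f K * B ^ K) div B ^ K = f K"
  proof -
    have "(x + k * b) div b = k" if "x < b" for x k b :: nat using that by (cases "b = 0") auto
    then show "(?a + e K * B ^ K) div B ^ K = e K" "(?b + f K * B ^ K) div B ^ K = f K"
      using lt by blast+
  qed
  then have "e K = f K" using eq by simp
  moreover then have "?a = ?b" using eq by simp
  ultimately show ?case using Suc by (cases "k = K") auto
qed simp

text \<open>Kronecker's substitution \<open>t\<^sub>k \<mapsto> s^(B^k)\<close> keeps the finitely many monomials apart.\<close>

lemma poly_eval_nonzero:
  assumes "p \<noteq> 0" shows "\<exists>c. poly_eval c p \<noteq> 0"
proof -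
  let ?E = "Poly_Mapping.keys p"
  have fin: "finite (\<Union>e\<in>?E. Poly_Mapping.keys e)" "finite (\<Union>e\<in>?E. Poly_Mapping.range e)" by auto
  obtain K where K: "\<And>e k. e \<in> ?E \<Longrightarrow> k \<in> Poly_Mapping.keys e \<Longrightarrow> k < K"
    using finite_nat_set_iff_bounded[THEN iffD1, OF fin(1)] by auto
  obtain B0 where B0: "\<And>e x. e \<in> ?E \<Longrightarrow> x \<in> Poly_Mapping.range e \<Longrightarrow> x < B0"
    using finite_nat_set_iff_bounded[THEN iffD1, OF fin(2)] by auto
  \<comment> \<open>The range of an exponent function omits 0, so \<open>B0\<close> bounds the
    nonzero exponents only; the successor also exceeds 0.\<close>
  define B where "B = Suc B0"
  have B: "Poly_Mapping.lookup e k < B" if "e \<in> ?E" for e k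
    using B0[OF that, of "Poly_Mapping.lookup e k"] unfolding B_def
    by (cases "Poly_Mapping.lookup e k = 0") (auto simp: in_keys_lookup_in_range in_keys_iff less_Suc_eq)
  define v where "v e = (\<Sum>k<K. Poly_Mapping.lookup e k * B ^ k)" for e :: "nat \<Rightarrow>\<^sub>0 nat"
  have inj: "e = f" if "e \<in> ?E" "f \<in> ?E" "v e = v f" for e f
  proof (rule poly_mapping_eqI)
    fix k
    show "Poly_Mapping.lookup e k = Poly_Mapping.lookup f k"
    proof (cases "k < K")
      case True
      then show ?thesis
        using digits_unique[of K "Poly_Mapping.lookup e" B "Poly_Mapping.lookup f" k] B that
        unfolding v_def by blast
    next
      case False
      then show ?thesis using K[OF that(1)] K[OF that(2)] by (metis in_keys_iff)
    qed
  qed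
  define q where "q = (\<Sum>e\<in>?E. monom (Poly_Mapping.lookup p e) (v e))"
  obtain e0 where e0: "e0 \<in> ?E"
    using assms poly_mapping_eqI[of p 0] by (auto simp: in_keys_iff)
  have "coeff q (v e0) = (\<Sum>e\<in>?E. if e = e0 then Poly_Mapping.lookup p e0 else 0)"
    unfolding q_def coeff_sum using inj e0 by (intro sum.cong) auto
  then have "coeff q (v e0) \<noteq> 0" using e0 by (simp add: in_keys_iff)
  then have "q \<noteq> 0" by auto
  then have "finite {s. poly q s = 0}" by (rule poly_roots_finite)
  then obtain s where s: "poly q s \<noteq> 0"
    using infinite_UNIV_char_0[where 'a = complex] by (metis (mono_tags) UNIV_I finite_subset mem_Collect_eq subsetI)
  have "poly_eval (\<lambda>k. s ^ (B ^ k)) p = poly q s"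
    unfolding poly_eval_def q_def poly_sum poly_monom
  proof (intro sum.cong refl arg_cong2[of _ _ _ _ "(*)"])
    fix e assume e: "e \<in> ?E"
    have "mon_val (\<lambda>k. s ^ (B ^ k)) e = (\<Prod>k<K. (s ^ (B ^ k)) ^ Poly_Mapping.lookup e k)"
      using K[OF e] by (intro mon_val_superset) auto
    also have "\<dots> = (\<Prod>k<K. s ^ (Poly_Mapping.lookup e k * B ^ k))"
      by (intro prod.cong refl) (simp add: power_mult[symmetric] mult.commute)
    finally show "mon_val (\<lambda>k. s ^ (B ^ k)) e = s ^ v e"
      by (simp add: v_def power_sum)
  qed
  then show ?thesis using s by metis
qed

section \<open>Polynomials and rational functions in \<open>m\<close> indeterminates\<close>

lemma polys_0: "0 \<in> polys m"
  and polys_1: "1 \<in> polys m"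
  and polys_add: "p \<in> polys m \<Longrightarrow> q \<in> polys m \<Longrightarrow> p + q \<in> polys m"
  and polys_uminus: "p \<in> polys m \<Longrightarrow> - p \<in> polys m"
  unfolding polys_def using keys_add[of p q] by (auto simp: in_keys_iff)

lemma polys_mult: "p \<in> polys m \<Longrightarrow> q \<in> polys m \<Longrightarrow> p * q \<in> polys m"
  unfolding polys_def
proof (intro CollectI ballI)
  fix e assume pq: "p \<in> {p. \<forall>e\<in>Poly_Mapping.keys p. Poly_Mapping.keys e \<subseteq> {..<m}}"
    "q \<in> {p. \<forall>e\<in>Poly_Mapping.keys p. Poly_Mapping.keys e \<subseteq> {..<m}}" and "e \<in> Poly_Mapping.keys (p * q)"
  then obtain a b where "e = a + b" "a \<in> Poly_Mapping.keys p" "b \<in> Poly_Mapping.keys q"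
    using keys_mult[of p q] by blast
  then show "Poly_Mapping.keys e \<subseteq> {..<m}" using pq keys_add[of a b] by blast
qed

lemma polys_sum: "(\<And>i. i \<in> I \<Longrightarrow> f i \<in> polys m) \<Longrightarrow> sum f I \<in> polys m"
  by (induction I rule: infinite_finite_induct) (auto intro: polys_0 polys_add)

lemma polys_prod: "(\<And>i. i \<in> I \<Longrightarrow> f i \<in> polys m) \<Longrightarrow> prod f I \<in> polys m"
  by (induction I rule: infinite_finite_induct) (auto intro: polys_1 polys_mult)

lemma polys_det:
  assumes A: "A \<in> carrier_mat n n" and "\<And>i j. i < n \<Longrightarrow> j < n \<Longrightarrow> A $$ (i, j) \<in> polys m"
  shows "det A \<in> polys m"
proof -
  have "signof \<pi> * (\<Prod>i = 0..<n. A $$ (i, \<pi> i)) \<in> polys m" if "\<pi> permutes {0..<n}" for \<pi>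
  proof -
    have "(\<Prod>i = 0..<n. A $$ (i, \<pi> i)) \<in> polys m"
      using assms(2) permutes_in_image[OF that] by (intro polys_prod) auto
    then show ?thesis by (cases "sign \<pi> = 1") (auto simp: sign_def polys_uminus)
  qed
  then show ?thesis unfolding det_def'[OF A] by (intro polys_sum) auto
qed

lemma comm_pencil_polys: "comm_pencil m X i j \<in> polys m"
  unfolding comm_pencil_def by (intro polys_sum) (auto simp: polys_def)

lemma rational_functions_memI:
  "p \<in> polys m \<Longrightarrow> q \<in> polys m \<Longrightarrow> q \<noteq> 0 \<Longrightarrow> Fract p q \<in> carrier (rational_functions m)"
  unfolding rational_functions_def by auto

lemma finsum_rational_functions:
  assumes "\<And>i. i \<in> I \<Longrightarrow> x i \<in> carrier (rational_functions m)" "finite I"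
  shows "finsum (rational_functions m) x I = sum x I \<and> sum x I \<in> carrier (rational_functions m)"
proof -
  let ?K = "rational_functions m"
  have add: "a + b \<in> carrier ?K" if "a \<in> carrier ?K" "b \<in> carrier ?K" for a b
  proof -
    obtain p q p' q' where "a = Fract p q" "b = Fract p' q'" "p \<in> polys m" "q \<in> polys m" "q \<noteq> 0"
      "p' \<in> polys m" "q' \<in> polys m" "q' \<noteq> 0" using \<open>a \<in> carrier ?K\<close> \<open>b \<in> carrier ?K\<close>
      unfolding rational_functions_def by auto
    then have "a + b = Fract (p * q' + p' * q) (q * q')" "p * q' + p' * q \<in> polys m" "q * q' \<in> polys m" "q * q' \<noteq> 0"
      by (auto intro: polys_add polys_mult)
    then show ?thesis using rational_functions_memI by metis
  qed
  have zero: "0 \<in> carrier ?K"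
    unfolding rational_functions_def Zero_fract_def using polys_0 polys_1 by fastforce
  interpret abelian_monoid ?K
    by (intro abelian_monoidI) (use add zero in \<open>auto simp: rational_functions_def add.assoc add.commute\<close>)
  show ?thesis using assms(2,1)
  proof (induction I rule: finite_induct)
    case empty
    have "finsum ?K x {} = 0"
      unfolding finsum_empty by (simp add: rational_functions_def)
    then show ?case using zero by simp
  next
    case (insert i I)
    then have "finsum ?K x (insert i I) = x i + sum x I"
      by (subst finsum_insert) (auto simp: rational_functions_def)
    then show ?case using insert add by simp
  qed
qed

definition pencil_at :: "nat \<Rightarrow> nat \<Rightarrow> (nat \<Rightarrow> complex mat) \<Rightarrow> (nat \<Rightarrow> complex) \<Rightarrow> complex mat" where
  "pencil_at n m X c = mat n n (\<lambda>(i, j). \<Sum>k<m. c k * X k $$ (i, j))"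

text \<open>Both conditions say that the determinant of the pencil is the zero polynomial: a nonzero
  determinant inverts the pencil through the adjugate, and a nonzero polynomial has a nonzero value.
  From here on the indeterminates are replaced by complex numbers.\<close>

theorem SING_iff:
  assumes X: "X \<in> mat_tuples n m"
  shows "X \<in> SING n m \<longleftrightarrow> (\<forall>c. det (pencil_at n m X c) = 0)"
proof -
  define P where "P = mat n n (\<lambda>(i, j). comm_pencil m X i j)"
  have cP: "P \<in> carrier_mat n n" unfolding P_def by simp
  let ?K = "rational_functions m"
  let ?A = "\<lambda>i j. Fract (comm_pencil m X i j) 1"
  have Kc: "Fract p q \<in> carrier ?K" if "p \<in> polys m" "q \<in> polys m" "q \<noteq> 0" for p q
    using that unfolding rational_functions_def by auto
  have AK: "?A i j \<in> carrier ?K" for i j using comm_pencil_polys polys_1 by (intro Kc) auto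
  have Kmult: "a * b \<in> carrier ?K" if "a \<in> carrier ?K" "b \<in> carrier ?K" for a b
  proof -
    obtain p q p' q' where *: "a = Fract p q" "b = Fract p' q'" "p \<in> polys m" "q \<in> polys m" "q \<noteq> 0"
      "p' \<in> polys m" "q' \<in> polys m" "q' \<noteq> 0" using \<open>a \<in> carrier ?K\<close> \<open>b \<in> carrier ?K\<close>
      unfolding rational_functions_def by auto
    then show ?thesis using Kc[of "p * p'" "q * q'"] by (simp add: polys_mult)
  qed
  have mult_K: "x \<otimes>\<^bsub>?K\<^esub> y = x * y" "\<one>\<^bsub>?K\<^esub> = 1" "\<zero>\<^bsub>?K\<^esub> = 0" for x y
    unfolding rational_functions_def by simp_all
  have sum_K: "(\<Oplus>\<^bsub>?K\<^esub>k\<in>{..<n}. x k \<otimes>\<^bsub>?K\<^esub> y k) = (\<Sum>k<n. x k * y k)"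
    if "\<And>k. k < n \<Longrightarrow> x k \<in> carrier ?K" "\<And>k. k < n \<Longrightarrow> y k \<in> carrier ?K" for x y :: "nat \<Rightarrow> cpoly fract"
    using finsum_rational_functions[of "{..<n}" "\<lambda>k. x k * y k" m] that Kmult by (simp add: mult_K)
  interpret tf: inj_comm_ring_hom "to_fract :: cpoly \<Rightarrow> cpoly fract" by (unfold_locales, auto)
  have "X \<in> SING n m \<longleftrightarrow> det P = 0"
  proof
    assume XS: "X \<in> SING n m"
    show "det P = 0"
    proof (rule ccontr)
      assume d: "det P \<noteq> 0"
      \<comment> \<open>The adjugate divided by the determinant. Its entries have to lie in the
        field with exactly \<open>m\<close> indeterminates, hence the closure properties of
        \<open>polys m\<close>.\<close>
      define B where "B = (\<lambda>i j. Fract (adj_mat P $$ (i, j)) (det P))"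
      have detK: "det P \<in> polys m"
        by (rule polys_det[OF cP]) (simp add: P_def comm_pencil_polys)
      have adjK: "adj_mat P $$ (i, j) \<in> polys m" if "i < n" "j < n" for i j
      proof -
        have "det (mat_delete P j i) \<in> polys m"
        proof (rule polys_det)
          show "mat_delete P j i \<in> carrier_mat (n - 1) (n - 1)"
            using mat_delete_carrier[OF cP] .
          fix a b assume "a < n - 1" "b < n - 1"
          then show "mat_delete P j i $$ (a, b) \<in> polys m"
            using cP unfolding mat_delete_def P_def by (auto simp: comm_pencil_polys)
        qed
        then have "cofactor P j i \<in> polys m" unfolding cofactor_def
          by (cases "even (j + i)") (auto simp: polys_uminus)
        then show ?thesis using that cP unfolding adj_mat_def by simp
      qed
      have BK: "B i j \<in> carrier ?K" if "i < n" "j < n" for i j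
        unfolding B_def using adjK[OF that] detK d by (intro Kc) auto
      have s: "(\<Sum>k<n. Fract (x k) 1 * Fract (y k) (det P)) = Fract (\<Sum>k<n. x k * y k) (det P)" for x y :: "nat \<Rightarrow> cpoly"
      proof -
        have "Fract (x k) 1 * Fract (y k) (det P) = to_fract (x k * y k) * Fract 1 (det P)" for k
          by (simp add: to_fract_def)
        then have "(\<Sum>k<n. Fract (x k) 1 * Fract (y k) (det P)) = to_fract (\<Sum>k<n. x k * y k) * Fract 1 (det P)"
          by (simp add: sum_distrib_right tf.hom_sum)
        then show ?thesis by (simp add: to_fract_def)
      qed
      have PB: "(\<Sum>k<n. comm_pencil m X i k * adj_mat P $$ (k, j)) = (if i = j then det P else 0)"
        "(\<Sum>k<n. adj_mat P $$ (i, k) * comm_pencil m X k j) = (if i = j then det P else 0)"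
        if ij: "i < n" "j < n" for i j
      proof -
        have "(P * adj_mat P) $$ (i, j) = (\<Sum>k<n. comm_pencil m X i k * adj_mat P $$ (k, j))"
          "(adj_mat P * P) $$ (i, j) = (\<Sum>k<n. adj_mat P $$ (i, k) * comm_pencil m X k j)"
          using ij adj_mat(1)[OF cP] by (auto simp: scalar_prod_def P_def lessThan_atLeast0 intro!: sum.cong)
        then show "(\<Sum>k<n. comm_pencil m X i k * adj_mat P $$ (k, j)) = (if i = j then det P else 0)"
          "(\<Sum>k<n. adj_mat P $$ (i, k) * comm_pencil m X k j) = (if i = j then det P else 0)"
          using adj_mat(2,3)[OF cP] ij by auto
      qed
      have F1: "Fract (if i = j then det P else 0) (det P) = (if i = j then 1 else 0)" for i j :: nat
        using d by (simp add: One_fract_def Zero_fract_def eq_fract)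
      have "(\<Oplus>\<^bsub>?K\<^esub>k\<in>{..<n}. ?A i k \<otimes>\<^bsub>?K\<^esub> B k j) = (if i = j then \<one>\<^bsub>?K\<^esub> else \<zero>\<^bsub>?K\<^esub>) \<and>
             (\<Oplus>\<^bsub>?K\<^esub>k\<in>{..<n}. B i k \<otimes>\<^bsub>?K\<^esub> ?A k j) = (if i = j then \<one>\<^bsub>?K\<^esub> else \<zero>\<^bsub>?K\<^esub>)"
        if ij: "i < n" "j < n" for i j
      proof -
        have "(\<Oplus>\<^bsub>?K\<^esub>k\<in>{..<n}. ?A i k \<otimes>\<^bsub>?K\<^esub> B k j) = (\<Sum>k<n. ?A i k * B k j)"
          using BK ij AK by (intro sum_K)
        moreover have "(\<Oplus>\<^bsub>?K\<^esub>k\<in>{..<n}. B i k \<otimes>\<^bsub>?K\<^esub> ?A k j) = (\<Sum>k<n. B i k * ?A k j)"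
          using BK ij AK by (intro sum_K)
        moreover have "(\<Sum>k<n. ?A i k * B k j) = (if i = j then 1 else 0)"
          unfolding B_def s PB[OF ij] by (rule F1)
        moreover have "(\<Sum>k<n. B i k * ?A k j) = (if i = j then 1 else 0)"
          using s[of "\<lambda>k. comm_pencil m X k j" "\<lambda>k. adj_mat P $$ (i, k)"] PB(2)[OF ij] F1[of i j]
          unfolding B_def by (simp add: mult.commute)
        ultimately show ?thesis by (simp add: mult_K)
      qed
      then have "\<not> singular_over ?K n ?A" unfolding singular_over_def using BK by blast
      then show False using XS unfolding SING_def by blast
    qed
  next
    assume d: "det P = 0"
    show "X \<in> SING n m"
    proof (rule ccontr)
      assume "X \<notin> SING n m"
      then obtain B where BK: "\<And>i j. i < n \<Longrightarrow> j < n \<Longrightarrow> B i j \<in> carrier ?K"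
        and AB: "\<And>i j. i < n \<Longrightarrow> j < n \<Longrightarrow>
          (\<Oplus>\<^bsub>?K\<^esub>k\<in>{..<n}. ?A i k \<otimes>\<^bsub>?K\<^esub> B k j) = (if i = j then \<one>\<^bsub>?K\<^esub> else \<zero>\<^bsub>?K\<^esub>)"
        using X unfolding SING_def singular_over_def by blast
      define A' where "A' = map_mat to_fract P"
      define B' where "B' = mat n n (\<lambda>(i, j). B i j)"
      have "A' * B' = 1\<^sub>m n"
      proof (rule eq_matI)
        fix i j assume "i < dim_row (1\<^sub>m n :: cpoly fract mat)" "j < dim_col (1\<^sub>m n :: cpoly fract mat)"
        then have ij: "i < n" "j < n" by auto
        have "(A' * B') $$ (i, j) = (\<Sum>k<n. ?A i k * B k j)"
          using ij by (auto simp: scalar_prod_def A'_def B'_def P_def to_fract_def lessThan_atLeast0 intro!: sum.cong)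
        also have "\<dots> = (\<Oplus>\<^bsub>?K\<^esub>k\<in>{..<n}. ?A i k \<otimes>\<^bsub>?K\<^esub> B k j)"
          using AK BK ij by (intro sum_K[symmetric])
        also have "\<dots> = (if i = j then 1 else 0)"
          using AB[OF ij] unfolding mult_K(2,3) .
        finally show "(A' * B') $$ (i, j) = 1\<^sub>m n $$ (i, j)" using ij by simp
      qed (auto simp: A'_def B'_def P_def)
      moreover have "A' \<in> carrier_mat n n" "B' \<in> carrier_mat n n" by (auto simp: A'_def B'_def P_def)
      ultimately have "det A' * det B' = 1" using det_mult[of A' n B'] by simp
      then have "det A' \<noteq> 0" by auto
      then show False using d unfolding A'_def tf.hom_det by simp
    qed
  qed
  also have "det P = 0 \<longleftrightarrow> (\<forall>c. poly_eval c (det P) = 0)"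
    using poly_eval_nonzero[of "det P"] poly_eval_0 by auto
  also have "\<dots> \<longleftrightarrow> (\<forall>c. det (pencil_at n m X c) = 0)"
  proof -
    have "poly_eval c (det P) = det (pencil_at n m X c)" for c
    proof -
      interpret comm_ring_hom "poly_eval c" by (rule poly_eval_hom)
      have "map_mat (poly_eval c) P = pencil_at n m X c"
        unfolding P_def pencil_at_def comm_pencil_def
        by (rule eq_matI) (auto simp: poly_eval_sum poly_eval_single mon_val_def mult.commute intro!: sum.cong)
      then show ?thesis using hom_det[of P] by simp
    qed
    then show ?thesis by simp
  qed
  finally show ?thesis .
qed

section \<open>Matrices invertible over a skew field\<close>

context ring
begin

lemma finsum_swap:
  assumes "finite I" "finite J" "\<And>i j. i \<in> I \<Longrightarrow> j \<in> J \<Longrightarrow> h i j \<in> carrier R"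
  shows "(\<Oplus>i\<in>I. \<Oplus>j\<in>J. h i j) = (\<Oplus>j\<in>J. \<Oplus>i\<in>I. h i j)"
  using assms(1,3)
proof (induction I rule: finite_induct)
  case empty
  then show ?case by (simp add: finsum_zero')
next
  case (insert a I)
  have "(\<Oplus>j\<in>J. \<Oplus>i\<in>insert a I. h i j) = (\<Oplus>j\<in>J. h a j \<oplus> (\<Oplus>i\<in>I. h i j))"
    using insert by (intro finsum_cong') (auto simp: Pi_iff)
  also have "\<dots> = (\<Oplus>j\<in>J. h a j) \<oplus> (\<Oplus>j\<in>J. \<Oplus>i\<in>I. h i j)"
    using insert.prems by (intro finsum_addf) auto
  finally show ?case using insert by (simp add: Pi_iff)
qed

text \<open>Products of matrices over a noncommutative ring given by a carrier. Entries matter only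
  below \<open>n\<close>, so identities are proved entrywise and substituted with
  \<open>rmul_cong\<close>.\<close>

definition rmul :: "nat \<Rightarrow> (nat \<Rightarrow> nat \<Rightarrow> 'a) \<Rightarrow> (nat \<Rightarrow> nat \<Rightarrow> 'a) \<Rightarrow> nat \<Rightarrow> nat \<Rightarrow> 'a" where
  "rmul n A B i j = (\<Oplus>k\<in>{..<n}. A i k \<otimes> B k j)"

definition rmat :: "nat \<Rightarrow> (nat \<Rightarrow> nat \<Rightarrow> 'a) \<Rightarrow> bool" where
  "rmat n A \<longleftrightarrow> (\<forall>i<n. \<forall>j<n. A i j \<in> carrier R)"

lemma rmat_mul: "rmat n A \<Longrightarrow> rmat n B \<Longrightarrow> rmat n (rmul n A B)"
  unfolding rmat_def rmul_def by (auto intro!: finsum_closed)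

lemma rmul_assoc:
  assumes "rmat n A" "rmat n B" "rmat n C" "i < n" "j < n"
  shows "rmul n (rmul n A B) C i j = rmul n A (rmul n B C) i j"
proof -
  note c = assms(1-3)[unfolded rmat_def, rule_format]
  have "rmul n (rmul n A B) C i j = (\<Oplus>k\<in>{..<n}. \<Oplus>l\<in>{..<n}. A i l \<otimes> B l k \<otimes> C k j)"
    unfolding rmul_def using c assms(4,5)
    by (intro finsum_cong') (auto simp: finsum_ldistr intro!: finsum_closed)
  also have "\<dots> = (\<Oplus>l\<in>{..<n}. \<Oplus>k\<in>{..<n}. A i l \<otimes> B l k \<otimes> C k j)"
    using c assms(4,5) by (intro finsum_swap) auto
  also have "\<dots> = rmul n A (rmul n B C) i j"
    unfolding rmul_def using c assms(4,5)
    by (intro finsum_cong') (auto simp: finsum_rdistr m_assoc intro!: finsum_closed finsum_cong')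
  finally show ?thesis .
qed

lemma rmul_cong:
  assumes "\<And>i j. i < n \<Longrightarrow> j < n \<Longrightarrow> A i j = A' i j" "\<And>i j. i < n \<Longrightarrow> j < n \<Longrightarrow> B i j = B' i j"
    and "rmat n A'" "rmat n B'" "i < n" "j < n"
  shows "rmul n A B i j = rmul n A' B' i j"
  unfolding rmul_def using assms unfolding rmat_def by (intro finsum_cong') auto

definition rone :: "nat \<Rightarrow> nat \<Rightarrow> 'a" where
  "rone i j = (if i = j then \<one> else \<zero>)"

lemma rmat_one: "rmat n rone"
  unfolding rmat_def rone_def by auto

lemma rmul_one_left:
  assumes "rmat n A" "i < n" "j < n" shows "rmul n rone A i j = A i j"
proof -
  have "rmul n rone A i j = (\<Oplus>k\<in>{..<n}. if i = k then A k j else \<zero>)"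
    unfolding rmul_def rone_def using assms unfolding rmat_def by (intro finsum_cong') auto
  also have "\<dots> = A i j"
    using assms unfolding rmat_def by (intro finsum_singleton) auto
  finally show ?thesis .
qed

end

text \<open>A substitute for the determinant expansion. The diagonal entry 1 of the product gives a
  column j0 in which row i0 of \<open>A\<close> and the matching entry of \<open>B\<close> are both
  nonzero. A column operation on \<open>B\<close> clears its row j0 elsewhere, after which column j0
  of \<open>A\<close> no longer contributes and the induction continues with the smaller index
  sets.\<close>

lemma skew_field_transversal:
  assumes K: "skew_field K" and I: "finite I" and J: "finite J"
    and A: "\<And>i j. i \<in> I \<Longrightarrow> j \<in> J \<Longrightarrow> A i j \<in> carrier K"
    and B: "\<And>i j. i \<in> I \<Longrightarrow> j \<in> J \<Longrightarrow> B j i \<in> carrier K"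
    and AB: "\<And>i i'. i \<in> I \<Longrightarrow> i' \<in> I \<Longrightarrow>
      (\<Oplus>\<^bsub>K\<^esub>j\<in>J. A i j \<otimes>\<^bsub>K\<^esub> B j i') = (if i = i' then \<one>\<^bsub>K\<^esub> else \<zero>\<^bsub>K\<^esub>)"
  shows "\<exists>\<sigma>. inj_on \<sigma> I \<and> \<sigma> ` I \<subseteq> J \<and> (\<forall>i\<in>I. A i (\<sigma> i) \<noteq> \<zero>\<^bsub>K\<^esub>)"
proof -
  interpret ring K using K unfolding skew_field_def by blast
  have units: "Units K = carrier K - {\<zero>\<^bsub>K\<^esub>}" using K unfolding skew_field_def by blast
  have nontriv: "\<one>\<^bsub>K\<^esub> \<noteq> \<zero>\<^bsub>K\<^esub>" using units Units_one_closed by auto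
  show ?thesis using I J A B AB
  proof (induction I arbitrary: J B rule: finite_induct)
    case empty
    then show ?case by auto
  next
    case (insert i0 I)
    have "\<exists>j0\<in>J. A i0 j0 \<noteq> \<zero>\<^bsub>K\<^esub> \<and> B j0 i0 \<noteq> \<zero>\<^bsub>K\<^esub>"
    proof (rule ccontr)
      assume neg: "\<not> ?thesis"
      have "(\<Oplus>\<^bsub>K\<^esub>j\<in>J. A i0 j \<otimes>\<^bsub>K\<^esub> B j i0) = (\<Oplus>\<^bsub>K\<^esub>j\<in>J. \<zero>\<^bsub>K\<^esub>)"
      proof (intro finsum_cong' refl)
        fix j assume j: "j \<in> J"
        have "A i0 j \<in> carrier K" "B j i0 \<in> carrier K" using insert.prems(2,3) j by auto
        then show "A i0 j \<otimes>\<^bsub>K\<^esub> B j i0 = \<zero>\<^bsub>K\<^esub>" using neg j by (cases "A i0 j = \<zero>\<^bsub>K\<^esub>") auto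
      qed auto
      then show False using insert.prems(4)[of i0 i0] nontriv by (simp add: finsum_zero')
    qed
    then obtain j0 where j0: "j0 \<in> J" "A i0 j0 \<noteq> \<zero>\<^bsub>K\<^esub>" "B j0 i0 \<noteq> \<zero>\<^bsub>K\<^esub>" by blast
    have Bc: "B j i \<in> carrier K" if "i \<in> insert i0 I" "j \<in> J" for i j
      using insert.prems(3) that by blast
    have Ac: "A i j \<in> carrier K" if "i \<in> insert i0 I" "j \<in> J" for i j
      using insert.prems(2) that by blast
    have u: "B j0 i0 \<in> Units K" using Bc j0 units by auto
    \<comment> \<open>The multiplier that makes row \<open>j0\<close> of \<open>B'\<close> vanish.
      It acts from the right, as columns of \<open>B\<close> are combined on that side.\<close>
    define c where "c i = \<ominus>\<^bsub>K\<^esub> (inv\<^bsub>K\<^esub> B j0 i0 \<otimes>\<^bsub>K\<^esub> B j0 i)" for i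
    define B' where "B' j i = B j i \<oplus>\<^bsub>K\<^esub> B j i0 \<otimes>\<^bsub>K\<^esub> c i" for j i
    have cc: "c i \<in> carrier K" if "i \<in> I" for i
      unfolding c_def using u Bc j0(1) that by auto
    have B'c: "B' j i \<in> carrier K" if "i \<in> I" "j \<in> J" for i j
      unfolding B'_def using Bc cc that by auto
    have B'0: "B' j0 i = \<zero>\<^bsub>K\<^esub>" if "i \<in> I" for i
    proof -
      have b: "B j0 i \<in> carrier K" "B j0 i0 \<in> carrier K" "inv\<^bsub>K\<^esub> B j0 i0 \<in> carrier K"
        using Bc j0(1) that u by auto
      have "B j0 i0 \<otimes>\<^bsub>K\<^esub> c i = \<ominus>\<^bsub>K\<^esub> (B j0 i0 \<otimes>\<^bsub>K\<^esub> (inv\<^bsub>K\<^esub> B j0 i0 \<otimes>\<^bsub>K\<^esub> B j0 i))"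
        unfolding c_def using b by (simp add: r_minus)
      also have "\<dots> = \<ominus>\<^bsub>K\<^esub> B j0 i" using b u by (simp add: m_assoc[symmetric])
      finally show ?thesis unfolding B'_def using b by (simp add: r_neg)
    qed
    have AB': "(\<Oplus>\<^bsub>K\<^esub>j\<in>J - {j0}. A i j \<otimes>\<^bsub>K\<^esub> B' j i') = (if i = i' then \<one>\<^bsub>K\<^esub> else \<zero>\<^bsub>K\<^esub>)"
      if ii: "i \<in> I" "i' \<in> I" for i i'
    proof -
      have "(\<Oplus>\<^bsub>K\<^esub>j\<in>J. A i j \<otimes>\<^bsub>K\<^esub> B' j i')
          = (\<Oplus>\<^bsub>K\<^esub>j\<in>insert j0 (J - {j0}). A i j \<otimes>\<^bsub>K\<^esub> B' j i')"
        using j0(1) by (simp add: insert_absorb)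
      also have "\<dots> = A i j0 \<otimes>\<^bsub>K\<^esub> B' j0 i' \<oplus>\<^bsub>K\<^esub> (\<Oplus>\<^bsub>K\<^esub>j\<in>J - {j0}. A i j \<otimes>\<^bsub>K\<^esub> B' j i')"
        using insert.prems(1) Ac B'c ii j0(1) by (intro finsum_insert) auto
      also have "\<dots> = (\<Oplus>\<^bsub>K\<^esub>j\<in>J - {j0}. A i j \<otimes>\<^bsub>K\<^esub> B' j i')"
        using B'0[OF ii(2)] Ac ii j0(1) B'c by (simp add: finsum_closed)
      finally have "(\<Oplus>\<^bsub>K\<^esub>j\<in>J - {j0}. A i j \<otimes>\<^bsub>K\<^esub> B' j i') = (\<Oplus>\<^bsub>K\<^esub>j\<in>J. A i j \<otimes>\<^bsub>K\<^esub> B' j i')" by simp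
      also have "\<dots> = (\<Oplus>\<^bsub>K\<^esub>j\<in>J. A i j \<otimes>\<^bsub>K\<^esub> B j i' \<oplus>\<^bsub>K\<^esub> A i j \<otimes>\<^bsub>K\<^esub> B j i0 \<otimes>\<^bsub>K\<^esub> c i')"
        unfolding B'_def using Ac Bc cc ii by (intro finsum_cong') (auto simp: r_distr m_assoc)
      also have "\<dots> = (\<Oplus>\<^bsub>K\<^esub>j\<in>J. A i j \<otimes>\<^bsub>K\<^esub> B j i') \<oplus>\<^bsub>K\<^esub> (\<Oplus>\<^bsub>K\<^esub>j\<in>J. A i j \<otimes>\<^bsub>K\<^esub> B j i0 \<otimes>\<^bsub>K\<^esub> c i')"
        using Ac Bc cc ii by (intro finsum_addf) auto
      also have "(\<Oplus>\<^bsub>K\<^esub>j\<in>J. A i j \<otimes>\<^bsub>K\<^esub> B j i0 \<otimes>\<^bsub>K\<^esub> c i')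
          = (\<Oplus>\<^bsub>K\<^esub>j\<in>J. A i j \<otimes>\<^bsub>K\<^esub> B j i0) \<otimes>\<^bsub>K\<^esub> c i'"
        using Ac Bc cc ii insert.prems(1) by (intro finsum_ldistr[symmetric]) auto
      \<comment> \<open>An off-diagonal entry of the product, as \<open>i\<close> differs from
        \<open>i0\<close>; therefore the column operation keeps the product equal to the
        identity.\<close>
      also have "(\<Oplus>\<^bsub>K\<^esub>j\<in>J. A i j \<otimes>\<^bsub>K\<^esub> B j i0) = \<zero>\<^bsub>K\<^esub>"
        using insert.prems(4)[of i i0] ii insert.hyps(2) by auto
      finally show ?thesis using insert.prems(4)[of i i'] ii cc by auto
    qed
    have "\<exists>\<sigma>. inj_on \<sigma> I \<and> \<sigma> ` I \<subseteq> J - {j0} \<and> (\<forall>i\<in>I. A i (\<sigma> i) \<noteq> \<zero>\<^bsub>K\<^esub>)"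
      by (rule insert.IH[of "J - {j0}" B']) (use insert.prems(1) Ac B'c AB' in auto)
    then obtain \<sigma> where \<sigma>: "inj_on \<sigma> I" "\<sigma> ` I \<subseteq> J - {j0}" "\<forall>i\<in>I. A i (\<sigma> i) \<noteq> \<zero>\<^bsub>K\<^esub>" by blast
    have "inj_on (\<sigma>(i0 := j0)) (insert i0 I)"
      using \<sigma>(1,2) insert.hyps(2) by (auto simp: inj_on_def)
    moreover have "\<forall>i\<in>insert i0 I. A i ((\<sigma>(i0 := j0)) i) \<noteq> \<zero>\<^bsub>K\<^esub>" using \<sigma>(3) j0(2) by simp
    moreover have "(\<sigma>(i0 := j0)) ` insert i0 I \<subseteq> J" using \<sigma>(2) j0(1) insert.hyps(2) by auto
    ultimately show ?case by blast
  qed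
qed

text \<open>Constant invertible matrices commute with the passage to the skew field, so the pencil of
  \<open>b X b'\<close> has a right inverse as soon as the pencil of \<open>X\<close> has one.\<close>

theorem NSING_transversal:
  assumes K: "skew_field F" and f: "f \<in> Ring.ring_hom (free_algebra m) F"
    and X: "X \<in> mat_tuples n m" "X \<notin> NSING F f n m"
    and b: "b \<in> carrier_mat n n" "c \<in> carrier_mat n n" "b * c = 1\<^sub>m n"
    and b': "b' \<in> carrier_mat n n" "c' \<in> carrier_mat n n" "b' * c' = 1\<^sub>m n"
  shows "\<exists>\<sigma>. inj_on \<sigma> {..<n} \<and> \<sigma> ` {..<n} \<subseteq> {..<n} \<and>
    (\<forall>i<n. \<exists>k<m. (b * X k * b') $$ (i, \<sigma> i) \<noteq> 0)"
proof -
  interpret ring F using K unfolding skew_field_def by blast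
  define Fr where "Fr = free_algebra m"
  have carr: "carrier Fr = {p. \<forall>w \<in> Poly_Mapping.keys p. set (letters w) \<subseteq> {..<m}}"
    unfolding Fr_def free_algebra_def by simp
  have f: "f \<in> Ring.ring_hom Fr F" using f Fr_def by simp
  have f_add: "f (p + q) = f p \<oplus>\<^bsub>F\<^esub> f q" and f_mult: "f (p * q) = f p \<otimes>\<^bsub>F\<^esub> f q"
    if "p \<in> carrier Fr" "q \<in> carrier Fr" for p q
    using Ring.ring_hom_add[OF f that] Ring.ring_hom_mult[OF f that]
    unfolding Fr_def free_algebra_def by simp_all
  have f_closed: "f p \<in> carrier F" if "p \<in> carrier Fr" for p
    using Ring.ring_hom_closed[OF f that] .
  have f_one: "f 1 = \<one>\<^bsub>F\<^esub>"
    using Ring.ring_hom_one[OF f] unfolding Fr_def free_algebra_def by simp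
  have z: "0 \<in> carrier Fr" unfolding carr by simp
  have f_zero: "f 0 = \<zero>\<^bsub>F\<^esub>"
    using f_add[OF z z] f_closed[OF z] by (metis add.r_cancel_one' add_0)
  have add_mem: "p + q \<in> carrier Fr" if "p \<in> carrier Fr" "q \<in> carrier Fr" for p q
    using that keys_add[of p q] unfolding carr by blast
  have mult_mem: "p * q \<in> carrier Fr" if pq: "p \<in> carrier Fr" "q \<in> carrier Fr" for p q
    unfolding carr
  proof (intro CollectI ballI)
    fix w assume "w \<in> Poly_Mapping.keys (p * q)"
    then obtain u v where "w = u + v" "u \<in> Poly_Mapping.keys p" "v \<in> Poly_Mapping.keys q"
      using keys_mult[of p q] by blast
    then show "set (letters w) \<subseteq> {..<m}" using pq unfolding carr by (auto simp: plus_word_def)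
  qed
  have sum_mem: "sum p I \<in> carrier Fr" if "\<And>i. i \<in> I \<Longrightarrow> p i \<in> carrier Fr" for p and I :: "nat set"
    using that by (induction I rule: infinite_finite_induct) (auto intro: z add_mem)
  have f_sum: "f (sum p I) = (\<Oplus>\<^bsub>F\<^esub>i\<in>I. f (p i))"
    if "finite I" "\<And>i. i \<in> I \<Longrightarrow> p i \<in> carrier Fr" for p and I :: "nat set"
    using that
  proof (induction I rule: finite_induct)
    case empty then show ?case by (simp add: f_zero)
  next
    case (insert i I)
    then show ?case using f_closed by (simp add: f_add sum_mem Pi_iff)
  qed
  \<comment> \<open>Scalars are multiples of the empty word; they commute with the indeterminates,
    which lets constant matrices pass through the pencil.\<close>
  define s where "s x = Poly_Mapping.single (0 :: word) (x :: complex)" for x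
  have s_mem: "s x \<in> carrier Fr" for x
    unfolding s_def carr by (auto simp: zero_word_def)
  have s_mult: "s x * s y = s (x * y)" for x y unfolding s_def by (simp add: mult_single)
  have s_sum: "s (sum x I) = (\<Sum>i\<in>I. s (x i))" for x and I :: "nat set"
    by (induction I rule: infinite_finite_induct) (simp_all add: s_def single_add)
  define S where "S a i j = f (s (a $$ (i, j)))" for a i j
  have S: "rmat n (S a)" for a unfolding rmat_def S_def using f_closed s_mem by blast
  have S_mul: "rmul n (S a) (S a') i j = S (a * a') i j"
    if "a \<in> carrier_mat n n" "a' \<in> carrier_mat n n" "i < n" "j < n" for a a' i j
  proof -
    have "(a * a') $$ (i, j) = (\<Sum>k\<in>{..<n}. a $$ (i, k) * a' $$ (k, j))"
      using that by (auto simp: scalar_prod_def lessThan_atLeast0 intro!: sum.cong)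
    then have "S (a * a') i j = f (\<Sum>k\<in>{..<n}. s (a $$ (i, k)) * s (a' $$ (k, j)))"
      unfolding S_def by (simp add: s_sum s_mult)
    also have "\<dots> = (\<Oplus>\<^bsub>F\<^esub>k\<in>{..<n}. f (s (a $$ (i, k)) * s (a' $$ (k, j))))"
      using s_mem mult_mem by (intro f_sum) auto
    also have "\<dots> = rmul n (S a) (S a') i j"
      unfolding rmul_def S_def using s_mem f_mult by simp
    finally show ?thesis by simp
  qed
  have S_one: "S (1\<^sub>m n) i j = rone i j" if "i < n" "j < n" for i j
    using that f_one f_zero unfolding S_def rone_def s_def by simp
  define P where "P X i j = f (nc_pencil m X i j)" for X i j
  have pencil_mem: "nc_pencil m X i j \<in> carrier Fr" for X i j
    unfolding nc_pencil_def by (intro sum_mem) (auto simp: carr)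
  have P: "rmat n (P X)" for X unfolding rmat_def P_def using f_closed pencil_mem by blast
  obtain B where B: "rmat n B" "\<And>i j. i < n \<Longrightarrow> j < n \<Longrightarrow> rmul n (P X) B i j = rone i j"
    using X unfolding NSING_def singular_over_def rmat_def rmul_def rone_def P_def by blast
  define Z where "Z = (\<lambda>k. b * X k * b')"
  have Xk: "X k \<in> carrier_mat n n" if "k < m" for k using mat_tuples_carrier[OF X(1) that] .
  have PZ: "P Z i j = rmul n (S b) (rmul n (P X) (S b')) i j" if ij: "i < n" "j < n" for i j
  proof -
    have Zk: "Z k $$ (i, j) = (\<Sum>p<n. b $$ (i, p) * (\<Sum>q<n. X k $$ (p, q) * b' $$ (q, j)))" if "k < m" for k
    proof -
      have "Z k = b * (X k * b')" unfolding Z_def using b b' Xk[OF that] by simp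
      then show ?thesis
        using ij b b' Xk[OF that] by (auto simp: scalar_prod_def lessThan_atLeast0 intro!: sum.cong)
    qed
    let ?t = "\<lambda>k x. Poly_Mapping.single (Word [k]) (x :: complex)"
    have t_sum: "?t k (sum x I) = (\<Sum>i\<in>I. ?t k (x i))" for k x and I :: "nat set"
      by (induction I rule: infinite_finite_induct) (simp_all add: single_add)
    have st: "s x * ?t k y = ?t k (x * y)" "?t k y * s x = ?t k (y * x)" for x k y
      unfolding s_def by (simp_all add: mult_single zero_word_def plus_word_def)
    have "nc_pencil m Z i j = (\<Sum>k<m. \<Sum>p<n. s (b $$ (i, p)) * (\<Sum>q<n. ?t k (X k $$ (p, q)) * s (b' $$ (q, j))))"
      unfolding nc_pencil_def by (intro sum.cong refl) (simp add: Zk t_sum st sum_distrib_left)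
    also have "\<dots> = (\<Sum>p<n. s (b $$ (i, p)) * (\<Sum>q<n. nc_pencil m X p q * s (b' $$ (q, j))))"
      unfolding nc_pencil_def sum_distrib_left sum_distrib_right
      by (rule trans[OF sum.swap], rule sum.cong[OF refl], rule sum.swap)
    finally have "P Z i j = f (\<Sum>p<n. s (b $$ (i, p)) * (\<Sum>q<n. nc_pencil m X p q * s (b' $$ (q, j))))"
      unfolding P_def by simp
    also have "\<dots> = rmul n (S b) (rmul n (P X) (S b')) i j"
      unfolding rmul_def S_def P_def
      using s_mem pencil_mem mult_mem sum_mem f_mult by (simp add: f_sum)
    finally show ?thesis .
  qed
  \<comment> \<open>If B inverts the pencil of X from the right, then c' B c inverts b X b' from the
    right.\<close>
  define D where "D = rmul n (S c') (rmul n B (S c))"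
  have D: "rmat n D" unfolding D_def by (intro rmat_mul S B)
  note rm = rmat_mul S P B(1)
  have PZD: "rmul n (P Z) D i j = rone i j" if ij: "i < n" "j < n" for i j
  proof -
    have e1: "rmul n (S b') D i j = rmul n B (S c) i j" if "i < n" "j < n" for i j
    proof -
      have "rmul n (S b') D i j = rmul n (rmul n (S b') (S c')) (rmul n B (S c)) i j"
        unfolding D_def using that by (intro rmul_assoc[symmetric] rm)
      also have "\<dots> = rmul n rone (rmul n B (S c)) i j"
        by (rule rmul_cong) (use that b' in \<open>simp_all add: S_mul S_one rm rmat_one\<close>)
      finally show ?thesis using that rmul_one_left rm by metis
    qed
    have e2: "rmul n (rmul n (P X) (S b')) D i j = S c i j" if "i < n" "j < n" for i j
    proof -
      have "rmul n (rmul n (P X) (S b')) D i j = rmul n (P X) (rmul n (S b') D) i j"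
        using that by (intro rmul_assoc rm D)
      also have "\<dots> = rmul n (P X) (rmul n B (S c)) i j"
        by (rule rmul_cong) (use that in \<open>simp_all add: e1 rm\<close>)
      also have "\<dots> = rmul n (rmul n (P X) B) (S c) i j"
        using that by (intro rmul_assoc[symmetric] rm)
      also have "\<dots> = rmul n rone (S c) i j"
        by (rule rmul_cong) (use that in \<open>simp_all add: B(2) rm rmat_one\<close>)
      finally show ?thesis using that rmul_one_left[OF S] by simp
    qed
    have "rmul n (P Z) D i j = rmul n (rmul n (S b) (rmul n (P X) (S b'))) D i j"
      by (rule rmul_cong) (use ij in \<open>simp_all add: PZ rm D\<close>)
    also have "\<dots> = rmul n (S b) (rmul n (rmul n (P X) (S b')) D) i j"
      using ij by (intro rmul_assoc rm D)
    also have "\<dots> = rmul n (S b) (S c) i j"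
      by (rule rmul_cong) (use ij in \<open>simp_all add: e2 rm\<close>)
    also have "\<dots> = rone i j" using S_mul[OF b(1,2) ij] b(3) S_one[OF ij] by simp
    finally show ?thesis .
  qed
  obtain \<sigma> where \<sigma>: "inj_on \<sigma> {..<n}" "\<sigma> ` {..<n} \<subseteq> {..<n}" "\<forall>i\<in>{..<n}. P Z i (\<sigma> i) \<noteq> \<zero>\<^bsub>F\<^esub>"
    using skew_field_transversal[OF K, of "{..<n}" "{..<n}" "P Z" D] P D PZD
    unfolding rmat_def rmul_def rone_def by auto
  have "\<exists>k<m. Z k $$ (i, \<sigma> i) \<noteq> 0" if "i < n" for i
  proof (rule ccontr)
    assume "\<not> ?thesis"
    then have "nc_pencil m Z i (\<sigma> i) = 0" unfolding nc_pencil_def by simp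
    then show False using bspec[OF \<sigma>(3), of i] that f_zero unfolding P_def by simp
  qed
  then show ?thesis using \<sigma>(1,2) unfolding Z_def by blast
qed

section \<open>Rank one tensors\<close>

text \<open>Every column of \<open>A\<close> is parallel to every column of \<open>B\<close>. For
  \<open>A = B\<close> this is the vanishing of all two by two minors, that is, rank at most
  one.\<close>

definition parallel_columns :: "'i set \<Rightarrow> 'p set \<Rightarrow> ('i \<Rightarrow> 'p \<Rightarrow> complex) \<Rightarrow> ('i \<Rightarrow> 'p \<Rightarrow> complex) \<Rightarrow> bool" where
  "parallel_columns I P A B \<longleftrightarrow> (\<forall>i\<in>I. \<forall>i'\<in>I. \<forall>p\<in>P. \<forall>p'\<in>P. A i p * B i' p' = A i' p * B i p')"

lemma parallel_columnsD: "parallel_columns I P A B \<Longrightarrow> i \<in> I \<Longrightarrow> i' \<in> I \<Longrightarrow> p \<in> P \<Longrightarrow> p' \<in> P \<Longrightarrow> A i p * B i' p' = A i' p * B i p'"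
  unfolding parallel_columns_def by blast

text \<open>Any nonzero column of one of the matrices spans the columns of all of them.\<close>

lemma parallel_columns_common_factor:
  assumes "\<And>r r'. r \<in> S \<Longrightarrow> r' \<in> S \<Longrightarrow> parallel_columns I P (A r) (A r')"
  shows "\<exists>f w. \<forall>r\<in>S. \<forall>i\<in>I. \<forall>p\<in>P. A r i p = f i * w r p"
proof (cases "\<exists>r\<in>S. \<exists>i\<in>I. \<exists>p\<in>P. A r i p \<noteq> 0")
  case True
  then obtain r0 i0 p0 where 0: "r0 \<in> S" "i0 \<in> I" "p0 \<in> P" "A r0 i0 p0 \<noteq> 0" by blast
  have "A r i p = A r0 i p0 * (A r i0 p / A r0 i0 p0)" if "r \<in> S" "i \<in> I" "p \<in> P" for r i p
    using parallel_columnsD[OF assms[OF that(1) 0(1)] that(2) 0(2) that(3) 0(3)] 0(4) by (simp add: field_simps)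
  then show ?thesis
    by (intro exI[of _ "\<lambda>i. A r0 i p0"] exI[of _ "\<lambda>r p. A r i0 p / A r0 i0 p0"]) blast
next
  case False
  then show ?thesis by (intro exI[of _ "\<lambda>_. 0"] exI[of _ "\<lambda>_ _. 0"]) auto
qed

lemma parallel_columns_rank_one:
  assumes "parallel_columns I P A A" shows "\<exists>f w. \<forall>i\<in>I. \<forall>p\<in>P. A i p = f i * w p"
  using parallel_columns_common_factor[of "{()}" I P "\<lambda>_. A"] assms by auto

text \<open>For A = a b^T and B = c d^T the minors of A + B are the products of a minor of a, c with
  a minor of b, d. So all minors of one of the two pairs vanish, and A and B share their column or
  their row direction.\<close>

lemma parallel_columns_pair:
  assumes "parallel_columns I P A A" "parallel_columns I P B B" "parallel_columns I P (\<lambda>i p. A i p + B i p) (\<lambda>i p. A i p + B i p)"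
  shows "parallel_columns I P A B \<or> parallel_columns P I (\<lambda>p i. A i p) (\<lambda>p i. B i p)"
proof -
  obtain a b where A: "\<And>i p. i \<in> I \<Longrightarrow> p \<in> P \<Longrightarrow> A i p = a i * b p" using parallel_columns_rank_one[OF assms(1)] by blast
  obtain c d where B: "\<And>i p. i \<in> I \<Longrightarrow> p \<in> P \<Longrightarrow> B i p = c i * d p" using parallel_columns_rank_one[OF assms(2)] by blast
  have "(a i * c i' - a i' * c i) * (b p * d p' - b p' * d p) = 0"
    if "i \<in> I" "i' \<in> I" "p \<in> P" "p' \<in> P" for i i' p p'
  proof -
    have "(a i * b p + c i * d p) * (a i' * b p' + c i' * d p') = (a i' * b p + c i' * d p) * (a i * b p' + c i * d p')"
      using parallel_columnsD[OF assms(3) that] A B that by simp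
    then show ?thesis by (simp add: algebra_simps)
  qed
  then consider "\<forall>i\<in>I. \<forall>i'\<in>I. a i * c i' = a i' * c i" | "\<forall>p\<in>P. \<forall>p'\<in>P. b p * d p' = b p' * d p"
    by (metis mult_eq_0_iff right_minus_eq)
  then show ?thesis
  proof cases
    case 1
    have "A i p * B i' p' = A i' p * B i p'" if "i \<in> I" "i' \<in> I" "p \<in> P" "p' \<in> P" for i i' p p'
    proof -
      have "A i p * B i' p' = (a i * c i') * (b p * d p')" using A B that by simp
      also have "\<dots> = (a i' * c i) * (b p * d p')" using 1 that by simp
      also have "\<dots> = A i' p * B i p'" using A B that by simp
      finally show ?thesis .
    qed
    then show ?thesis unfolding parallel_columns_def by blast
  next
    case 2
    have "A i p * B i' p' = A i p' * B i' p" if "i \<in> I" "i' \<in> I" "p \<in> P" "p' \<in> P" for i i' p p'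
    proof -
      have "A i p * B i' p' = (a i * c i') * (b p * d p')" using A B that by simp
      also have "\<dots> = (a i * c i') * (b p' * d p)" using 2 that by simp
      also have "\<dots> = A i p' * B i' p" using A B that by simp
      finally show ?thesis .
    qed
    then show ?thesis unfolding parallel_columns_def by blast
  qed
qed

section \<open>Closed conditions tested along lines\<close>

definition polyfun :: "(complex \<Rightarrow> complex) \<Rightarrow> bool" where
  "polyfun f \<longleftrightarrow> (\<exists>p. \<forall>t. f t = poly p t)"

lemma polyfun_const: "polyfun (\<lambda>_. c)"
  unfolding polyfun_def by (intro exI[of _ "[:c:]"]) simp

lemma polyfun_id: "polyfun (\<lambda>t. t)"
  unfolding polyfun_def by (intro exI[of _ "[:0, 1:]"]) simp

lemma polyfun_add: "polyfun f \<Longrightarrow> polyfun g \<Longrightarrow> polyfun (\<lambda>t. f t + g t)"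
  unfolding polyfun_def by (elim exE) (metis poly_add)

lemma polyfun_diff: "polyfun f \<Longrightarrow> polyfun g \<Longrightarrow> polyfun (\<lambda>t. f t - g t)"
  unfolding polyfun_def by (elim exE) (metis poly_diff)

lemma polyfun_mult: "polyfun f \<Longrightarrow> polyfun g \<Longrightarrow> polyfun (\<lambda>t. f t * g t)"
  unfolding polyfun_def by (elim exE) (metis poly_mult)

lemma polyfun_sum: "(\<And>i. i \<in> I \<Longrightarrow> polyfun (f i)) \<Longrightarrow> polyfun (\<lambda>t. \<Sum>i\<in>I. f i t)"
  by (induction I rule: infinite_finite_induct) (auto intro: polyfun_const polyfun_add)

text \<open>A weak form of Zariski closedness: on every line the condition is a system of polynomial
  equations in the parameter. Irreducibility needs no more than this.\<close>

definition zclosed :: "(('v \<Rightarrow> complex) \<Rightarrow> bool) \<Rightarrow> bool" where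
  "zclosed Q \<longleftrightarrow> (\<forall>u v. \<exists>S. \<forall>t. Q (\<lambda>i. u i + t * v i) \<longleftrightarrow> (\<forall>p\<in>S. poly p t = 0))"

text \<open>Irreducibility of affine space: two points outside the respective sets lie on a line, where
  the two nonzero polynomials have only finitely many zeros.\<close>

lemma zclosed_irreducible:
  assumes Q: "zclosed Q" and R: "zclosed R" and QR: "\<And>z. Q z \<or> R z"
  shows "(\<forall>z. Q z) \<or> (\<forall>z. R z)"
proof (rule ccontr)
  assume "\<not> ?thesis"
  then obtain u w where uw: "\<not> Q u" "\<not> R w" by blast
  define v where "v i = w i - u i" for i
  obtain S where S: "\<And>t. Q (\<lambda>i. u i + t * v i) \<longleftrightarrow> (\<forall>p\<in>S. poly p t = 0)"
    using Q unfolding zclosed_def by blast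
  obtain S' where S': "\<And>t. R (\<lambda>i. u i + t * v i) \<longleftrightarrow> (\<forall>p\<in>S'. poly p t = 0)"
    using R unfolding zclosed_def by blast
  obtain p where p: "p \<in> S" "poly p 0 \<noteq> 0" using S[of 0] uw(1) by auto
  obtain q where q: "q \<in> S'" "poly q 1 \<noteq> 0" using S'[of 1] uw(2) unfolding v_def by auto
  have "poly (p * q) t = 0" for t
    using QR[of "\<lambda>i. u i + t * v i"] S[of t] S'[of t] p(1) q(1) by auto
  then have "p * q = 0" using poly_all_0_iff_0 by blast
  then show False using p(2) q(2) by auto
qed

lemma zclosed_parallel_columns:
  fixes A B :: "('v \<Rightarrow> complex) \<Rightarrow> 'i \<Rightarrow> 'p \<Rightarrow> complex"
  assumes A: "\<And>i p u v. polyfun (\<lambda>t. A (\<lambda>a. u a + t * v a) i p)"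
    and B: "\<And>i p u v. polyfun (\<lambda>t. B (\<lambda>a. u a + t * v a) i p)"
  shows "zclosed (\<lambda>z. parallel_columns I P (A z) (B z))"
  unfolding zclosed_def
proof (intro allI)
  fix u v :: "'v \<Rightarrow> complex"
  let ?D = "I \<times> I \<times> P \<times> P"
  let ?l = "\<lambda>t a. u a + t * v a"
  define f where "f i i' p p' = (SOME q. \<forall>t.
      A (?l t) i p * B (?l t) i' p' - A (?l t) i' p * B (?l t) i p' = poly q t)" for i i' p p'
  have f: "A (?l t) i p * B (?l t) i' p' - A (?l t) i' p * B (?l t) i p' = poly (f i i' p p') t"
    for i i' p p' t
  proof -
    have "\<exists>q. \<forall>t. A (?l t) i p * B (?l t) i' p' - A (?l t) i' p * B (?l t) i p' = poly q t"
      using polyfun_diff[OF polyfun_mult[OF A B] polyfun_mult[OF A B]] unfolding polyfun_def .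
    from someI_ex[OF this] show ?thesis unfolding f_def by blast
  qed
  show "\<exists>S. \<forall>t. parallel_columns I P (A (?l t)) (B (?l t)) \<longleftrightarrow> (\<forall>p\<in>S. poly p t = 0)"
  proof (intro exI allI)
    fix t
    show "parallel_columns I P (A (?l t)) (B (?l t)) \<longleftrightarrow> (\<forall>q\<in>(\<lambda>(i, i', p, p'). f i i' p p') ` ?D. poly q t = 0)"
      unfolding parallel_columns_def by (auto simp: f[symmetric])
  qed
qed

text \<open>Each array t(., ., a, .) has the form f_a(i) w_a(p', p). If f_0 and f_a are independent,
  the product form of the sum forces w_a to be a multiple of w_0, so one w serves all
  \<open>a\<close>. The last hypothesis supplies the independence. Used twice: to split off the row
  indices, then to separate the column indices from the slots.\<close>

lemma factor_coefficients:
  fixes t :: "nat \<Rightarrow> 'p \<Rightarrow> nat \<Rightarrow> 'p \<Rightarrow> complex"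
  assumes n: "n \<ge> 2"
    and H1: "\<And>a. a < n \<Longrightarrow> \<exists>f w. \<forall>p'\<in>P. \<forall>i\<in>{..<n}. \<forall>p\<in>P. t i p a p' = f i * w p' p"
    and H2: "\<And>a. a < n \<Longrightarrow> a \<noteq> 0 \<Longrightarrow> \<exists>f w. \<forall>p'\<in>P. \<forall>i\<in>{..<n}. \<forall>p\<in>P. t i p 0 p' + t i p a p' = f i * w p' p"
    and H3: "\<And>a f w w'. a < n \<Longrightarrow> a \<noteq> 0 \<Longrightarrow> \<forall>p'\<in>P. \<forall>i\<in>{..<n}. \<forall>p\<in>P. t i p 0 p' = f i * w p' p
      \<Longrightarrow> \<forall>p'\<in>P. \<forall>i\<in>{..<n}. \<forall>p\<in>P. t i p a p' = f i * w' p' p \<Longrightarrow> False"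
  shows "\<exists>q s. \<forall>i<n. \<forall>a<n. \<forall>p\<in>P. \<forall>p'\<in>P. t i p a p' = q i a * s p p'"
proof -
  obtain f0 w0 where t0: "\<forall>p'\<in>P. \<forall>i\<in>{..<n}. \<forall>p\<in>P. t i p 0 p' = f0 i * w0 p' p" using H1[of 0] n by auto
  have main: "\<exists>g. \<forall>i\<in>{..<n}. \<forall>p\<in>P. \<forall>p'\<in>P. t i p a p' = g i * w0 p' p" if a: "a < n" "a \<noteq> 0" for a
  proof -
    obtain f w where ta: "\<forall>p'\<in>P. \<forall>i\<in>{..<n}. \<forall>p\<in>P. t i p a p' = f i * w p' p" using H1[OF a(1)] by blast
    obtain g v where tg: "\<forall>p'\<in>P. \<forall>i\<in>{..<n}. \<forall>p\<in>P. t i p 0 p' + t i p a p' = g i * v p' p"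
      using H2[OF a] by blast
    \<comment> \<open>Dependent \<open>f0\<close> and \<open>f\<close> would allow a common factor,
      with zero as the other factor where \<open>f0\<close> vanishes; \<open>H3\<close> excludes
      that.\<close>
    have "\<exists>i<n. \<exists>i'<n. f0 i * f i' \<noteq> f0 i' * f i"
    proof (rule ccontr)
      assume neg: "\<not> ?thesis"
      show False
      proof (cases "\<exists>i<n. f0 i \<noteq> 0")
        case True
        then obtain i0 where i0: "i0 < n" "f0 i0 \<noteq> 0" by blast
        have "f i = f0 i * (f i0 / f0 i0)" if "i < n" for i
          using neg i0 that by (auto simp: field_simps)
        then have "\<forall>p'\<in>P. \<forall>i\<in>{..<n}. \<forall>p\<in>P. t i p a p' = f0 i * ((f i0 / f0 i0) * w p' p)"
          using ta by (simp add: mult.assoc)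
        then show False by (rule H3[OF a t0, of "\<lambda>p' p. (f i0 / f0 i0) * w p' p"])
      next
        case False
        then have "\<forall>p'\<in>P. \<forall>i\<in>{..<n}. \<forall>p\<in>P. t i p 0 p' = f i * 0" using t0 by simp
        then show False using H3[OF a, of f "\<lambda>_ _. 0" w] ta by simp
      qed
    qed
    then obtain i1 i2 where i12: "i1 < n" "i2 < n" "f0 i1 * f i2 \<noteq> f0 i2 * f i1" by blast
    have par: "w0 p' p * w r' r = w p' p * w0 r' r" if "p \<in> P" "p' \<in> P" "r \<in> P" "r' \<in> P" for p p' r r'
    proof -
      have e: "f0 i * w0 x' x + f i * w x' x = g i * v x' x" if "i < n" "x \<in> P" "x' \<in> P" for i x x'
        using t0 ta tg that by (metis lessThan_iff)
      \<comment> \<open>A minor of the sum is the product of the minor of \<open>f0\<close>,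
        \<open>f\<close> and the minor of \<open>w0\<close>, \<open>w\<close>; the former is nonzero
        at \<open>i1\<close>, \<open>i2\<close>.\<close>
      have "(f0 i1 * w0 p' p + f i1 * w p' p) * (f0 i2 * w0 r' r + f i2 * w r' r)
          = (f0 i2 * w0 p' p + f i2 * w p' p) * (f0 i1 * w0 r' r + f i1 * w r' r)"
        unfolding e[OF i12(1) that(1,2)] e[OF i12(2) that(3,4)] e[OF i12(2) that(1,2)] e[OF i12(1) that(3,4)]
        by (simp add: ac_simps)
      then have "(f0 i1 * f i2 - f0 i2 * f i1) * (w0 p' p * w r' r - w p' p * w0 r' r) = 0"
        by (simp add: algebra_simps)
      then show ?thesis using i12(3) by simp
    qed
    have "\<exists>r\<in>P. \<exists>r'\<in>P. w0 r' r \<noteq> 0"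
    proof (rule ccontr)
      assume "\<not> ?thesis"
      then have "\<forall>p'\<in>P. \<forall>i\<in>{..<n}. \<forall>p\<in>P. t i p 0 p' = f i * 0" using t0 by simp
      then show False using H3[OF a, of f "\<lambda>_ _. 0" w] ta by simp
    qed
    then obtain r r' where r: "r \<in> P" "r' \<in> P" "w0 r' r \<noteq> 0" by blast
    have "w p' p = (w r' r / w0 r' r) * w0 p' p" if "p \<in> P" "p' \<in> P" for p p'
      using par[OF that r(1,2)] r(3) by (simp add: field_simps)
    then have "\<forall>i\<in>{..<n}. \<forall>p\<in>P. \<forall>p'\<in>P. t i p a p' = (f i * (w r' r / w0 r' r)) * w0 p' p"
      using ta by (simp add: mult.assoc)
    then show ?thesis by (rule exI[of _ "\<lambda>i. f i * (w r' r / w0 r' r)"])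
  qed
  have "\<forall>a<n. \<exists>g. \<forall>i\<in>{..<n}. \<forall>p\<in>P. \<forall>p'\<in>P. t i p a p' = g i * w0 p' p"
  proof (intro allI impI)
    fix a assume "a < n"
    then show "\<exists>g. \<forall>i\<in>{..<n}. \<forall>p\<in>P. \<forall>p'\<in>P. t i p a p' = g i * w0 p' p"
      using main t0 by (cases "a = 0") auto
  qed
  from choice_less[OF this] obtain q where "\<forall>a<n. \<forall>i\<in>{..<n}. \<forall>p\<in>P. \<forall>p'\<in>P. t i p a p' = q a i * w0 p' p" by blast
  then show ?thesis by (intro exI[of _ "\<lambda>i a. q a i"] exI[of _ "\<lambda>p p'. w0 p' p"]) auto
qed

text \<open>More vectors than coordinates are dependent: padded with zero rows they form a singular
  square matrix, and \<rho> is a kernel vector.\<close>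

lemma rank_dependent:
  fixes w :: "'p \<Rightarrow> nat \<Rightarrow> complex"
  assumes P: "finite P" "card P > n"
  shows "\<exists>\<rho>. (\<exists>p\<in>P. \<rho> p \<noteq> 0) \<and> (\<forall>i<n. (\<Sum>p\<in>P. w p i * \<rho> p) = 0)"
proof -
  define c where "c = card P"
  obtain h where h: "bij_betw h {0..<c} P" using ex_bij_betw_nat_finite[OF P(1)] c_def by blast
  define M where "M = mat c c (\<lambda>(i, l). if i < n then w (h l) i else 0)"
  have cM: "M \<in> carrier_mat c c" unfolding M_def by simp
  have "det M = 0"
  proof (rule det_zero_of_low_rank[of n])
    fix i j assume ij: "i < c" "j < c"
    have "(\<Sum>l<n. (if l = i then 1 else 0) * w (h j) l) = (\<Sum>l<n. if l = i then w (h j) i else 0)"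
      by (intro sum.cong) auto
    then show "M $$ (i, j) = (\<Sum>l<n. (if l = i then 1 else 0) * w (h j) l)"
      using ij by (simp add: M_def)
  qed (use P(2) cM c_def in auto)
  then obtain v where v: "v \<in> carrier_vec c" "v \<noteq> 0\<^sub>v c" "M *\<^sub>v v = 0\<^sub>v c"
    using det_0_iff_vec_prod_zero[OF cM] by blast
  define \<rho> where "\<rho> p = v $ (inv_into {0..<c} h p)" for p
  have \<rho>h: "\<rho> (h l) = v $ l" if "l < c" for l
    using bij_betw_inv_into_left[OF h, of l] that unfolding \<rho>_def by simp
  obtain l where l: "l < c" "v $ l \<noteq> 0" using v(1,2) by (metis carrier_vecD eq_vecI index_zero_vec)
  have "h l \<in> P" using h l(1) unfolding bij_betw_def by auto
  then have "\<exists>p\<in>P. \<rho> p \<noteq> 0" using \<rho>h[OF l(1)] l(2) by force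
  moreover have "(\<Sum>p\<in>P. w p i * \<rho> p) = 0" if "i < n" for i
  proof -
    have i: "i < c" using that P(2) c_def by simp
    have "(\<Sum>p\<in>P. w p i * \<rho> p) = (\<Sum>l\<in>{0..<c}. w (h l) i * \<rho> (h l))"
      using sum.reindex_bij_betw[OF h, of "\<lambda>p. w p i * \<rho> p"] by simp
    also have "\<dots> = (\<Sum>l<c. M $$ (i, l) * v $ l)"
      using i that by (auto simp: M_def \<rho>h lessThan_atLeast0 intro!: sum.cong)
    also have "\<dots> = (M *\<^sub>v v) $ i" using mult_mat_vec_index[OF cM v(1) i] by simp
    finally show ?thesis using v(3) i by simp
  qed
  ultimately show ?thesis by blast
qed

section \<open>Linear maps preserving tensors with a split factor\<close>

type_synonym tensor = "nat \<Rightarrow> nat \<Rightarrow> nat \<Rightarrow> complex"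

text \<open>Read as a matrix with rows \<open>i\<close> and columns \<open>(j, k)\<close>, the
  tensor has rank at most one, so it is \<open>u i * \<rho> j k\<close>. Minors instead of factors
  make this a closed condition.\<close>

definition splits_first :: "nat \<Rightarrow> nat \<Rightarrow> tensor \<Rightarrow> bool" where
  "splits_first n m x \<longleftrightarrow> parallel_columns {..<n} ({..<n} \<times> {..<m}) (\<lambda>i p. x i (fst p) (snd p)) (\<lambda>i p. x i (fst p) (snd p))"

definition splits_second :: "nat \<Rightarrow> nat \<Rightarrow> tensor \<Rightarrow> bool" where
  "splits_second n m x \<longleftrightarrow> splits_first n m (\<lambda>i j k. x j i k)"

definition tensor_apply :: "nat \<Rightarrow> nat \<Rightarrow> (nat \<Rightarrow> nat \<Rightarrow> nat \<Rightarrow> tensor) \<Rightarrow> tensor \<Rightarrow> tensor" where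
  "tensor_apply n m t x i j k = (\<Sum>i'<n. \<Sum>j'<n. \<Sum>k'<m. t i j k i' j' k' * x i' j' k')"

definition kron :: "nat \<Rightarrow> nat \<Rightarrow> complex" where
  "kron a i = (if i = a then 1 else 0)"

lemma kron_simps [simp]: "kron a a = 1" "i \<noteq> a \<Longrightarrow> kron a i = 0"
  by (auto simp: kron_def)

lemma sum_kron [simp]: "a < n \<Longrightarrow> (\<Sum>i<n. f i * kron a i) = f a"
proof -
  assume "a < n"
  have "(\<Sum>i<n. f i * kron a i) = (\<Sum>i<n. if i = a then f a else 0)"
    by (intro sum.cong) (auto simp: kron_def)
  then show ?thesis using \<open>a < n\<close> by simp
qed

lemma splits_firstI:
  assumes "\<And>i j k. i < n \<Longrightarrow> j < n \<Longrightarrow> k < m \<Longrightarrow> x i j k = f i * w j k"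
  shows "splits_first n m x"
  unfolding splits_first_def parallel_columns_def using assms by auto

lemma splits_secondI:
  assumes "\<And>i j k. i < n \<Longrightarrow> j < n \<Longrightarrow> k < m \<Longrightarrow> x i j k = f j * w i k"
  shows "splits_second n m x"
  unfolding splits_second_def by (rule splits_firstI[of n m _ f w]) (simp add: assms)

lemma splits_firstD:
  "splits_first n m x \<Longrightarrow> i < n \<Longrightarrow> i' < n \<Longrightarrow> j < n \<Longrightarrow> j' < n \<Longrightarrow> k < m \<Longrightarrow> k' < m \<Longrightarrow>
    x i j k * x i' j' k' = x i' j k * x i j' k'"
  unfolding splits_first_def by (drule parallel_columnsD[of _ _ _ _ i i' "(j, k)" "(j', k')"]) auto

lemma splits_secondD:
  "splits_second n m x \<Longrightarrow> i < n \<Longrightarrow> i' < n \<Longrightarrow> j < n \<Longrightarrow> j' < n \<Longrightarrow> k < m \<Longrightarrow> k' < m \<Longrightarrow>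
    x i j k * x i' j' k' = x i j' k * x i' j k'"
  unfolding splits_second_def using splits_firstD[of n m "\<lambda>i j k. x j i k" j j' i i' k k'] by simp

lemma not_rank_one:
  assumes "i < n" "i' < n" "j < n" "j' < n" "m \<ge> 1" "i \<noteq> i'" "j \<noteq> j'"
  shows "\<not> splits_first n m (\<lambda>a b c. kron i a * (kron j b * kron 0 c) + kron i' a * (kron j' b * kron 0 c))"
    "\<not> splits_second n m (\<lambda>a b c. kron i a * (kron j b * kron 0 c) + kron i' a * (kron j' b * kron 0 c))"
proof -
  let ?x = "\<lambda>a b c. kron i a * (kron j b * kron 0 c) + kron i' a * (kron j' b * kron 0 c)"
  have "?x i j 0 * ?x i' j' 0 = 1" "?x i' j 0 * ?x i j' 0 = 0" "?x i j' 0 * ?x i' j 0 = 0"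
    using assms by auto
  then show "\<not> splits_first n m ?x" "\<not> splits_second n m ?x"
    using splits_firstD[of n m ?x i i' j j' 0 0] splits_secondD[of n m ?x i i' j j' 0 0] assms by auto
qed

text \<open>\<open>t\<close> is the coefficient array of an injective linear map. Tensors are total
  functions, so the kernel can be trivial only within the index bounds.\<close>

locale tensor_preserver =
  fixes n m :: nat and t :: "nat \<Rightarrow> nat \<Rightarrow> nat \<Rightarrow> tensor"
  assumes n2: "n \<ge> 2" and m1: "m \<ge> 1"
    and inj: "\<And>x i j k. (\<And>i j k. i < n \<Longrightarrow> j < n \<Longrightarrow> k < m \<Longrightarrow> tensor_apply n m t x i j k = 0) \<Longrightarrow>
      i < n \<Longrightarrow> j < n \<Longrightarrow> k < m \<Longrightarrow> x i j k = 0"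
    and pres: "\<And>x. splits_first n m x \<or> splits_second n m x \<Longrightarrow> splits_first n m (tensor_apply n m t x) \<or> splits_second n m (tensor_apply n m t x)"
    and reflect: "\<And>x. splits_first n m (tensor_apply n m t x) \<or> splits_second n m (tensor_apply n m t x) \<Longrightarrow> splits_first n m x \<or> splits_second n m x"

text \<open>Elementary tensors \<open>u \<otimes> \<rho>\<close>, \<open>u \<otimes> \<rho>'\<close> are sent to elementary tensors with the same first factor.\<close>

definition first_to_first :: "nat \<Rightarrow> nat \<Rightarrow> (nat \<Rightarrow> nat \<Rightarrow> nat \<Rightarrow> tensor) \<Rightarrow> bool" where
  "first_to_first n m t \<longleftrightarrow> (\<forall>u \<rho> \<rho>'. parallel_columns {..<n} ({..<n} \<times> {..<m})
     (\<lambda>i p. tensor_apply n m t (\<lambda>i j k. u i * \<rho> j k) i (fst p) (snd p))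
     (\<lambda>i p. tensor_apply n m t (\<lambda>i j k. u i * \<rho>' j k) i (fst p) (snd p)))"

definition tswap :: "(nat \<Rightarrow> nat \<Rightarrow> nat \<Rightarrow> tensor) \<Rightarrow> nat \<Rightarrow> nat \<Rightarrow> nat \<Rightarrow> tensor" where
  "tswap t = (\<lambda>i j k. t j i k)"

lemma tswap_tswap [simp]: "tswap (tswap t) = t"
  unfolding tswap_def by simp

lemma tensor_apply_swap: "tensor_apply n m (tswap t) x = (\<lambda>i j k. tensor_apply n m t x j i k)"
  unfolding tensor_apply_def tswap_def by simp

lemma tensor_preserver_tswap:
  assumes "tensor_preserver n m t" shows "tensor_preserver n m (tswap t)"
proof -
  interpret tensor_preserver n m t by fact
  have sw: "splits_first n m (\<lambda>i j k. tensor_apply n m t x j i k) \<or> splits_second n m (\<lambda>i j k. tensor_apply n m t x j i k)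
    \<longleftrightarrow> splits_first n m (tensor_apply n m t x) \<or> splits_second n m (tensor_apply n m t x)" for x
    unfolding splits_second_def by (rule disj_commute)
  show ?thesis
  proof (rule tensor_preserver.intro)
    show "x i j k = 0" if "\<And>i j k. i < n \<Longrightarrow> j < n \<Longrightarrow> k < m \<Longrightarrow> tensor_apply n m (tswap t) x i j k = 0"
      "i < n" "j < n" "k < m" for x i j k
    proof (rule inj[OF _ that(2-4)])
      fix i j k assume "i < n" "j < n" "k < m"
      then show "tensor_apply n m t x i j k = 0" using that(1)[of j i k] unfolding tensor_apply_swap by simp
    qed
    show "splits_first n m (tensor_apply n m (tswap t) x) \<or> splits_second n m (tensor_apply n m (tswap t) x)"
      if "splits_first n m x \<or> splits_second n m x" for x
      unfolding tensor_apply_swap sw by (rule pres[OF that])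
    show "splits_first n m x \<or> splits_second n m x"
      if "splits_first n m (tensor_apply n m (tswap t) x) \<or> splits_second n m (tensor_apply n m (tswap t) x)" for x
      using that unfolding tensor_apply_swap sw by (rule reflect)
  qed (fact n2 m1)+
qed

lemma polyfun_tensor_apply:
  assumes "\<And>i j k. polyfun (\<lambda>s. X s i j k)" shows "polyfun (\<lambda>s. tensor_apply n m t (X s) i j k)"
  unfolding tensor_apply_def by (intro polyfun_sum polyfun_mult polyfun_const assms)

lemma polyfun_line: "polyfun (\<lambda>s. u + s * v)"
  by (intro polyfun_add polyfun_mult polyfun_const polyfun_id)

lemma tensor_apply_add:
  "tensor_apply n m t (\<lambda>i j k. x i j k + y i j k) i j k = tensor_apply n m t x i j k + tensor_apply n m t y i j k"
  unfolding tensor_apply_def by (simp add: distrib_left sum.distrib)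

lemma tensor_apply_basis:
  assumes "a < n" "b < n" "c < m"
  shows "tensor_apply n m t (\<lambda>i j k. kron a i * (kron b j * kron c k)) i j k = t i j k a b c"
proof -
  have "tensor_apply n m t (\<lambda>i j k. kron a i * (kron b j * kron c k)) i j k
      = (\<Sum>i'<n. (\<Sum>j'<n. (\<Sum>k'<m. t i j k i' j' k' * kron c k') * kron b j') * kron a i')"
    unfolding tensor_apply_def sum_distrib_right by (intro sum.cong refl) (simp only: ac_simps)
  then show ?thesis using assms by simp
qed

context tensor_preserver
begin

text \<open>The tensors with a split first factor are parametrised by an affine space, which the two
  closed conditions on their images cover; by irreducibility one of them holds throughout.\<close>

lemma splits_first_or_second:
  "(\<forall>u \<rho>. splits_first n m (tensor_apply n m t (\<lambda>i j k. u i * \<rho> j k))) \<or> (\<forall>u \<rho>. splits_second n m (tensor_apply n m t (\<lambda>i j k. u i * \<rho> j k)))"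
proof -
  define X :: "(nat + nat \<times> nat \<Rightarrow> complex) \<Rightarrow> tensor"
    where "X z i j k = z (Inl i) * z (Inr (j, k))" for z i j k
  have pf: "polyfun (\<lambda>s. tensor_apply n m t (X (\<lambda>a. u a + s * v a)) i j k)" for u v i j k
    by (rule polyfun_tensor_apply) (unfold X_def, intro polyfun_mult polyfun_line)
  have "(\<forall>z. splits_first n m (tensor_apply n m t (X z))) \<or> (\<forall>z. splits_second n m (tensor_apply n m t (X z)))"
  proof (rule zclosed_irreducible)
    show "zclosed (\<lambda>z. splits_first n m (tensor_apply n m t (X z)))"
      unfolding splits_first_def by (rule zclosed_parallel_columns; rule pf)
    show "zclosed (\<lambda>z. splits_second n m (tensor_apply n m t (X z)))"
      unfolding splits_second_def splits_first_def by (rule zclosed_parallel_columns; rule pf)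
    fix z
    have "splits_first n m (X z)" by (rule splits_firstI) (simp add: X_def)
    then show "splits_first n m (tensor_apply n m t (X z)) \<or> splits_second n m (tensor_apply n m t (X z))" using pres by blast
  qed
  moreover have "\<exists>z. X z = (\<lambda>i j k. u i * \<rho> j k)" for u \<rho>
    by (intro exI[of _ "case_sum u (\<lambda>(j, k). \<rho> j k)"]) (simp add: X_def fun_eq_iff)
  ultimately show ?thesis by metis
qed

text \<open>The images for \<open>\<rho>\<close>, \<open>\<rho>'\<close> and their sum have rank
  one, so the first two share their row factor or their remaining factor, uniformly by
  irreducibility. In the second case, for \<open>m > 1\<close>, a space of dimension n m would be
  mapped injectively into one of dimension \<open>n\<close>.\<close>

lemma first_to_first_of_splits:
  assumes R: "\<And>u \<rho>. splits_first n m (tensor_apply n m t (\<lambda>i j k. u i * \<rho> j k))"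
  shows "first_to_first n m t \<or> first_to_first n m (tswap t)"
proof -
  let ?P = "{..<n} \<times> {..<m}"
  define X :: "(nat + (nat \<times> nat) + (nat \<times> nat) \<Rightarrow> complex) \<Rightarrow> tensor"
    where "X z i j k = z (Inl i) * z (Inr (Inl (j, k)))" for z i j k
  define Y :: "(nat + (nat \<times> nat) + (nat \<times> nat) \<Rightarrow> complex) \<Rightarrow> tensor"
    where "Y z i j k = z (Inl i) * z (Inr (Inr (j, k)))" for z i j k
  define A where "A z i p = tensor_apply n m t (X z) i (fst p) (snd p)" for z i p
  define B where "B z i p = tensor_apply n m t (Y z) i (fst p) (snd p)" for z i p
  have pfA: "polyfun (\<lambda>s. A (\<lambda>a. u a + s * v a) i p)" for u v i p
    unfolding A_def by (rule polyfun_tensor_apply) (unfold X_def, intro polyfun_mult polyfun_line)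
  have pfB: "polyfun (\<lambda>s. B (\<lambda>a. u a + s * v a) i p)" for u v i p
    unfolding B_def by (rule polyfun_tensor_apply) (unfold Y_def, intro polyfun_mult polyfun_line)
  have disj: "(\<forall>z. parallel_columns {..<n} ?P (A z) (B z)) \<or> (\<forall>z. parallel_columns ?P {..<n} (\<lambda>p i. A z i p) (\<lambda>p i. B z i p))"
  proof (rule zclosed_irreducible)
    show "zclosed (\<lambda>z. parallel_columns {..<n} ?P (A z) (B z))" by (rule zclosed_parallel_columns; rule pfA pfB)
    show "zclosed (\<lambda>z. parallel_columns ?P {..<n} (\<lambda>p i. A z i p) (\<lambda>p i. B z i p))" by (rule zclosed_parallel_columns; rule pfA pfB)
    fix z
    show "parallel_columns {..<n} ?P (A z) (B z) \<or> parallel_columns ?P {..<n} (\<lambda>p i. A z i p) (\<lambda>p i. B z i p)"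
    proof (rule parallel_columns_pair)
      show "parallel_columns {..<n} ?P (A z) (A z)"
        using R[of "\<lambda>i. z (Inl i)" "\<lambda>j k. z (Inr (Inl (j, k)))"] unfolding splits_first_def A_def X_def .
      show "parallel_columns {..<n} ?P (B z) (B z)"
        using R[of "\<lambda>i. z (Inl i)" "\<lambda>j k. z (Inr (Inr (j, k)))"] unfolding splits_first_def B_def Y_def .
      have "A z i p + B z i p
          = tensor_apply n m t (\<lambda>i j k. z (Inl i) * (z (Inr (Inl (j, k))) + z (Inr (Inr (j, k))))) i (fst p) (snd p)" for i p
        unfolding A_def B_def tensor_apply_add[symmetric] X_def Y_def by (simp add: distrib_left)
      then show "parallel_columns {..<n} ?P (\<lambda>i p. A z i p + B z i p) (\<lambda>i p. A z i p + B z i p)"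
        using R[of "\<lambda>i. z (Inl i)" "\<lambda>j k. z (Inr (Inl (j, k))) + z (Inr (Inr (j, k)))"]
        unfolding splits_first_def by simp
    qed
  qed
  have ex: "\<exists>z. A z = (\<lambda>i p. tensor_apply n m t (\<lambda>i j k. u i * \<rho> j k) i (fst p) (snd p)) \<and>
      B z = (\<lambda>i p. tensor_apply n m t (\<lambda>i j k. u i * \<rho>' j k) i (fst p) (snd p))" for u \<rho> \<rho>'
  proof -
    let ?z = "case_sum u (case_sum (\<lambda>(j, k). \<rho> j k) (\<lambda>(j, k). \<rho>' j k))"
    have XY: "X ?z = (\<lambda>i j k. u i * \<rho> j k)" "Y ?z = (\<lambda>i j k. u i * \<rho>' j k)"
      by (simp_all add: X_def Y_def fun_eq_iff)
    show ?thesis by (intro exI[of _ ?z] conjI ext) (simp_all only: A_def B_def XY)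
  qed
  from disj show ?thesis
  proof
    assume all: "\<forall>z. parallel_columns {..<n} ?P (A z) (B z)"
    have "parallel_columns {..<n} ?P
       (\<lambda>i p. tensor_apply n m t (\<lambda>i j k. u i * \<rho> j k) i (fst p) (snd p))
       (\<lambda>i p. tensor_apply n m t (\<lambda>i j k. u i * \<rho>' j k) i (fst p) (snd p))" for u \<rho> \<rho>'
    proof -
      obtain z where z: "A z = (\<lambda>i p. tensor_apply n m t (\<lambda>i j k. u i * \<rho> j k) i (fst p) (snd p)) \<and>
        B z = (\<lambda>i p. tensor_apply n m t (\<lambda>i j k. u i * \<rho>' j k) i (fst p) (snd p))" using ex[of u \<rho> \<rho>'] by (elim exE)
      show ?thesis using all[rule_format, of z] unfolding conjunct1[OF z] conjunct2[OF z] .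
    qed
    then show ?thesis unfolding first_to_first_def by blast
  next
    assume all: "\<forall>z. parallel_columns ?P {..<n} (\<lambda>p i. A z i p) (\<lambda>p i. B z i p)"
    have rows: "parallel_columns ?P {..<n}
       (\<lambda>p i. tensor_apply n m t (\<lambda>i j k. u i * \<rho> j k) i (fst p) (snd p))
       (\<lambda>p i. tensor_apply n m t (\<lambda>i j k. u i * \<rho>' j k) i (fst p) (snd p))" for u \<rho> \<rho>'
    proof -
      obtain z where z: "A z = (\<lambda>i p. tensor_apply n m t (\<lambda>i j k. u i * \<rho> j k) i (fst p) (snd p)) \<and>
        B z = (\<lambda>i p. tensor_apply n m t (\<lambda>i j k. u i * \<rho>' j k) i (fst p) (snd p))" using ex[of u \<rho> \<rho>'] by (elim exE)
      show ?thesis using all[rule_format, of z] unfolding conjunct1[OF z] conjunct2[OF z] .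
    qed
    show ?thesis
    proof (cases "m = 1")
      case True
      \<comment> \<open>With a single slot the remaining factor is just the column factor, and
        swapping the output indices makes it the first one.\<close>
      have "first_to_first n m (tswap t)"
        unfolding first_to_first_def tensor_apply_swap
      proof (intro allI)
        fix u \<rho> \<rho>'
        show "parallel_columns {..<n} ?P (\<lambda>i p. tensor_apply n m t (\<lambda>i j k. u i * \<rho> j k) (fst p) i (snd p))
           (\<lambda>i p. tensor_apply n m t (\<lambda>i j k. u i * \<rho>' j k) (fst p) i (snd p))"
          unfolding parallel_columns_def
        proof (intro ballI)
          fix i i' p p' assume *: "i \<in> {..<n}" "i' \<in> {..<n}" "p \<in> ?P" "p' \<in> ?P"
          then have 0: "snd p = 0" "snd p' = 0" using True by auto
          have "(i, 0) \<in> ?P" "(i', 0) \<in> ?P" "fst p \<in> {..<n}" "fst p' \<in> {..<n}" using * True by auto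
          from parallel_columnsD[OF rows[of u \<rho> \<rho>'] this]
          show "tensor_apply n m t (\<lambda>i j k. u i * \<rho> j k) (fst p) i (snd p) * tensor_apply n m t (\<lambda>i j k. u i * \<rho>' j k) (fst p') i' (snd p')
            = tensor_apply n m t (\<lambda>i j k. u i * \<rho> j k) (fst p) i' (snd p) * tensor_apply n m t (\<lambda>i j k. u i * \<rho>' j k) (fst p') i (snd p')"
            by (simp add: 0)
        qed
      qed
      then show ?thesis by blast
    next
      case False
      let ?e = "\<lambda>r i j k. kron 0 i * (kron (fst r) j * kron (snd r) k)"
      have par_e: "parallel_columns ?P {..<n} (\<lambda>p i. tensor_apply n m t (?e r) i (fst p) (snd p)) (\<lambda>p i. tensor_apply n m t (?e r') i (fst p) (snd p))" for r r'
        using rows[of "kron 0" "\<lambda>j k. kron (fst r) j * kron (snd r) k" "\<lambda>j k. kron (fst r') j * kron (snd r') k"] .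
      have "\<exists>f w. \<forall>r\<in>?P. \<forall>p\<in>?P. \<forall>i\<in>{..<n}. tensor_apply n m t (?e r) i (fst p) (snd p) = f p * w r i"
        by (rule parallel_columns_common_factor) (rule par_e)
      then obtain f w where fw0: "\<forall>r\<in>?P. \<forall>p\<in>?P. \<forall>i\<in>{..<n}. tensor_apply n m t (?e r) i (fst p) (snd p) = f p * w r i"
        by (elim exE)
      have fw: "tensor_apply n m t (?e r) i j k = f (j, k) * w r i" if "r \<in> ?P" "i < n" "j < n" "k < m" for r i j k
        using bspec[OF bspec[OF bspec[OF fw0 that(1)], of "(j, k)"], of i] that by simp
      have et: "tensor_apply n m t (?e r) i j k = t i j k 0 (fst r) (snd r)" if "r \<in> ?P" for r i j k
        using tensor_apply_basis[of 0 n "fst r" "snd r" m] that n2 by auto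
      have "card ?P > n" using False m1 n2 by (simp add: card_cartesian_product)
      \<comment> \<open>A relation among the vectors \<open>w r\<close>; the corresponding
        combination of basis tensors is nonzero and is mapped to zero.\<close>
      then obtain \<rho> where \<rho>: "\<exists>p\<in>?P. \<rho> p \<noteq> 0" "\<forall>i<n. (\<Sum>p\<in>?P. w p i * \<rho> p) = 0"
        using rank_dependent[of ?P n w] by auto
      define x where "x i j k = kron 0 i * \<rho> (j, k)" for i j k
      have "tensor_apply n m t x i j k = 0" if ijk: "i < n" "j < n" "k < m" for i j k
      proof -
        have "tensor_apply n m t x i j k = (\<Sum>i'<n. (\<Sum>j'<n. \<Sum>k'<m. t i j k i' j' k' * \<rho> (j', k')) * kron 0 i')"
          unfolding tensor_apply_def x_def sum_distrib_right by (intro sum.cong refl) (simp only: ac_simps)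
        also have "\<dots> = (\<Sum>j'<n. \<Sum>k'<m. t i j k 0 j' k' * \<rho> (j', k'))"
          using n2 by (subst sum_kron) auto
        also have "\<dots> = (\<Sum>r\<in>?P. t i j k 0 (fst r) (snd r) * \<rho> r)"
          by (simp add: sum.cartesian_product case_prod_beta)
        also have "\<dots> = (\<Sum>r\<in>?P. f (j, k) * (w r i * \<rho> r))"
          using fw[OF _ ijk] et by (intro sum.cong refl) (simp add: mult.assoc)
        also have "\<dots> = 0" using \<rho>(2) ijk by (simp flip: sum_distrib_left)
        finally show ?thesis .
      qed
      then have "x 0 (fst p) (snd p) = 0" if "p \<in> ?P" for p
        using inj[of x 0 "fst p" "snd p"] that n2 by auto
      then show ?thesis using \<rho>(1) unfolding x_def by auto
    qed
  qed
qed

end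

lemma tensor_preserver_first_to_first:
  assumes t: "tensor_preserver n m t"
  shows "first_to_first n m t \<or> first_to_first n m (tswap t)"
  using tensor_preserver.splits_first_or_second[OF t]
proof
  assume "\<forall>u \<rho>. splits_first n m (tensor_apply n m t (\<lambda>i j k. u i * \<rho> j k))"
  then show ?thesis using tensor_preserver.first_to_first_of_splits[OF t] by blast
next
  assume "\<forall>u \<rho>. splits_second n m (tensor_apply n m t (\<lambda>i j k. u i * \<rho> j k))"
  then have "splits_first n m (tensor_apply n m (tswap t) (\<lambda>i j k. u i * \<rho> j k))" for u \<rho>
    unfolding tensor_apply_swap splits_second_def by blast
  from tensor_preserver.first_to_first_of_splits[OF tensor_preserver_tswap[OF t] this]
  show ?thesis by auto
qed

lemma inverse_of_injective:
  fixes q :: "nat \<Rightarrow> nat \<Rightarrow> complex"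
  assumes "\<And>v a. (\<And>i. i < n \<Longrightarrow> (\<Sum>a<n. q i a * v a) = 0) \<Longrightarrow> a < n \<Longrightarrow> v a = 0"
  shows "\<exists>Q'. Q' \<in> carrier_mat n n \<and> Q' * mat n n (\<lambda>(i, j). q i j) = 1\<^sub>m n \<and>
    mat n n (\<lambda>(i, j). q i j) * Q' = 1\<^sub>m n"
proof -
  let ?Q = "mat n n (\<lambda>(i, j). q i j)"
  have cQ: "?Q \<in> carrier_mat n n" by simp
  have "det ?Q \<noteq> 0"
  proof
    assume "det ?Q = 0"
    then obtain v where v: "v \<in> carrier_vec n" "v \<noteq> 0\<^sub>v n" "?Q *\<^sub>v v = 0\<^sub>v n"
      using det_0_iff_vec_prod_zero[OF cQ] by blast
    have "(\<Sum>a<n. q i a * v $ a) = 0" if "i < n" for i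
    proof -
      have "(\<Sum>a<n. q i a * v $ a) = (?Q *\<^sub>v v) $ i"
        using that by (subst mult_mat_vec_index[OF cQ v(1) that]) (intro sum.cong; simp)
      then show ?thesis using v(3) that by simp
    qed
    then have "v $ a = 0" if "a < n" for a using assms[of "\<lambda>a. v $ a" a] that by blast
    then show False using v(1,2) by auto
  qed
  then show ?thesis
    using det_non_zero_imp_unit[OF cQ, of "()"] unfolding Units_def ring_mat_def by auto
qed

context tensor_preserver
begin

lemma first_to_first_factor:
  assumes c1: "first_to_first n m t"
  shows "\<exists>q s. \<forall>i<n. \<forall>a<n. \<forall>j<n. \<forall>k<m. \<forall>b<n. \<forall>c<m. t i j k a b c = q i a * s (j, k) (b, c)"
proof -
  let ?P = "{..<n} \<times> {..<m}"
  define t1 where "t1 i p a p' = t i (fst p) (snd p) a (fst p') (snd p')" for i p a p'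
  have at: "tensor_apply n m t (\<lambda>i j k. kron a i * (kron (fst p') j * kron (snd p') k)) i (fst p) (snd p) = t1 i p a p'"
    if "a < n" "p' \<in> ?P" for a p' i p
    unfolding t1_def using tensor_apply_basis[OF that(1), of "fst p'" "snd p'"] that(2) by auto
  have "\<exists>q s. \<forall>i<n. \<forall>a<n. \<forall>p\<in>?P. \<forall>p'\<in>?P. t1 i p a p' = q i a * s p p'"
  proof (rule factor_coefficients[OF n2])
    fix a assume a: "a < n"
    have "\<exists>f w. \<forall>p'\<in>?P. \<forall>i\<in>{..<n}. \<forall>p\<in>?P.
        tensor_apply n m t (\<lambda>i j k. kron a i * (kron (fst p') j * kron (snd p') k)) i (fst p) (snd p) = f i * w p' p"
      by (rule parallel_columns_common_factor) (rule c1[unfolded first_to_first_def, rule_format])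
    then obtain f w where "\<forall>p'\<in>?P. \<forall>i\<in>{..<n}. \<forall>p\<in>?P.
        tensor_apply n m t (\<lambda>i j k. kron a i * (kron (fst p') j * kron (snd p') k)) i (fst p) (snd p) = f i * w p' p"
      by (elim exE)
    note fw = this
    have "\<forall>p'\<in>?P. \<forall>i\<in>{..<n}. \<forall>p\<in>?P. t1 i p a p' = f i * w p' p"
    proof (intro ballI)
      fix p' i p assume *: "p' \<in> ?P" "i \<in> {..<n}" "p \<in> ?P"
      show "t1 i p a p' = f i * w p' p"
        using bspec[OF bspec[OF bspec[OF fw *(1)] *(2)] *(3)] unfolding at[OF a *(1)] .
    qed
    then show "\<exists>f w. \<forall>p'\<in>?P. \<forall>i\<in>{..<n}. \<forall>p\<in>?P. t1 i p a p' = f i * w p' p"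
      by blast
  next
    fix a assume a: "a < n" "a \<noteq> 0"
    let ?x = "\<lambda>p' i j k. (kron 0 i + kron a i) * (kron (fst p') j * kron (snd p') k)"
    have "\<exists>f w. \<forall>p'\<in>?P. \<forall>i\<in>{..<n}. \<forall>p\<in>?P. tensor_apply n m t (?x p') i (fst p) (snd p) = f i * w p' p"
      by (rule parallel_columns_common_factor) (rule c1[unfolded first_to_first_def, rule_format])
    then obtain f w where "\<forall>p'\<in>?P. \<forall>i\<in>{..<n}. \<forall>p\<in>?P. tensor_apply n m t (?x p') i (fst p) (snd p) = f i * w p' p"
      by (elim exE)
    note fw = this
    have eq: "tensor_apply n m t (?x p') i (fst p) (snd p) = t1 i p 0 p' + t1 i p a p'" if "p' \<in> ?P" for p' i p
      using at[OF _ that, of 0 i p] at[OF _ that, of a i p] a n2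
        tensor_apply_add[of n m t "\<lambda>i j k. kron 0 i * (kron (fst p') j * kron (snd p') k)"
          "\<lambda>i j k. kron a i * (kron (fst p') j * kron (snd p') k)"]
      by (simp add: distrib_right)
    have "\<forall>p'\<in>?P. \<forall>i\<in>{..<n}. \<forall>p\<in>?P. t1 i p 0 p' + t1 i p a p' = f i * w p' p"
    proof (intro ballI)
      fix p' i p assume *: "p' \<in> ?P" "i \<in> {..<n}" "p \<in> ?P"
      show "t1 i p 0 p' + t1 i p a p' = f i * w p' p"
        using bspec[OF bspec[OF bspec[OF fw *(1)] *(2)] *(3)] unfolding eq[OF *(1)] .
    qed
    then show "\<exists>f w. \<forall>p'\<in>?P. \<forall>i\<in>{..<n}. \<forall>p\<in>?P. t1 i p 0 p' + t1 i p a p' = f i * w p' p"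
      by blast
  next
    fix a f w w'
    assume a: "a < n" "a \<noteq> 0" and w: "\<forall>p'\<in>?P. \<forall>i\<in>{..<n}. \<forall>p\<in>?P. t1 i p 0 p' = f i * w p' p"
      and w': "\<forall>p'\<in>?P. \<forall>i\<in>{..<n}. \<forall>p\<in>?P. t1 i p a p' = f i * w' p' p"
    \<comment> \<open>If both images had the same row factor, the image of this tensor would split
      although the tensor itself does not.\<close>
    let ?x = "\<lambda>i j k. kron 0 i * (kron 0 j * kron 0 k) + kron a i * (kron 1 j * kron 0 k)"
    have P01: "(0, 0) \<in> ?P" "(1, 0) \<in> ?P" using n2 m1 by auto
    have "tensor_apply n m t ?x i j k = f i * (w (0, 0) (j, k) + w' (1, 0) (j, k))"
      if "i < n" "j < n" "k < m" for i j k
    proof -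
      have "tensor_apply n m t ?x i j k = t1 i (j, k) 0 (0, 0) + t1 i (j, k) a (1, 0)"
        using at[OF _ P01(1), of 0 i "(j, k)"] at[OF a(1) P01(2), of i "(j, k)"] n2
        by (simp add: tensor_apply_add)
      then show ?thesis using w w' P01 that by (simp add: distrib_left)
    qed
    then have "splits_first n m (tensor_apply n m t ?x)" by (rule splits_firstI)
    then show False using reflect[of ?x] not_rank_one[of 0 n a 0 1 m] a n2 m1 by auto
  qed
  then obtain q s where "\<forall>i<n. \<forall>a<n. \<forall>p\<in>?P. \<forall>p'\<in>?P. t1 i p a p' = q i a * s p p'" by (elim exE)
  then show ?thesis unfolding t1_def by (intro exI[of _ q] exI[of _ s]) auto
qed

text \<open>The row factor is already separated. A tensor with column factor \<open>w\<close> and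
  two slots is mapped to a splitting tensor; splitting in the first index would contradict
  injectivity, so the images \<open>sw w c\<close> share their column factor over all slots
  \<open>c\<close>, and \<open>factor_coefficients\<close> applies again.\<close>

theorem first_to_first_product:
  assumes c1: "first_to_first n m t"
  shows "\<exists>q p r. \<forall>i<n. \<forall>a<n. \<forall>j<n. \<forall>k<m. \<forall>b<n. \<forall>c<m. t i j k a b c = q i a * (p j b * r k c)"
proof -
  obtain q s where t: "\<forall>i<n. \<forall>a<n. \<forall>j<n. \<forall>k<m. \<forall>b<n. \<forall>c<m. t i j k a b c = q i a * s (j, k) (b, c)"
    using first_to_first_factor[OF c1] by (elim exE)
  have aps: "tensor_apply n m t (\<lambda>i j k. u i * \<rho> j k) i j k
      = (\<Sum>a<n. q i a * u a) * (\<Sum>b<n. \<Sum>c<m. s (j, k) (b, c) * \<rho> b c)"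
    if "i < n" "j < n" "k < m" for u \<rho> i j k
  proof -
    have "tensor_apply n m t (\<lambda>i j k. u i * \<rho> j k) i j k
      = (\<Sum>a<n. \<Sum>b<n. \<Sum>c<m. (q i a * u a) * (s (j, k) (b, c) * \<rho> b c))"
      unfolding tensor_apply_def using t that by (intro sum.cong refl) simp
    then show ?thesis by (simp only: sum_distrib_left[symmetric] sum_distrib_right[symmetric])
  qed
  \<comment> \<open>The image under \<open>s\<close> of the vector \<open>w\<close> put into slot
    \<open>c\<close>.\<close>
  define sw where "sw w c j k = (\<Sum>b<n. s (j, k) (b, c) * w b)" for w :: "nat \<Rightarrow> complex" and c j k
  have apsw: "tensor_apply n m t (\<lambda>i j k. u i * (w j * kron c k)) i j k = (\<Sum>a<n. q i a * u a) * sw w c j k"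
    if "i < n" "j < n" "k < m" "c < m" for u w c i j k
  proof -
    have "(\<Sum>b<n. \<Sum>c'<m. s (j, k) (b, c') * (w b * kron c c')) = sw w c j k"
      unfolding sw_def
    proof (intro sum.cong refl)
      fix b
      show "(\<Sum>c'<m. s (j, k) (b, c') * (w b * kron c c')) = s (j, k) (b, c) * w b"
        using sum_kron[OF that(4), of "\<lambda>c'. s (j, k) (b, c') * w b"] by (simp add: mult.assoc)
    qed
    then show ?thesis using aps[OF that(1-3), of u "\<lambda>j k. w j * kron c k"] by simp
  qed
  have sw_inj: False
    if "c < m" "c' < m" "b0 < n" "w b0 \<noteq> 0" "c \<noteq> c'" "\<alpha> \<noteq> 0"
      and zero: "\<And>j k. j < n \<Longrightarrow> k < m \<Longrightarrow> \<alpha> * sw w c j k + \<beta> * sw w c' j k = 0" for w c c' b0 \<alpha> \<beta>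
  proof -
    let ?x = "\<lambda>i j k. (\<alpha> * kron 0 i) * (w j * kron c k) + (\<beta> * kron 0 i) * (w j * kron c' k)"
    have "tensor_apply n m t ?x i j k = 0" if "i < n" "j < n" "k < m" for i j k
    proof -
      have k0: "(\<Sum>a<n. q i a * (x * kron 0 a)) = x * q i 0" for x
      proof -
        have "(\<Sum>a<n. q i a * (x * kron 0 a)) = (\<Sum>a<n. (q i a * x) * kron 0 a)" by (simp only: mult.assoc)
        also have "\<dots> = q i 0 * x" using n2 by (intro sum_kron) simp
        finally show ?thesis by (simp only: mult.commute)
      qed
      have "tensor_apply n m t ?x i j k = q i 0 * (\<alpha> * sw w c j k + \<beta> * sw w c' j k)"
        unfolding tensor_apply_add apsw[OF that \<open>c < m\<close>] apsw[OF that \<open>c' < m\<close>] k0 by (simp add: algebra_simps)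
      then show ?thesis using zero that by simp
    qed
    then have "?x 0 b0 c = 0" using that n2 by (intro inj[of ?x 0 b0 c]) auto
    then show False using that by simp
  qed
  have "\<exists>Q'. Q' \<in> carrier_mat n n \<and> Q' * mat n n (\<lambda>(i, j). q i j) = 1\<^sub>m n \<and> mat n n (\<lambda>(i, j). q i j) * Q' = 1\<^sub>m n"
  proof (rule inverse_of_injective)
    fix v a assume v: "\<And>i. i < n \<Longrightarrow> (\<Sum>a<n. q i a * v a) = 0" and a: "a < n"
    let ?x = "\<lambda>i j k. v i * (kron 0 j * kron 0 k)"
    have "tensor_apply n m t ?x i j k = 0" if "i < n" "j < n" "k < m" for i j k
      using aps[OF that, of v "\<lambda>j k. kron 0 j * kron 0 k"] v[OF that(1)] by simp
    then have "?x a 0 0 = 0" using a n2 m1 by (intro inj[of ?x a 0 0]) auto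
    then show "v a = 0" by simp
  qed
  then obtain Q' where Q': "Q' \<in> carrier_mat n n" "Q' * mat n n (\<lambda>(i, j). q i j) = 1\<^sub>m n" by blast
  define q' where "q' a i = Q' $$ (a, i)" for a i
  have q'q: "(\<Sum>i<n. q' a i * q i b) = (if a = b then 1 else 0)" if "a < n" "b < n" for a b
  proof -
    have "(\<Sum>i<n. q' a i * q i b) = (Q' * mat n n (\<lambda>(i, j). q i j)) $$ (a, b)"
      using that Q'(1) by (auto simp: scalar_prod_def q'_def lessThan_atLeast0 intro!: sum.cong)
    then show ?thesis using Q'(2) that by simp
  qed
  \<comment> \<open>Contraction with two rows of the inverse of \<open>q\<close> extracts single
    products from the quadratic identities satisfied by the image.\<close>
  have ext: "(\<Sum>i<n. \<Sum>i'<n. q' a i * q' b i' * ((q i 0 * A + q i 1 * B) * (q i' 0 * C + q i' 1 * D)))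
      = (if a = 0 then A else B) * (if b = 0 then C else D)" if "a < 2" "b < 2" for a b :: nat and A B C D
  proof -
    have e1: "(\<Sum>i<n. q' a i * (q i 0 * A + q i 1 * B)) = (if a = 0 then A else B)" if "a < 2" for a :: nat and A B
    proof -
      have "(\<Sum>i<n. q' a i * (q i 0 * A + q i 1 * B)) = (\<Sum>i<n. q' a i * q i 0) * A + (\<Sum>i<n. q' a i * q i 1) * B"
        unfolding sum_distrib_right sum.distrib[symmetric]
        by (intro sum.cong refl) (simp only: distrib_left mult.assoc)
      then show ?thesis using q'q[of a 0] q'q[of a 1] that n2 by auto
    qed
    have "(\<Sum>i<n. \<Sum>i'<n. q' a i * q' b i' * ((q i 0 * A + q i 1 * B) * (q i' 0 * C + q i' 1 * D)))
      = (\<Sum>i<n. q' a i * (q i 0 * A + q i 1 * B)) * (\<Sum>i'<n. q' b i' * (q i' 0 * C + q i' 1 * D))"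
      unfolding sum_product by (intro sum.cong refl) (simp only: ac_simps)
    then show ?thesis using e1 that by simp
  qed
  have ext0: "(\<Sum>i<n. \<Sum>i'<n. q' 0 i * q' 0 i' * ((q i 0 * A + q i 1 * B) * (q i' 0 * C + q i' 1 * D))) = A * C"
    and ext1: "(\<Sum>i<n. \<Sum>i'<n. q' 0 i * q' 1 i' * ((q i 0 * A + q i 1 * B) * (q i' 0 * C + q i' 1 * D))) = A * D"
    for A B C D
    using ext[of 0 0 A B C D] ext[of 0 1 A B C D] by simp_all
  have par_distinct: "parallel_columns {..<n} {..<m} (sw w c) (sw w c) \<and> parallel_columns {..<n} {..<m} (sw w c) (sw w c')"
    if cc: "c < m" "c' < m" "c \<noteq> c'" and w: "b0 < n" "w b0 \<noteq> 0" for w c c' b0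
  proof -
    let ?x = "\<lambda>i j k. kron 0 i * (w j * kron c k) + kron 1 i * (w j * kron c' k)"
    define y where "y i j k = q i 0 * sw w c j k + q i 1 * sw w c' j k" for i j k
    have apy: "tensor_apply n m t ?x i j k = y i j k" if "i < n" "j < n" "k < m" for i j k
      unfolding tensor_apply_add apsw[OF that cc(1)] apsw[OF that cc(2)] y_def using n2 by simp
    have "splits_second n m ?x" by (rule splits_secondI[of _ _ _ w "\<lambda>i k. kron 0 i * kron c k + kron 1 i * kron c' k"]) (simp add: algebra_simps)
    then have "splits_first n m (tensor_apply n m t ?x) \<or> splits_second n m (tensor_apply n m t ?x)" using pres by blast
    then show ?thesis
    proof
      \<comment> \<open>Here \<open>sw w c\<close> and \<open>sw w c'\<close> would be proportional,
        and a nonzero tensor would be mapped to zero.\<close>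
      assume R: "splits_first n m (tensor_apply n m t ?x)"
      have par: "sw w c j k * sw w c' j' k' = sw w c' j k * sw w c j' k'"
        if *: "j < n" "j' < n" "k < m" "k' < m" for j j' k k'
      proof -
        have "(\<Sum>i<n. \<Sum>i'<n. q' 0 i * q' 1 i' * (y i j k * y i' j' k')) = (\<Sum>i<n. \<Sum>i'<n. q' 0 i * q' 1 i' * (y i' j k * y i j' k'))"
          using splits_firstD[OF R] * apy by (intro sum.cong refl) simp
        also have "\<dots> = (\<Sum>i<n. \<Sum>i'<n. q' 0 i * q' 1 i' * (y i j' k' * y i' j k))"
          by (intro sum.cong refl) (simp only: ac_simps)
        finally show ?thesis unfolding y_def ext1 by (simp add: mult.commute)
      qed
      show ?thesis
      proof (cases "\<exists>j<n. \<exists>k<m. sw w c j k \<noteq> 0")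
        case True
        then obtain j0 k0 where j0: "j0 < n" "k0 < m" "sw w c j0 k0 \<noteq> 0" by blast
        have "sw w c j0 k0 * sw w c' j k + (- sw w c' j0 k0) * sw w c j k = 0" if "j < n" "k < m" for j k
          using par[OF j0(1) that(1) j0(2) that(2)] by simp
        then have False using cc w j0(3) by (intro sw_inj[of c' c b0 w "sw w c j0 k0" "- sw w c' j0 k0"]) auto
        then show ?thesis ..
      next
        case False
        then have False using cc w by (intro sw_inj[of c c' b0 w 1 0]) auto
        then show ?thesis ..
      qed
    next
      assume R: "splits_second n m (tensor_apply n m t ?x)"
      have key: "(\<Sum>i<n. \<Sum>i'<n. q' 0 i * q' b i' * (y i j k * y i' j' k')) = (\<Sum>i<n. \<Sum>i'<n. q' 0 i * q' b i' * (y i j' k * y i' j k'))"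
        if *: "j < n" "j' < n" "k < m" "k' < m" for b j j' k k'
        using splits_secondD[OF R] * apy by (intro sum.cong refl) simp
      have "sw w c j k * sw w c j' k' = sw w c j' k * sw w c j k' \<and> sw w c j k * sw w c' j' k' = sw w c j' k * sw w c' j k'"
        if *: "j < n" "j' < n" "k < m" "k' < m" for j j' k k'
        using key[OF *, of 0] key[OF *, of 1] unfolding y_def ext0 ext1 by blast
      then show ?thesis unfolding parallel_columns_def by blast
    qed
  qed
  have par_sw: "parallel_columns {..<n} {..<m} (sw w c) (sw w c')" if cc: "c < m" "c' < m" and w: "b0 < n" "w b0 \<noteq> 0" for w c c' b0
  proof (cases "c = c'")
    case False then show ?thesis using par_distinct[of c c' b0 w] cc w by blast
  next
    case True
    show ?thesis
    proof (cases "m = 1")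
      case m: True
      show ?thesis unfolding True parallel_columns_def m by (auto simp: mult.commute)
    next
      case False
      \<comment> \<open>For equal slots a different slot \<open>d\<close> yields the rank one
        statement about \<open>sw w c\<close> itself.\<close>
      then have "\<exists>d<m. c \<noteq> d" using m1 by (intro exI[of _ "if c = 0 then 1 else 0"]) auto
      then obtain d where "d < m" "c \<noteq> d" by blast
      then show ?thesis using par_distinct[of c d b0 w] cc w True by blast
    qed
  qed
  have swkd: "sw (kron a) c j k = s (j, k) (a, c)" if "a < n" for a c j k
    unfolding sw_def using that by simp
  have "\<exists>p r. \<forall>j<n. \<forall>b<n. \<forall>k\<in>{..<m}. \<forall>c\<in>{..<m}. s (j, k) (b, c) = p j b * r k c"
  proof (rule factor_coefficients[OF n2])
    fix a assume a: "a < n"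
    have "\<exists>f w. \<forall>c\<in>{..<m}. \<forall>j\<in>{..<n}. \<forall>k\<in>{..<m}. sw (kron a) c j k = f j * w c k"
      by (rule parallel_columns_common_factor) (rule par_sw[of _ _ a], use a in auto)
    then show "\<exists>f w. \<forall>c\<in>{..<m}. \<forall>j\<in>{..<n}. \<forall>k\<in>{..<m}. s (j, k) (a, c) = f j * w c k"
      unfolding swkd[OF a] .
  next
    fix a assume a: "a < n" "a \<noteq> 0"
    let ?w = "\<lambda>b. kron 0 b + kron a b"
    have "\<exists>f w. \<forall>c\<in>{..<m}. \<forall>j\<in>{..<n}. \<forall>k\<in>{..<m}. sw ?w c j k = f j * w c k"
      by (rule parallel_columns_common_factor) (rule par_sw[of _ _ a], use a in auto)
    moreover have "sw ?w c j k = s (j, k) (0, c) + s (j, k) (a, c)" for c j k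
      using swkd[of 0 c j k] swkd[of a c j k] a n2 unfolding sw_def by (simp add: distrib_left sum.distrib)
    ultimately show "\<exists>f w. \<forall>c\<in>{..<m}. \<forall>j\<in>{..<n}. \<forall>k\<in>{..<m}. s (j, k) (0, c) + s (j, k) (a, c) = f j * w c k"
      by simp
  next
    fix a f w w'
    assume a: "a < n" "a \<noteq> 0" and w: "\<forall>c\<in>{..<m}. \<forall>j\<in>{..<n}. \<forall>k\<in>{..<m}. s (j, k) (0, c) = f j * w c k"
      and w': "\<forall>c\<in>{..<m}. \<forall>j\<in>{..<n}. \<forall>k\<in>{..<m}. s (j, k) (a, c) = f j * w' c k"
    \<comment> \<open>A common column factor would make the image of this tensor split in the second
      index, while the tensor splits in neither.\<close>
    let ?x = "\<lambda>i j k. kron 0 i * (kron 0 j * kron 0 k) + kron 1 i * (kron a j * kron 0 k)"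
    have "tensor_apply n m t ?x i j k = f j * (q i 0 * w 0 k + q i 1 * w' 0 k)" if "i < n" "j < n" "k < m" for i j k
    proof -
      have "tensor_apply n m t ?x i j k = q i 0 * s (j, k) (0, 0) + q i 1 * s (j, k) (a, 0)"
        unfolding tensor_apply_add using t that a n2 m1 by (simp add: tensor_apply_basis)
      then show ?thesis using w w' that m1 by (simp add: algebra_simps)
    qed
    then have "splits_second n m (tensor_apply n m t ?x)" by (rule splits_secondI)
    then show False using reflect[of ?x] not_rank_one[of 0 n 1 0 a m] a n2 m1 by auto
  qed
  then obtain p r where pr: "\<forall>j<n. \<forall>b<n. \<forall>k\<in>{..<m}. \<forall>c\<in>{..<m}. s (j, k) (b, c) = p j b * r k c" by (elim exE)
  have "\<forall>i<n. \<forall>a<n. \<forall>j<n. \<forall>k<m. \<forall>b<n. \<forall>c<m. t i j k a b c = q i a * (p j b * r k c)"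
    using t pr by simp
  then show ?thesis by (intro exI)
qed

end

section \<open>Linear preservers of singular pencils\<close>

lemma mult_mat_index:
  fixes A B :: "'r::comm_ring_1 mat"
  assumes "A \<in> carrier_mat n k" "B \<in> carrier_mat k r" "i < n" "j < r"
  shows "(A * B) $$ (i, j) = (\<Sum>l<k. A $$ (i, l) * B $$ (l, j))"
  using assms by (auto simp: scalar_prod_def lessThan_atLeast0 intro!: sum.cong)

lemma det_zero_row:
  fixes A :: "complex mat"
  assumes A: "A \<in> carrier_mat n n" and a: "a < n" and z: "\<And>j. j < n \<Longrightarrow> A $$ (a, j) = 0"
  shows "det A = 0"
proof -
  have cT: "A\<^sup>T \<in> carrier_mat n n" using A by simp
  have "A\<^sup>T *\<^sub>v unit_vec n a = 0\<^sub>v n"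
    by (rule eq_vecI) (use A a z in auto)
  moreover have "unit_vec n a \<noteq> (0\<^sub>v n :: complex vec)" using a by (simp add: unit_vec_nonzero)
  ultimately have "det A\<^sup>T = 0"
    using det_0_iff_vec_prod_zero[OF cT] unit_vec_carrier by blast
  then show ?thesis using det_transpose[OF A] by simp
qed

text \<open>det (A + t B) is affine in t when B has rank at most one, so zeros at 0 and 1 give a
  zero at 2. In the proof B = u w^T and y is a left kernel vector of A. If y is orthogonal to u, it
  stays a left kernel vector; otherwise a kernel vector of A + B is orthogonal to w, hence killed by
  both A and B.\<close>

lemma det_zero_rank_one:
  fixes A B :: "complex mat"
  assumes A: "A \<in> carrier_mat n n" "det A = 0" and B: "B \<in> carrier_mat n n"
    and AB: "det (A + B) = 0"
    and min: "parallel_columns {..<n} {..<n} (\<lambda>i j. B $$ (i, j)) (\<lambda>i j. B $$ (i, j))"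
  shows "det (A + B + B) = 0"
proof -
  obtain u w where uw: "\<forall>i\<in>{..<n}. \<forall>j\<in>{..<n}. B $$ (i, j) = u i * w j" using parallel_columns_rank_one[OF min] by (elim exE)
  have cAB: "A + B \<in> carrier_mat n n" "A + B + B \<in> carrier_mat n n" "A\<^sup>T \<in> carrier_mat n n" "(A + B + B)\<^sup>T \<in> carrier_mat n n"
    using A B by auto
  define W where "W v = (\<Sum>j<n. w j * v $ j)" for v
  define U where "U v = (\<Sum>i<n. u i * v $ i)" for v
  have Av: "((A + B) *\<^sub>v v) $ i = (A *\<^sub>v v) $ i + u i * W v"
    "((A + B + B) *\<^sub>v v) $ i = (A *\<^sub>v v) $ i + u i * W v + u i * W v"
    if "v \<in> carrier_vec n" "i < n" for v i
  proof -
    have Bv: "(B *\<^sub>v v) $ i = u i * W v"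
      using mult_mat_vec_index[OF B that] uw that unfolding W_def
      by (simp add: sum_distrib_left mult.assoc)
    show "((A + B) *\<^sub>v v) $ i = (A *\<^sub>v v) $ i + u i * W v"
      "((A + B + B) *\<^sub>v v) $ i = (A *\<^sub>v v) $ i + u i * W v + u i * W v"
      using that A B Bv cAB(1) by (simp_all add: add_mult_distrib_mat_vec[of _ n n])
  qed
  have ATv: "((A + B + B)\<^sup>T *\<^sub>v v) $ j = (A\<^sup>T *\<^sub>v v) $ j + w j * U v + w j * U v"
    if "v \<in> carrier_vec n" "j < n" for v j
  proof -
    have Bv: "(B\<^sup>T *\<^sub>v v) $ j = w j * U v"
    proof -
      have "(B\<^sup>T *\<^sub>v v) $ j = (\<Sum>i<n. B\<^sup>T $$ (j, i) * v $ i)"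
        using B that by (intro mult_mat_vec_index[of _ n]) auto
      also have "\<dots> = (\<Sum>i<n. w j * (u i * v $ i))"
        using uw that B by (intro sum.cong) auto
      finally show ?thesis unfolding U_def sum_distrib_left .
    qed
    have "(A + B + B)\<^sup>T = A\<^sup>T + B\<^sup>T + B\<^sup>T"
      using A B by (intro eq_matI) auto
    then show ?thesis using that A B Bv by (simp add: add_mult_distrib_mat_vec[of _ n n])
  qed
  obtain x where x: "x \<in> carrier_vec n" "x \<noteq> 0\<^sub>v n" "A *\<^sub>v x = 0\<^sub>v n"
    using det_0_iff_vec_prod_zero[OF A(1)] A(2) by blast
  obtain y where y: "y \<in> carrier_vec n" "y \<noteq> 0\<^sub>v n" "A\<^sup>T *\<^sub>v y = 0\<^sub>v n"
    using det_0_iff_vec_prod_zero[OF cAB(3)] A(2) det_transpose[OF A(1)] by auto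
  have ker: "det (A + B + B) = 0" if "z \<in> carrier_vec n" "z \<noteq> 0\<^sub>v n" "A *\<^sub>v z = 0\<^sub>v n" "W z = 0" for z
  proof -
    have "(A + B + B) *\<^sub>v z = 0\<^sub>v n"
      by (rule eq_vecI) (use that B in \<open>auto simp del: index_mult_mat_vec simp: Av(2)\<close>)
    then show ?thesis using det_0_iff_vec_prod_zero[OF cAB(2)] that by blast
  qed
  show ?thesis
  proof (cases "U y = 0")
    case True
    have "(A + B + B)\<^sup>T *\<^sub>v y = 0\<^sub>v n"
      by (rule eq_vecI) (use y B True in \<open>auto simp del: index_mult_mat_vec simp: ATv\<close>)
    then have "det (A + B + B)\<^sup>T = 0" using det_0_iff_vec_prod_zero[OF cAB(4)] y by blast
    then show ?thesis using det_transpose[OF cAB(2)] by simp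
  next
    case False
    obtain z where z: "z \<in> carrier_vec n" "z \<noteq> 0\<^sub>v n" "(A + B) *\<^sub>v z = 0\<^sub>v n"
      using det_0_iff_vec_prod_zero[OF cAB(1)] AB by blast
    have Az: "(A *\<^sub>v z) $ i = - u i * W z" if "i < n" for i
      using Av(1)[OF z(1) that] z(3) that by (simp add: eq_neg_iff_add_eq_0 del: index_mult_mat_vec)
    have "(\<Sum>i<n. y $ i * (A *\<^sub>v z) $ i) = (\<Sum>j<n. (A\<^sup>T *\<^sub>v y) $ j * z $ j)"
    proof -
      have "(\<Sum>i<n. y $ i * (A *\<^sub>v z) $ i) = (\<Sum>i<n. \<Sum>j<n. y $ i * (A $$ (i, j) * z $ j))"
        using mult_mat_vec_index[OF A(1) z(1)] by (intro sum.cong refl) (simp add: sum_distrib_left del: index_mult_mat_vec)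
      also have "\<dots> = (\<Sum>j<n. \<Sum>i<n. y $ i * (A $$ (i, j) * z $ j))" by (rule sum.swap)
      also have "\<dots> = (\<Sum>j<n. (A\<^sup>T *\<^sub>v y) $ j * z $ j)"
      proof (intro sum.cong refl)
        fix j assume j: "j \<in> {..<n}"
        have "(A\<^sup>T *\<^sub>v y) $ j = (\<Sum>i<n. A\<^sup>T $$ (j, i) * y $ i)"
          using mult_mat_vec_index[OF cAB(3) y(1)] j by simp
        also have "\<dots> = (\<Sum>i<n. A $$ (i, j) * y $ i)" using A j by (intro sum.cong) auto
        finally have e: "(A\<^sup>T *\<^sub>v y) $ j = (\<Sum>i<n. A $$ (i, j) * y $ i)" .
        show "(\<Sum>i<n. y $ i * (A $$ (i, j) * z $ j)) = (A\<^sup>T *\<^sub>v y) $ j * z $ j"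
          unfolding e sum_distrib_right by (intro sum.cong refl) (simp only: ac_simps)
      qed
      finally show ?thesis .
    qed
    also have "\<dots> = 0" using y(3) by simp
    finally have "(\<Sum>i<n. y $ i * (- u i * W z)) = 0" using Az by simp
    moreover have "(\<Sum>i<n. y $ i * (- u i * W z)) = - (W z) * U y"
      unfolding U_def sum_distrib_left by (intro sum.cong refl) simp
    ultimately have "W z = 0" using False by simp
    moreover then have "A *\<^sub>v z = 0\<^sub>v n"
      by (intro eq_vecI) (use Az A in \<open>auto simp del: index_mult_mat_vec\<close>)
    ultimately show ?thesis using ker z by blast
  qed
qed

section \<open>Rank one tensors characterised by singularity\<close>

definition tensor_of :: "(nat \<Rightarrow> complex mat) \<Rightarrow> tensor" where
  "tensor_of X i j k = entry X (k, i, j)"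

definition tuple_of_tensor :: "nat \<Rightarrow> nat \<Rightarrow> tensor \<Rightarrow> nat \<Rightarrow> complex mat" where
  "tuple_of_tensor n m x = tuple_of n m (\<lambda>(k, i, j). x i j k)"

lemma tuple_of_tensor_mem [simp]: "tuple_of_tensor n m x \<in> mat_tuples n m"
  by (simp add: tuple_of_tensor_def)

lemma tensor_of_tuple: "i < n \<Longrightarrow> j < n \<Longrightarrow> k < m \<Longrightarrow> tensor_of (tuple_of_tensor n m x) i j k = x i j k"
  unfolding tensor_of_def tuple_of_tensor_def by (subst entry_tuple_of) (auto simp: idx_def)

lemma pencil_at_index:
  "i < n \<Longrightarrow> j < n \<Longrightarrow> pencil_at n m X c $$ (i, j) = (\<Sum>k<m. c k * tensor_of X i j k)"
  unfolding pencil_at_def tensor_of_def entry_def by simp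

lemma pencil_at_carrier [simp]: "pencil_at n m X c \<in> carrier_mat n n"
  unfolding pencil_at_def by simp

lemma tensor_of_add:
  "X \<in> mat_tuples n m \<Longrightarrow> Y \<in> mat_tuples n m \<Longrightarrow> i < n \<Longrightarrow> j < n \<Longrightarrow> k < m \<Longrightarrow>
    tensor_of (tuple_add m X Y) i j k = tensor_of X i j k + tensor_of Y i j k"
  unfolding tensor_of_def by (rule entry_tuple_add[of _ n]) (auto simp: idx_def)

lemma pencil_at_add:
  assumes "X \<in> mat_tuples n m" "Y \<in> mat_tuples n m"
  shows "pencil_at n m (tuple_add m X Y) c = pencil_at n m X c + pencil_at n m Y c"
proof (rule eq_matI)
  fix i j assume "i < dim_row (pencil_at n m X c + pencil_at n m Y c)"
    "j < dim_col (pencil_at n m X c + pencil_at n m Y c)"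
  then have ij: "i < n" "j < n" by (auto simp: pencil_at_def)
  then show "pencil_at n m (tuple_add m X Y) c $$ (i, j) = (pencil_at n m X c + pencil_at n m Y c) $$ (i, j)"
    using tensor_of_add[OF assms ij] carrier_matD[OF pencil_at_carrier[of n m Y c]]
    by (simp add: pencil_at_index sum.distrib distrib_left)
qed (auto simp: pencil_at_def)

text \<open>This property of \<open>Y\<close> refers to \<open>SING\<close> and the linear structure only, so it is invariant under linear
  preservers; it turns out to single out the tuples that are rank one as tensors.\<close>

definition collapse :: "nat \<Rightarrow> nat \<Rightarrow> (nat \<Rightarrow> complex mat) \<Rightarrow> bool" where
  "collapse n m Y \<longleftrightarrow> (\<forall>Z\<in>SING n m. tuple_add m Z Y \<in> SING n m \<longrightarrow> tuple_add m (tuple_add m Z Y) Y \<in> SING n m)"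

lemma SING_sub: "X \<in> SING n m \<Longrightarrow> X \<in> mat_tuples n m"
  unfolding SING_def by blast

text \<open>Whichever factor splits off, the pencil of \<open>Y\<close> has rank at most one at each
  \<open>c\<close>, and \<open>det_zero_rank_one\<close> applies there.\<close>

lemma rank_one_collapse:
  assumes Y: "Y \<in> mat_tuples n m" and R: "splits_first n m (tensor_of Y) \<or> splits_second n m (tensor_of Y)"
  shows "collapse n m Y"
  unfolding collapse_def
proof (intro ballI impI)
  fix Z assume Z: "Z \<in> SING n m" and ZY: "tuple_add m Z Y \<in> SING n m"
  have ZV: "Z \<in> mat_tuples n m" "tuple_add m Z Y \<in> mat_tuples n m" using SING_sub Z ZY by blast+
  have V2: "tuple_add m (tuple_add m Z Y) Y \<in> mat_tuples n m" using tuple_add_mem[OF ZV(2) Y] .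
  have "det (pencil_at n m (tuple_add m (tuple_add m Z Y) Y) c) = 0" for c
  proof -
    let ?p = "\<lambda>X. pencil_at n m X c"
    have "parallel_columns {..<n} {..<n} (\<lambda>i j. ?p Y $$ (i, j)) (\<lambda>i j. ?p Y $$ (i, j))"
      unfolding parallel_columns_def
    proof (intro ballI)
      fix i i' j j' assume "i \<in> {..<n}" "i' \<in> {..<n}" "j \<in> {..<n}" "j' \<in> {..<n}"
      then have ij: "i < n" "i' < n" "j < n" "j' < n" by auto
      have exp: "?p Y $$ (a, b) * ?p Y $$ (a', b') = (\<Sum>k<m. \<Sum>k'<m. c k * c k' * (tensor_of Y a b k * tensor_of Y a' b' k'))"
        if "a < n" "b < n" "a' < n" "b' < n" for a b a' b'
        unfolding pencil_at_index[OF that(1,2)] pencil_at_index[OF that(3,4)] sum_product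
        by (intro sum.cong refl) (simp only: ac_simps)
      have "(\<Sum>k<m. \<Sum>k'<m. c k * c k' * (tensor_of Y i j k * tensor_of Y i' j' k'))
          = (\<Sum>k<m. \<Sum>k'<m. c k * c k' * (tensor_of Y i' j k * tensor_of Y i j' k'))"
        using R
      proof
        assume R: "splits_first n m (tensor_of Y)"
        show ?thesis using splits_firstD[OF R ij] by (intro sum.cong refl) simp
      next
        assume R: "splits_second n m (tensor_of Y)"
        have "(\<Sum>k<m. \<Sum>k'<m. c k * c k' * (tensor_of Y i j k * tensor_of Y i' j' k'))
          = (\<Sum>k<m. \<Sum>k'<m. c k * c k' * (tensor_of Y i j' k * tensor_of Y i' j k'))"
          using splits_secondD[OF R ij] by (intro sum.cong refl) simp
        also have "\<dots> = ?p Y $$ (i, j') * ?p Y $$ (i', j)" using exp ij by simp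
        also have "\<dots> = ?p Y $$ (i', j) * ?p Y $$ (i, j')" by simp
        also have "\<dots> = (\<Sum>k<m. \<Sum>k'<m. c k * c k' * (tensor_of Y i' j k * tensor_of Y i j' k'))" using exp ij by simp
        finally show ?thesis .
      qed
      then show "?p Y $$ (i, j) * ?p Y $$ (i', j') = ?p Y $$ (i', j) * ?p Y $$ (i, j')" using exp ij by simp
    qed
    moreover have "det (?p Z) = 0" "det (?p Z + ?p Y) = 0"
      using Z ZY SING_iff[OF ZV(1)] SING_iff[OF ZV(2)] pencil_at_add[OF ZV(1) Y] by auto
    ultimately have "det (?p Z + ?p Y + ?p Y) = 0"
      by (intro det_zero_rank_one[of _ n]) auto
    then show ?thesis using pencil_at_add[OF ZV(1) Y] pencil_at_add[OF ZV(2) Y] by simp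
  qed
  then show "tuple_add m (tuple_add m Z Y) Y \<in> SING n m" using SING_iff[OF V2] by blast
qed

text \<open>If two rows of \<open>Y\<close> are independent at \<open>c\<close>, choose \<open>Z\<close> so that \<open>Z\<close> and \<open>Z + Y\<close> each have a
  zero row while \<open>Z + 2 Y\<close> is invertible at \<open>c\<close>.\<close>

lemma collapse_minors:
  assumes Y: "Y \<in> mat_tuples n m" and C: "collapse n m Y"
  shows "parallel_columns {..<n} {..<n} (\<lambda>i j. pencil_at n m Y c $$ (i, j)) (\<lambda>i j. pencil_at n m Y c $$ (i, j))"
proof (rule ccontr)
  define y where "y i j = pencil_at n m Y c $$ (i, j)" for i j
  assume "\<not> ?thesis"
  then obtain a b p q where ab: "a < n" "b < n" "p < n" "q < n" "y a p * y b q \<noteq> y b p * y a q"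
    unfolding parallel_columns_def y_def by auto
  have neq: "a \<noteq> b" "p \<noteq> q" using ab(5) by (auto simp: mult.commute)
  have "\<exists>l<m. c l \<noteq> 0"
  proof (rule ccontr)
    assume "\<not> ?thesis"
    then have "y i j = 0" if "i < n" "j < n" for i j unfolding y_def using that by (simp add: pencil_at_index)
    then show False using ab by simp
  qed
  then obtain l where l: "l < m" "c l \<noteq> 0" by blast
  have "card ({..<n} - {a, b}) = card ({..<n} - {p, q})"
    using ab neq by (simp add: card_Diff_subset)
  then obtain h where h: "bij_betw h ({..<n} - {a, b}) ({..<n} - {p, q})"
    using finite_same_card_bij[of "{..<n} - {a, b}" "{..<n} - {p, q}"] by auto
  \<comment> \<open>Outside rows \<open>a\<close> and \<open>b\<close>, Z + 2 Y keeps only a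
    permutation pattern, placed in a slot \<open>l\<close> whose weight \<open>c l\<close> is
    nonzero. Its rows \<open>a\<close> and \<open>b\<close> are 2 Y and Y.\<close>
  define Z where "Z = tuple_of_tensor n m (\<lambda>i j k. if i = a then 0 else if i = b then - tensor_of Y i j k
    else - 2 * tensor_of Y i j k + (if k = l then kron (h i) j else 0))"
  have Z: "Z \<in> mat_tuples n m" unfolding Z_def by simp
  have Zt: "tensor_of Z i j k = (if i = a then 0 else if i = b then - tensor_of Y i j k
    else - 2 * tensor_of Y i j k + (if k = l then kron (h i) j else 0))" if "i < n" "j < n" "k < m" for i j k
    unfolding Z_def using tensor_of_tuple[OF that] by simp
  let ?Z1 = "tuple_add m Z Y" and ?Z2 = "tuple_add m (tuple_add m Z Y) Y"
  have V: "?Z1 \<in> mat_tuples n m" "?Z2 \<in> mat_tuples n m"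
    using tuple_add_mem[OF Z Y] tuple_add_mem[OF tuple_add_mem[OF Z Y] Y] by auto
  have "Z \<in> SING n m" unfolding SING_iff[OF Z]
  proof
    fix c' show "det (pencil_at n m Z c') = 0"
      by (rule det_zero_row[of _ n a]) (use ab in \<open>auto simp: pencil_at_index Zt\<close>)
  qed
  moreover have "?Z1 \<in> SING n m" unfolding SING_iff[OF V(1)]
  proof
    fix c' show "det (pencil_at n m ?Z1 c') = 0"
      by (rule det_zero_row[of _ n b]) (use ab neq in \<open>auto simp: pencil_at_index Zt tensor_of_add[OF Z Y]\<close>)
  qed
  ultimately have "?Z2 \<in> SING n m" using C unfolding collapse_def by blast
  then have "det (pencil_at n m ?Z2 c) = 0" using SING_iff[OF V(2)] by blast
  then obtain v where v: "v \<in> carrier_vec n" "v \<noteq> 0\<^sub>v n" "pencil_at n m ?Z2 c *\<^sub>v v = 0\<^sub>v n"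
    using det_0_iff_vec_prod_zero[OF pencil_at_carrier] by blast
  have Z2: "pencil_at n m ?Z2 c $$ (i, j) = (if i = a then 2 * y i j else if i = b then y i j else c l * kron (h i) j)"
    if "i < n" "j < n" for i j
  proof -
    have "c k * tensor_of ?Z2 i j k = (if i = a then 2 * (c k * tensor_of Y i j k) else if i = b then c k * tensor_of Y i j k
        else if k = l then c l * kron (h i) j else 0)" if "k < m" for k
      using tensor_of_add[OF V(1) Y \<open>i < n\<close> \<open>j < n\<close> that] tensor_of_add[OF Z Y \<open>i < n\<close> \<open>j < n\<close> that] Zt[OF \<open>i < n\<close> \<open>j < n\<close> that]
      by (simp add: algebra_simps)
    then have "pencil_at n m ?Z2 c $$ (i, j) = (\<Sum>k<m. if i = a then 2 * (c k * tensor_of Y i j k) else if i = b then c k * tensor_of Y i j k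
        else if k = l then c l * kron (h i) j else 0)"
      using that by (simp add: pencil_at_index)
    then show ?thesis using that l(1) by (auto simp: y_def pencil_at_index sum_distrib_left)
  qed
  have row: "(\<Sum>j<n. pencil_at n m ?Z2 c $$ (i, j) * v $ j) = 0" if "i < n" for i
    using mult_mat_vec_index[OF pencil_at_carrier v(1) that, of m ?Z2 c] v(3) that by simp
  \<comment> \<open>The pattern rows confine a kernel vector to the columns \<open>p\<close> and
    \<open>q\<close>, where the nonzero minor of \<open>Y\<close> forces it to vanish.\<close>
  have other: "v $ j = 0" if j: "j < n" "j \<noteq> p" "j \<noteq> q" for j
  proof -
    have "j \<in> h ` ({..<n} - {a, b})" using h j unfolding bij_betw_def by simp
    then obtain i where i: "i < n" "i \<noteq> a" "i \<noteq> b" "h i = j" by blast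
    have "(\<Sum>j'<n. pencil_at n m ?Z2 c $$ (i, j') * v $ j') = (\<Sum>j'<n. (c l * v $ j') * kron j j')"
      using Z2[OF i(1)] i by (intro sum.cong refl) simp
    also have "\<dots> = c l * v $ j" using j(1) by simp
    finally show ?thesis using row[OF i(1)] l(2) by simp
  qed
  have two: "(\<Sum>j<n. y i j * v $ j) = y i p * v $ p + y i q * v $ q" for i
  proof -
    have "(\<Sum>j<n. y i j * v $ j) = (\<Sum>j\<in>{p, q}. y i j * v $ j)"
      using ab other by (intro sum.mono_neutral_right) auto
    then show ?thesis using neq by simp
  qed
  have "(\<Sum>j<n. 2 * (y a j * v $ j)) = 0"
    using row[OF ab(1)] Z2[OF ab(1)] by (simp add: mult.assoc)
  then have "2 * (\<Sum>j<n. y a j * v $ j) = 0" by (simp only: sum_distrib_left)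
  then have "(\<Sum>j<n. y a j * v $ j) = 0" by (simp only: mult_eq_0_iff) simp
  then have ea: "y a p * v $ p + y a q * v $ q = 0" unfolding two .
  have "(\<Sum>j<n. y b j * v $ j) = 0"
    using row[OF ab(2)] Z2[OF ab(2)] neq by simp
  then have eb: "y b p * v $ p + y b q * v $ q = 0" using two[of b] by simp
  have "(y a p * y b q - y b p * y a q) * v $ p = y b q * (y a p * v $ p + y a q * v $ q) - y a q * (y b p * v $ p + y b q * v $ q)"
    by (simp add: algebra_simps)
  then have vp: "v $ p = 0" using ea eb ab(5) by simp
  have "(y a p * y b q - y b p * y a q) * v $ q = y a p * (y b p * v $ p + y b q * v $ q) - y b p * (y a p * v $ p + y a q * v $ q)"
    by (simp add: algebra_simps)
  then have vq: "v $ q = 0" using ea eb ab(5) by simp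
  have "v $ j = 0" if "j < n" for j using other vp vq that by metis
  then show False using v(1,2) by auto
qed

text \<open>Two specialised pencils and their sum have rank at most one, so the two share a column
  or a row direction, and irreducibility makes the choice uniform over all pairs of weights.\<close>

lemma collapse_rank_one:
  assumes Y: "Y \<in> mat_tuples n m" and C: "collapse n m Y"
  shows "splits_first n m (tensor_of Y) \<or> splits_second n m (tensor_of Y)"
proof -
  define A :: "(nat + nat \<Rightarrow> complex) \<Rightarrow> nat \<Rightarrow> nat \<Rightarrow> complex"
    where "A z i j = (\<Sum>k<m. z (Inl k) * tensor_of Y i j k)" for z i j
  define B :: "(nat + nat \<Rightarrow> complex) \<Rightarrow> nat \<Rightarrow> nat \<Rightarrow> complex"
    where "B z i j = (\<Sum>k<m. z (Inr k) * tensor_of Y i j k)" for z i j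
  have pfA: "polyfun (\<lambda>s. A (\<lambda>a. u a + s * v a) i p)" for u v i p
    unfolding A_def by (intro polyfun_sum polyfun_mult polyfun_line polyfun_const)
  have pfB: "polyfun (\<lambda>s. B (\<lambda>a. u a + s * v a) i p)" for u v i p
    unfolding B_def by (intro polyfun_sum polyfun_mult polyfun_line polyfun_const)
  have min: "parallel_columns {..<n} {..<n} (\<lambda>i j. \<Sum>k<m. c k * tensor_of Y i j k) (\<lambda>i j. \<Sum>k<m. c k * tensor_of Y i j k)" for c
    using collapse_minors[OF Y C, of c] unfolding parallel_columns_def by (simp add: pencil_at_index)
  have "(\<forall>z. parallel_columns {..<n} {..<n} (A z) (B z)) \<or> (\<forall>z. parallel_columns {..<n} {..<n} (\<lambda>p i. A z i p) (\<lambda>p i. B z i p))"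
  proof (rule zclosed_irreducible)
    show "zclosed (\<lambda>z. parallel_columns {..<n} {..<n} (A z) (B z))" by (rule zclosed_parallel_columns; rule pfA pfB)
    show "zclosed (\<lambda>z. parallel_columns {..<n} {..<n} (\<lambda>p i. A z i p) (\<lambda>p i. B z i p))" by (rule zclosed_parallel_columns; rule pfA pfB)
    fix z
    show "parallel_columns {..<n} {..<n} (A z) (B z) \<or> parallel_columns {..<n} {..<n} (\<lambda>p i. A z i p) (\<lambda>p i. B z i p)"
    proof (rule parallel_columns_pair)
      show "parallel_columns {..<n} {..<n} (A z) (A z)" using min[of "\<lambda>k. z (Inl k)"] unfolding A_def .
      show "parallel_columns {..<n} {..<n} (B z) (B z)" using min[of "\<lambda>k. z (Inr k)"] unfolding B_def .
      show "parallel_columns {..<n} {..<n} (\<lambda>i p. A z i p + B z i p) (\<lambda>i p. A z i p + B z i p)"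
        using min[of "\<lambda>k. z (Inl k) + z (Inr k)"] unfolding A_def B_def by (simp add: distrib_right sum.distrib)
    qed
  qed
  \<comment> \<open>Weights concentrated on one slot turn the statement about pencils into one about
    the entries of two given slots.\<close>
  moreover have AB: "A (case_sum (kron k) (kron k')) i j = tensor_of Y i j k" "B (case_sum (kron k) (kron k')) i j = tensor_of Y i j k'"
    if "k < m" "k' < m" for i j k k'
    using sum_kron[OF that(1), of "\<lambda>k. tensor_of Y i j k"] sum_kron[OF that(2), of "\<lambda>k. tensor_of Y i j k"]
    unfolding A_def B_def by (simp_all add: mult.commute)
  ultimately show ?thesis
  proof (elim disjE)
    assume all: "\<forall>z. parallel_columns {..<n} {..<n} (A z) (B z)"
    have "splits_first n m (tensor_of Y)" unfolding splits_first_def parallel_columns_def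
    proof (intro ballI)
      fix i i' p p' assume *: "i \<in> {..<n}" "i' \<in> {..<n}" "p \<in> {..<n} \<times> {..<m}" "p' \<in> {..<n} \<times> {..<m}"
      then have "fst p \<in> {..<n}" "fst p' \<in> {..<n}" and k: "snd p < m" "snd p' < m" by auto
      then show "tensor_of Y i (fst p) (snd p) * tensor_of Y i' (fst p') (snd p') = tensor_of Y i' (fst p) (snd p) * tensor_of Y i (fst p') (snd p')"
        using parallel_columnsD[OF all[rule_format, of "case_sum (kron (snd p)) (kron (snd p'))"] *(1,2)] AB[OF k] by simp
    qed
    then show ?thesis ..
  next
    assume all: "\<forall>z. parallel_columns {..<n} {..<n} (\<lambda>p i. A z i p) (\<lambda>p i. B z i p)"
    have "splits_second n m (tensor_of Y)" unfolding splits_second_def splits_first_def parallel_columns_def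
    proof (intro ballI)
      fix i i' p p' assume *: "i \<in> {..<n}" "i' \<in> {..<n}" "p \<in> {..<n} \<times> {..<m}" "p' \<in> {..<n} \<times> {..<m}"
      then have "fst p \<in> {..<n}" "fst p' \<in> {..<n}" and k: "snd p < m" "snd p' < m" by auto
      then show "tensor_of Y (fst p) i (snd p) * tensor_of Y (fst p') i' (snd p') = tensor_of Y (fst p) i' (snd p) * tensor_of Y (fst p') i (snd p')"
        using parallel_columnsD[OF all[rule_format, of "case_sum (kron (snd p)) (kron (snd p'))"] *(1,2)] AB[OF k] by simp
    qed
    then show ?thesis ..
  qed
qed

lemma splits_cong:
  assumes "\<And>i j k. i < n \<Longrightarrow> j < n \<Longrightarrow> k < m \<Longrightarrow> x i j k = y i j k"
  shows "splits_first n m x \<or> splits_second n m x \<longleftrightarrow> splits_first n m y \<or> splits_second n m y"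
proof -
  have "splits_first n m x = splits_first n m y" if "\<And>i j k. i < n \<Longrightarrow> j < n \<Longrightarrow> k < m \<Longrightarrow> x i j k = y i j k" for x y
    unfolding splits_first_def parallel_columns_def using that by auto
  from this[of x y] this[of "\<lambda>i j k. x j i k" "\<lambda>i j k. y j i k"]
  show ?thesis unfolding splits_second_def using assms by simp
qed

section \<open>The shape of a linear bijection preserving \<open>SING\<close>\<close>

locale sing_action = lin_action +
  assumes n2: "n \<ge> 2" and m1: "m \<ge> 1"
    and preserves: "\<And>g. g \<in> G \<Longrightarrow> \<phi> g ` SING n m = SING n m"
begin

lemma act_collapse:
  assumes g: "g \<in> G" and Y: "Y \<in> mat_tuples n m" and C: "collapse n m Y"
  shows "collapse n m (\<phi> g Y)"
  unfolding collapse_def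
proof (intro ballI impI)
  fix Z assume Z: "Z \<in> SING n m" and ZY: "tuple_add m Z (\<phi> g Y) \<in> SING n m"
  obtain h where h: "h \<in> G" "\<forall>X\<in>mat_tuples n m. \<phi> g (\<phi> h X) = X \<and> \<phi> h (\<phi> g X) = X"
    using act_inverse[OF g] by blast
  have ZV: "Z \<in> mat_tuples n m" "\<phi> g Y \<in> mat_tuples n m" "\<phi> h Z \<in> mat_tuples n m"
    using SING_sub[OF Z] act_closed g h Y by auto
  have "\<phi> h Z \<in> SING n m" using preserves[OF h(1)] Z by blast
  moreover have "\<phi> h (tuple_add m Z (\<phi> g Y)) \<in> SING n m" using preserves[OF h(1)] ZY by blast
  then have "tuple_add m (\<phi> h Z) Y \<in> SING n m" using act_add[OF h(1) ZV(1,2)] h(2) Y by simp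
  ultimately have S: "tuple_add m (tuple_add m (\<phi> h Z) Y) Y \<in> SING n m" using C unfolding collapse_def by blast
  have "\<phi> g (tuple_add m (tuple_add m (\<phi> h Z) Y) Y) = tuple_add m (tuple_add m Z (\<phi> g Y)) (\<phi> g Y)"
    using act_add[OF g tuple_add_mem[OF ZV(3) Y] Y] act_add[OF g ZV(3) Y] h(2) ZV(1) by simp
  moreover have "\<phi> g (tuple_add m (tuple_add m (\<phi> h Z) Y) Y) \<in> SING n m"
    using preserves[OF g] S by blast
  ultimately show "tuple_add m (tuple_add m Z (\<phi> g Y)) (\<phi> g Y) \<in> SING n m" by simp
qed

definition action_tensor :: "complex mat \<Rightarrow> nat \<Rightarrow> nat \<Rightarrow> nat \<Rightarrow> tensor" where
  "action_tensor g i j k a b c = tensor_of (\<phi> g (basis_tuple n m (c, a, b))) i j k"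

lemma tensor_apply_action:
  assumes g: "g \<in> G" and X: "X \<in> mat_tuples n m" and ijk: "i < n" "j < n" "k < m"
  shows "tensor_of (\<phi> g X) i j k = tensor_apply n m (action_tensor g) (tensor_of X) i j k"
proof -
  have "(k, i, j) \<in> idx n m" using ijk by (auto simp: idx_def)
  from act_expand[OF g X this]
  have "tensor_of (\<phi> g X) i j k = (\<Sum>b\<in>{..<m} \<times> {..<n} \<times> {..<n}. entry X b * entry (\<phi> g (basis_tuple n m b)) (k, i, j))"
    unfolding tensor_of_def idx_def .
  also have "\<dots> = (\<Sum>c<m. \<Sum>a<n. \<Sum>b<n. entry X (c, a, b) * entry (\<phi> g (basis_tuple n m (c, a, b))) (k, i, j))"
    by (simp add: sum.cartesian_product case_prod_beta)
  also have "\<dots> = (\<Sum>a<n. \<Sum>c<m. \<Sum>b<n. entry X (c, a, b) * entry (\<phi> g (basis_tuple n m (c, a, b))) (k, i, j))"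
    by (rule sum.swap)
  also have "\<dots> = (\<Sum>a<n. \<Sum>b<n. \<Sum>c<m. entry X (c, a, b) * entry (\<phi> g (basis_tuple n m (c, a, b))) (k, i, j))"
    by (rule sum.cong[OF refl], rule sum.swap)
  finally show ?thesis unfolding tensor_apply_def action_tensor_def tensor_of_def by (simp add: mult.commute)
qed

text \<open>Splitting is equivalent to \<open>collapse\<close>, which both \<open>g\<close> and its
  inverse transport; this gives preservation in both directions.\<close>

lemma tensor_preserver_action:
  assumes g: "g \<in> G" shows "tensor_preserver n m (action_tensor g)"
proof (rule tensor_preserver.intro)
  obtain h where h: "h \<in> G" "\<forall>X\<in>mat_tuples n m. \<phi> g (\<phi> h X) = X \<and> \<phi> h (\<phi> g X) = X"
    using act_inverse[OF g] by blast
  have tensor_apply: "tensor_apply n m (action_tensor g) x i j k = tensor_of (\<phi> g (tuple_of_tensor n m x)) i j k" if ijk: "i < n" "j < n" "k < m" for x i j k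
  proof -
    have "tensor_apply n m (action_tensor g) x i j k = tensor_apply n m (action_tensor g) (tensor_of (tuple_of_tensor n m x)) i j k"
      unfolding tensor_apply_def by (intro sum.cong refl) (simp add: tensor_of_tuple)
    then show ?thesis using tensor_apply_action[OF g tuple_of_tensor_mem ijk] by simp
  qed
  have Rx: "splits_first n m x \<or> splits_second n m x \<longleftrightarrow> collapse n m (tuple_of_tensor n m x)" for x
    using splits_cong[of n m "tensor_of (tuple_of_tensor n m x)" x] tensor_of_tuple[of _ n _ _ m x]
      rank_one_collapse[OF tuple_of_tensor_mem, of n m x] collapse_rank_one[OF tuple_of_tensor_mem, of n m x] by blast
  have Rax: "splits_first n m (tensor_apply n m (action_tensor g) x) \<or> splits_second n m (tensor_apply n m (action_tensor g) x) \<longleftrightarrow> collapse n m (\<phi> g (tuple_of_tensor n m x))" for x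
    using splits_cong[of n m "tensor_apply n m (action_tensor g) x" "tensor_of (\<phi> g (tuple_of_tensor n m x))", OF tensor_apply]
      rank_one_collapse[OF act_closed[OF g tuple_of_tensor_mem], of x] collapse_rank_one[OF act_closed[OF g tuple_of_tensor_mem], of x] by blast
  show "splits_first n m (tensor_apply n m (action_tensor g) x) \<or> splits_second n m (tensor_apply n m (action_tensor g) x)" if "splits_first n m x \<or> splits_second n m x" for x
    using that act_collapse[OF g tuple_of_tensor_mem, of x] Rx[of x] Rax[of x] by blast
  show "splits_first n m x \<or> splits_second n m x" if "splits_first n m (tensor_apply n m (action_tensor g) x) \<or> splits_second n m (tensor_apply n m (action_tensor g) x)" for x
  proof -
    have "collapse n m (\<phi> h (\<phi> g (tuple_of_tensor n m x)))"
      using that act_collapse[OF h(1) act_closed[OF g tuple_of_tensor_mem], of x] Rax[of x] by blast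
    then show ?thesis using Rx[of x] h(2) by simp
  qed
  show "x i j k = 0" if zero: "\<And>i j k. i < n \<Longrightarrow> j < n \<Longrightarrow> k < m \<Longrightarrow> tensor_apply n m (action_tensor g) x i j k = 0"
    and ijk: "i < n" "j < n" "k < m" for x i j k
  proof -
    have "\<phi> g (tuple_of_tensor n m x) = tuple_zero n m"
    proof (rule mat_tuples_eqI[OF act_closed[OF g tuple_of_tensor_mem] tuple_zero_mem])
      fix b assume b: "b \<in> idx n m"
      obtain k i j where bk: "b = (k, i, j)" by (cases b) auto
      then have "i < n" "j < n" "k < m" using b by (auto simp: idx_def)
      then have "tensor_of (\<phi> g (tuple_of_tensor n m x)) i j k = 0" using tensor_apply zero by metis
      then show "entry (\<phi> g (tuple_of_tensor n m x)) b = entry (tuple_zero n m) b"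
        using bk entry_tuple_zero[OF b] unfolding tensor_of_def by simp
    qed
    then have "tuple_of_tensor n m x = tuple_zero n m" using h act_zero[OF h(1)] tuple_of_tensor_mem by metis
    then have "tensor_of (tuple_of_tensor n m x) i j k = 0"
      using ijk unfolding tensor_of_def by (simp add: entry_tuple_zero idx_def)
    then show ?thesis using tensor_of_tuple[OF ijk] by simp
  qed
qed (fact n2 m1)+

text \<open>The bit \<open>s\<close> records a transposition of the output. Nothing is claimed about
  how the data depend on \<open>g\<close>, since the factors come from pure existence
  statements.\<close>

theorem sing_preserver:
  assumes g: "g \<in> G"
  shows "\<exists>(s::bool) P Q R. P \<in> carrier_mat n n \<and> Q \<in> carrier_mat n n \<and> R \<in> carrier_mat m m \<and>
    (\<forall>X\<in>mat_tuples n m. \<forall>i<n. \<forall>j<n. \<forall>k<m.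
      entry (\<phi> g X) (k, if s then (j, i) else (i, j)) = (\<Sum>c<m. R $$ (k, c) * (P * X c * Q) $$ (i, j)))"
proof -
  have "\<exists>s. first_to_first n m (if s then tswap (action_tensor g) else action_tensor g)"
    using tensor_preserver_first_to_first[OF tensor_preserver_action[OF g]] by (metis (full_types))
  then obtain s where s: "first_to_first n m (if s then tswap (action_tensor g) else action_tensor g)" ..
  define t where "t = (if s then tswap (action_tensor g) else action_tensor g)"
  have tp: "tensor_preserver n m t"
    using tensor_preserver_action[OF g] tensor_preserver_tswap unfolding t_def by simp
  from tensor_preserver.first_to_first_product[OF tp s[folded t_def]]
  obtain q p r where f: "\<forall>i<n. \<forall>a<n. \<forall>j<n. \<forall>k<m. \<forall>b<n. \<forall>c<m. t i j k a b c = q i a * (p j b * r k c)"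
    by (elim exE)
  define P where "P = mat n n (\<lambda>(i, j). q i j)"
  define P2 where "P2 = mat n n (\<lambda>(i, j). p i j)"
  define R where "R = mat m m (\<lambda>(i, j). r i j)"
  have c: "P \<in> carrier_mat n n" "P2 \<in> carrier_mat n n" "R \<in> carrier_mat m m" unfolding P_def P2_def R_def by auto
  have form: "entry (\<phi> g X) (k, if s then (j, i) else (i, j)) = (\<Sum>c<m. R $$ (k, c) * (P * X c * P2\<^sup>T) $$ (i, j))"
    if X: "X \<in> mat_tuples n m" and ijk: "i < n" "j < n" "k < m" for X i j k
  proof -
    have "entry (\<phi> g X) (k, if s then (j, i) else (i, j)) = tensor_apply n m t (tensor_of X) i j k"
      using tensor_apply_action[OF g X ijk] tensor_apply_action[OF g X ijk(2,1,3)] unfolding t_def by (auto simp: tensor_of_def tensor_apply_swap)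
    also have "\<dots> = (\<Sum>a<n. \<Sum>b<n. \<Sum>c<m. r k c * (q i a * (X c $$ (a, b) * p j b)))"
      unfolding tensor_apply_def using f ijk by (intro sum.cong refl) (simp add: tensor_of_def entry_def)
    also have "\<dots> = (\<Sum>a<n. \<Sum>c<m. \<Sum>b<n. r k c * (q i a * (X c $$ (a, b) * p j b)))"
      by (rule sum.cong[OF refl], rule sum.swap)
    also have "\<dots> = (\<Sum>c<m. \<Sum>a<n. \<Sum>b<n. r k c * (q i a * (X c $$ (a, b) * p j b)))"
      by (rule sum.swap)
    also have "\<dots> = (\<Sum>c<m. R $$ (k, c) * (P * X c * P2\<^sup>T) $$ (i, j))"
    proof (intro sum.cong refl)
      fix c' assume "c' \<in> {..<m}"
      then have c': "c' < m" by simp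
      have Xc: "X c' \<in> carrier_mat n n" using mat_tuples_carrier[OF X c'] .
      have "P * X c' * P2\<^sup>T = P * (X c' * P2\<^sup>T)" using c Xc by simp
      moreover have "(P * (X c' * P2\<^sup>T)) $$ (i, j) = (\<Sum>a<n. q i a * (\<Sum>b<n. X c' $$ (a, b) * p j b))"
      proof -
        have "(P * (X c' * P2\<^sup>T)) $$ (i, j) = (\<Sum>a<n. P $$ (i, a) * (X c' * P2\<^sup>T) $$ (a, j))"
          using c Xc ijk by (intro mult_mat_index[of _ n n _ n]) auto
        also have "\<dots> = (\<Sum>a<n. q i a * (\<Sum>b<n. X c' $$ (a, b) * P2\<^sup>T $$ (b, j)))"
        proof (intro sum.cong refl)
          fix a assume "a \<in> {..<n}"
          then have a: "a < n" by simp
          have "(X c' * P2\<^sup>T) $$ (a, j) = (\<Sum>b<n. X c' $$ (a, b) * P2\<^sup>T $$ (b, j))"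
            using c Xc ijk a by (intro mult_mat_index[of _ n n _ n]) auto
          then show "P $$ (i, a) * (X c' * P2\<^sup>T) $$ (a, j) = q i a * (\<Sum>b<n. X c' $$ (a, b) * P2\<^sup>T $$ (b, j))"
            using ijk a by (simp add: P_def del: index_mult_mat)
        qed
        also have "\<dots> = (\<Sum>a<n. q i a * (\<Sum>b<n. X c' $$ (a, b) * p j b))"
          using ijk by (intro sum.cong refl arg_cong2[of _ _ _ _ "(*)"]) (simp add: P2_def)
        finally show ?thesis .
      qed
      ultimately show "(\<Sum>a<n. \<Sum>b<n. r k c' * (q i a * (X c' $$ (a, b) * p j b))) = R $$ (k, c') * (P * X c' * P2\<^sup>T) $$ (i, j)"
        using ijk c' by (simp only: sum_distrib_left) (simp add: R_def sum_distrib_left)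
    qed
    finally show ?thesis .
  qed
  show ?thesis
  proof (rule exI[of _ s], rule exI[of _ P], rule exI[of _ "P2\<^sup>T"], rule exI[of _ R], intro conjI ballI allI impI)
    show "P2\<^sup>T \<in> carrier_mat n n" using c(2) by auto
  qed (rule c form; assumption?)+
qed

end

section \<open>The null cone\<close>

text \<open>The matrix \<open>A\<close> acting on the slot index, entry by entry in the
  matrices.\<close>

definition mix :: "nat \<Rightarrow> nat \<Rightarrow> 'r::comm_ring_1 mat \<Rightarrow> (nat \<Rightarrow> 'r mat) \<Rightarrow> nat \<Rightarrow> 'r mat" where
  "mix n m A Z k = mat n n (\<lambda>ij. \<Sum>c<m. A $$ (k, c) * Z c $$ ij)"

lemma mix_carrier [simp]: "mix n m A Z k \<in> carrier_mat n n"
  unfolding mix_def by simp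

lemma mix_index: "i < n \<Longrightarrow> j < n \<Longrightarrow> mix n m A Z k $$ (i, j) = (\<Sum>c<m. A $$ (k, c) * Z c $$ (i, j))"
  unfolding mix_def by simp

lemma mix_cong:
  "(\<And>c. c < m \<Longrightarrow> Z c = Z' c) \<Longrightarrow> mix n m A Z k = mix n m A Z' k"
  unfolding mix_def by simp

lemma mix_mult_left:
  fixes B :: "'r::comm_ring_1 mat"
  assumes B: "B \<in> carrier_mat n n" and Z: "\<And>c. c < m \<Longrightarrow> Z c \<in> carrier_mat n n"
  shows "B * mix n m A Z k = mix n m A (\<lambda>c. B * Z c) k"
proof (rule eq_matI)
  fix i j assume "i < dim_row (mix n m A (\<lambda>c. B * Z c) k)" "j < dim_col (mix n m A (\<lambda>c. B * Z c) k)"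
  then have ij: "i < n" "j < n" by (auto simp: mix_def)
  have "(B * mix n m A Z k) $$ (i, j) = (\<Sum>l<n. B $$ (i, l) * (\<Sum>c<m. A $$ (k, c) * Z c $$ (l, j)))"
    using mult_mat_index[OF B mix_carrier ij] ij by (simp add: mix_index)
  also have "\<dots> = (\<Sum>l<n. \<Sum>c<m. A $$ (k, c) * (B $$ (i, l) * Z c $$ (l, j)))"
    unfolding sum_distrib_left by (intro sum.cong refl) (simp only: ac_simps)
  also have "\<dots> = (\<Sum>c<m. \<Sum>l<n. A $$ (k, c) * (B $$ (i, l) * Z c $$ (l, j)))" by (rule sum.swap)
  also have "\<dots> = (\<Sum>c<m. A $$ (k, c) * (B * Z c) $$ (i, j))"
    using mult_mat_index[OF B Z ij] by (intro sum.cong refl) (simp only: sum_distrib_left lessThan_iff)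
  finally show "(B * mix n m A Z k) $$ (i, j) = mix n m A (\<lambda>c. B * Z c) k $$ (i, j)"
    using ij by (simp only: mix_index)
qed (use B in \<open>auto simp: mix_def\<close>)

lemma mix_mult_right:
  fixes B :: "'r::comm_ring_1 mat"
  assumes B: "B \<in> carrier_mat n n" and Z: "\<And>c. c < m \<Longrightarrow> Z c \<in> carrier_mat n n"
  shows "mix n m A Z k * B = mix n m A (\<lambda>c. Z c * B) k"
proof (rule eq_matI)
  fix i j assume "i < dim_row (mix n m A (\<lambda>c. Z c * B) k)" "j < dim_col (mix n m A (\<lambda>c. Z c * B) k)"
  then have ij: "i < n" "j < n" by (auto simp: mix_def)
  have "(mix n m A Z k * B) $$ (i, j) = (\<Sum>l<n. (\<Sum>c<m. A $$ (k, c) * Z c $$ (i, l)) * B $$ (l, j))"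
    using mult_mat_index[OF mix_carrier B ij] ij by (simp add: mix_index)
  also have "\<dots> = (\<Sum>l<n. \<Sum>c<m. A $$ (k, c) * (Z c $$ (i, l) * B $$ (l, j)))"
    unfolding sum_distrib_right by (intro sum.cong refl) (simp only: ac_simps)
  also have "\<dots> = (\<Sum>c<m. \<Sum>l<n. A $$ (k, c) * (Z c $$ (i, l) * B $$ (l, j)))" by (rule sum.swap)
  also have "\<dots> = (\<Sum>c<m. A $$ (k, c) * (Z c * B) $$ (i, j))"
    using mult_mat_index[OF Z B ij] by (intro sum.cong refl) (simp only: sum_distrib_left lessThan_iff)
  finally show "(mix n m A Z k * B) $$ (i, j) = mix n m A (\<lambda>c. Z c * B) k $$ (i, j)"
    using ij by (simp only: mix_index)
qed (use B in \<open>auto simp: mix_def\<close>)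

lemma mix_mult:
  fixes B :: "'r::comm_ring_1 mat"
  assumes "B \<in> carrier_mat n n" "C \<in> carrier_mat n n" and Z: "\<And>c. c < m \<Longrightarrow> Z c \<in> carrier_mat n n"
  shows "B * mix n m A Z k * C = mix n m A (\<lambda>c. B * Z c * C) k"
proof -
  have BZ: "B * Z c \<in> carrier_mat n n" if "c < m" for c using assms(1) Z[OF that] by simp
  have "B * mix n m A Z k = mix n m A (\<lambda>c. B * Z c) k" by (rule mix_mult_left[OF assms(1) Z])
  moreover have "mix n m A (\<lambda>c. B * Z c) k * C = mix n m A (\<lambda>c. B * Z c * C) k"
    by (rule mix_mult_right[OF assms(2) BZ])
  ultimately show ?thesis by (simp only:)
qed

lemma mix_mix:
  fixes A :: "'r::comm_ring_1 mat"
  assumes A: "A \<in> carrier_mat m m" and A': "A' \<in> carrier_mat m m" and k: "k < m"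
  shows "mix n m A (mix n m A' Z) k = mix n m (A * A') Z k"
proof (rule eq_matI)
  fix i j assume "i < dim_row (mix n m (A * A') Z k)" "j < dim_col (mix n m (A * A') Z k)"
  then have ij: "i < n" "j < n" by (auto simp: mix_def)
  have "mix n m A (mix n m A' Z) k $$ (i, j) = (\<Sum>c<m. A $$ (k, c) * (\<Sum>d<m. A' $$ (c, d) * Z d $$ (i, j)))"
    using ij by (simp only: mix_index)
  also have "\<dots> = (\<Sum>c<m. \<Sum>d<m. A $$ (k, c) * A' $$ (c, d) * Z d $$ (i, j))"
    unfolding sum_distrib_left by (simp only: mult.assoc)
  also have "\<dots> = (\<Sum>d<m. \<Sum>c<m. A $$ (k, c) * A' $$ (c, d) * Z d $$ (i, j))" by (rule sum.swap)
  also have "\<dots> = (\<Sum>d<m. (A * A') $$ (k, d) * Z d $$ (i, j))"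
    using mult_mat_index[OF A A' k] by (intro sum.cong refl) (simp only: sum_distrib_right lessThan_iff)
  finally show "mix n m A (mix n m A' Z) k $$ (i, j) = mix n m (A * A') Z k $$ (i, j)"
    using ij by (simp only: mix_index)
qed (auto simp: mix_def)

lemma mix_one:
  fixes Z :: "nat \<Rightarrow> 'r::comm_ring_1 mat"
  assumes "Z k \<in> carrier_mat n n" "k < m" shows "mix n m (1\<^sub>m m) Z k = Z k"
proof (rule eq_matI)
  fix i j assume "i < dim_row (Z k)" "j < dim_col (Z k)"
  then have ij: "i < n" "j < n" using assms by auto
  have "(\<Sum>c<m. 1\<^sub>m m $$ (k, c) * Z c $$ (i, j)) = (\<Sum>c<m. if c = k then Z k $$ (i, j) else 0)"
    using assms(2) by (intro sum.cong) auto
  then show "mix n m (1\<^sub>m m) Z k $$ (i, j) = Z k $$ (i, j)"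
    using ij assms(2) by (simp add: mix_index)
qed (use assms in \<open>auto simp: mix_def\<close>)

lemma mat_rel_mix:
  assumes ph: "part_hom H" and A: "mat_rel H A a" "A \<in> carrier_mat m m" and k: "k < m"
    and Z: "\<And>c. c < m \<Longrightarrow> mat_rel H (Z c) (z c)" "\<And>c. c < m \<Longrightarrow> Z c \<in> carrier_mat n n"
  shows "mat_rel H (mix n m A Z k) (mix n m a z k)"
proof -
  have "((\<Sum>c<m. A $$ (k, c) * Z c $$ (i, j)), (\<Sum>c<m. a $$ (k, c) * z c $$ (i, j))) \<in> H"
    if "i < n" "j < n" for i j
    using that k mat_rel_index[OF A] mat_rel_index[OF Z]
    by (intro part_hom_sum[OF ph] part_hom_mult[OF ph]) auto
  then show ?thesis unfolding mat_rel_def by (auto simp: mix_def)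
qed

lemma mix_diagonal_value:
  assumes H: "place H" and D: "diag_upto H n n D" "D \<in> carrier_mat n n"
    and D': "diag_upto H n n D'" "D' \<in> carrier_mat n n"
    and E: "diag_upto H m m E" "E \<in> carrier_mat m m"
    and Z: "\<And>c. c < m \<Longrightarrow> Z c \<in> carrier_mat n n" and ijk: "i < n" "j < n" "k < m"
  shows "ae_eq H (mix n m E (\<lambda>c. D * Z c * D') k $$ (i, j))
    (E $$ (k, k) * (D $$ (i, i) * Z k $$ (i, j) * D' $$ (j, j)))"
proof -
  have ph: "part_hom H" using H by (rule place_part_hom)
  note ae0 = D(1)[unfolded diag_upto_def, rule_format] D'(1)[unfolded diag_upto_def, rule_format]
    E(1)[unfolded diag_upto_def, rule_format]
  have sum1: "ae_eq H (\<Sum>l<r. h l) (h l0)" if "l0 < r" "\<And>l. l < r \<Longrightarrow> l \<noteq> l0 \<Longrightarrow> ae_eq H (h l) 0" for h and l0 r :: nat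
  proof -
    have "ae_eq H (\<Sum>l<r. h l) (\<Sum>l<r. if l = l0 then h l0 else 0)"
      using that by (intro ae_eq_sum[OF ph]) (auto intro: ae_eq_refl[OF ph])
    then show ?thesis using that(1) by simp
  qed
  have z1: "ae_eq H (x * y) 0" if "ae_eq H x 0" for x y
    using ae_eq_mult[OF ph that ae_eq_refl[OF ph, of y]] by simp
  have z2: "ae_eq H (y * x) 0" if "ae_eq H x 0" for x y
    using z1[OF that, of y] by (simp only: mult.commute)
  have DZ: "ae_eq H ((D * Z k) $$ (i, b)) (D $$ (i, i) * Z k $$ (i, b))" if "b < n" for b
    unfolding mult_mat_index[OF D(2) Z[OF ijk(3)] ijk(1) that]
    using ijk ae0(1) by (intro sum1[of i n "\<lambda>l. D $$ (i, l) * Z k $$ (l, b)"] z1) auto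
  have cDZ: "D * Z k \<in> carrier_mat n n" using D(2) Z[OF ijk(3)] by simp
  have "ae_eq H ((D * Z k * D') $$ (i, j)) ((D * Z k) $$ (i, j) * D' $$ (j, j))"
    unfolding mult_mat_index[OF cDZ D'(2) ijk(1,2)]
    using ijk ae0(2) by (intro sum1[of j n "\<lambda>l. (D * Z k) $$ (i, l) * D' $$ (l, j)"] z2) auto
  moreover have "ae_eq H ((D * Z k) $$ (i, j) * D' $$ (j, j)) (D $$ (i, i) * Z k $$ (i, j) * D' $$ (j, j))"
    by (intro ae_eq_mult[OF ph] DZ ae_eq_refl[OF ph] ijk)
  ultimately have 1: "ae_eq H ((D * Z k * D') $$ (i, j)) (D $$ (i, i) * Z k $$ (i, j) * D' $$ (j, j))"
    by (rule ae_eq_trans[OF ph])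
  have "ae_eq H (mix n m E (\<lambda>c. D * Z c * D') k $$ (i, j)) (E $$ (k, k) * (D * Z k * D') $$ (i, j))"
    unfolding mix_index[OF ijk(1,2)]
    using ijk ae0(3) by (intro sum1[of k m "\<lambda>c. E $$ (k, c) * (D * Z c * D') $$ (i, j)"] z1) auto
  moreover have "ae_eq H (E $$ (k, k) * (D * Z k * D') $$ (i, j))
      (E $$ (k, k) * (D $$ (i, i) * Z k $$ (i, j) * D' $$ (j, j)))"
    by (intro ae_eq_mult[OF ph] 1 ae_eq_refl[OF ph])
  ultimately show ?thesis by (rule ae_eq_trans[OF ph])
qed

text \<open>Meant for the transposition bit, which varies with \<open>g\<close>: the indicator of
  \<open>s\<close> has some value, and the result does not depend on it because both branches agree
  in value.\<close>

lemma place_if_value: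
  assumes H: "place H" and f: "(f, a) \<in> H" "(g, a) \<in> H"
  shows "((\<lambda>x. if s x then f x else g x), a) \<in> H"
proof -
  have ph: "part_hom H" using H by (rule place_part_hom)
  define e where "e = (\<lambda>x. if s x then 1 else 0 :: complex)"
  have "e * e = e" by (auto simp: e_def fun_eq_iff fun_apply)
  then obtain c where c: "(e, c) \<in> H" using place_idempotent[OF H] by force
  have "(e * f + (1 - e) * g, c * a + (1 - c) * a) \<in> H"
    by (intro part_hom_add part_hom_mult part_hom_diff part_hom_1 ph c f)
  moreover have "e * f + (1 - e) * g = (\<lambda>x. if s x then f x else g x)"
    by (auto simp: e_def fun_eq_iff fun_apply)
  ultimately show ?thesis by (simp add: algebra_simps)
qed

lemma place_poly_value:
  assumes H: "part_hom H" and p: "p \<in> poly_funs (tuple_coords n m)"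
    and Z: "\<And>b. b \<in> idx n m \<Longrightarrow> ((\<lambda>g. entry (Z g) b), entry z b) \<in> H"
  shows "((\<lambda>g. p (Z g)), p z) \<in> H"
  using p
proof (induction rule: poly_funs.induct)
  case (const c)
  then show ?case by (rule part_hom_const[OF H])
next
  case (coord f)
  then show ?case using Z unfolding tuple_coords_eq by auto
next
  case (add f g)
  then show ?case using part_hom_add[OF H] unfolding plus_fun_def by blast
next
  case (mult f g)
  then show ?case using part_hom_mult[OF H] unfolding times_fun_def by blast
qed

lemma eval_hom: "comm_ring_hom (\<lambda>f :: 'a \<Rightarrow> complex. f g)"
  by standard (simp_all add: fun_apply)

lemma perm_mat_det:
  fixes \<sigma> :: "nat \<Rightarrow> nat"
  assumes \<sigma>: "inj_on \<sigma> {..<n}" "\<sigma> ` {..<n} \<subseteq> {..<n}"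
  shows "det (mat n n (\<lambda>(i, j). if j = \<sigma> i then 1 else 0 :: complex)) \<noteq> 0"
proof -
  let ?A = "mat n n (\<lambda>(i, j). if j = \<sigma> i then 1 else 0 :: complex)"
  have c: "?A \<in> carrier_mat n n" "?A\<^sup>T \<in> carrier_mat n n" by auto
  have "?A * ?A\<^sup>T = 1\<^sub>m n"
  proof (rule eq_matI)
    fix i j assume "i < dim_row (1\<^sub>m n :: complex mat)" "j < dim_col (1\<^sub>m n :: complex mat)"
    then have ij: "i < n" "j < n" by auto
    have "(?A * ?A\<^sup>T) $$ (i, j) = (\<Sum>l<n. ?A $$ (i, l) * ?A\<^sup>T $$ (l, j))"
      by (rule mult_mat_index[OF c ij])
    also have "\<dots> = (\<Sum>l<n. if l = \<sigma> i then (if i = j then 1 else 0) else 0)"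
      using ij \<sigma>(1) by (intro sum.cong refl) (auto simp: inj_on_def)
    also have "\<dots> = 1\<^sub>m n $$ (i, j)" using ij \<sigma>(2) by auto
    finally show "(?A * ?A\<^sup>T) $$ (i, j) = 1\<^sub>m n $$ (i, j)" .
  qed auto
  then have "det ?A * det ?A\<^sup>T = 1" using det_mult[OF c] by simp
  then show ?thesis by auto
qed

lemma mix_compose:
  fixes A1 :: "'r::comm_ring_1 mat"
  assumes A: "A1 \<in> carrier_mat m m" "A2 \<in> carrier_mat m m"
    and B: "B1 \<in> carrier_mat n n" "B2 \<in> carrier_mat n n"
    and C: "C1 \<in> carrier_mat n n" "C2 \<in> carrier_mat n n"
    and X: "\<And>c. c < m \<Longrightarrow> X c \<in> carrier_mat n n" and k: "k < m"
  shows "mix n m A1 (\<lambda>k. B1 * mix n m A2 (\<lambda>c. B2 * X c * C2) k * C1) k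
    = mix n m (A1 * A2) (\<lambda>c. (B1 * B2) * X c * (C2 * C1)) k"
proof -
  have c: "B2 * X c * C2 \<in> carrier_mat n n" if "c < m" for c using B C X[OF that] by simp
  have "B1 * mix n m A2 (\<lambda>c. B2 * X c * C2) k * C1 = mix n m A2 (\<lambda>c. B1 * (B2 * X c * C2) * C1) k" for k
    by (rule mix_mult[OF B(1) C(1) c])
  also have "mix n m A2 (\<lambda>c. B1 * (B2 * X c * C2) * C1) k = mix n m A2 (\<lambda>c. (B1 * B2) * X c * (C2 * C1)) k" for k
  proof (rule mix_cong)
    fix c assume "c < m"
    then show "B1 * (B2 * X c * C2) * C1 = (B1 * B2) * X c * (C2 * C1)"
      using B C X[of c] by (simp add: assoc_mult_mat[of _ n n _ n _ n])
  qed
  finally have "mix n m A1 (\<lambda>k. B1 * mix n m A2 (\<lambda>c. B2 * X c * C2) k * C1) k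
      = mix n m A1 (mix n m A2 (\<lambda>c. (B1 * B2) * X c * (C2 * C1))) k"
    by (simp only:)
  then show ?thesis using mix_mix[OF A k, of n "\<lambda>c. (B1 * B2) * X c * (C2 * C1)"] by (simp only:)
qed

text \<open>One-sided forms of L P M = D: on either side of \<open>P\<close>, one base change is
  traded for the inverse of the other.\<close>

lemma smith_sides:
  fixes P :: "'r::comm_ring_1 mat"
  assumes "P \<in> carrier_mat n n" "L \<in> carrier_mat n n" "L' \<in> carrier_mat n n"
    "M \<in> carrier_mat n n" "M' \<in> carrier_mat n n" "L' * L = 1\<^sub>m n" "M * M' = 1\<^sub>m n"
  shows "L * P = (L * P * M) * M'" "P * M = L' * (L * P * M)"
proof -
  have "(L * P * M) * M' = L * P * (M * M')" using assms by (intro assoc_mult_mat[of _ n n _ n _ n]) auto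
  then show "L * P = (L * P * M) * M'" using assms by simp
  have "L' * (L * P * M) = L' * (L * (P * M))" using assms by (simp add: assoc_mult_mat[of _ n n _ n _ n])
  also have "\<dots> = (L' * L) * (P * M)" using assms by (intro assoc_mult_mat[symmetric, of _ n n _ n _ n]) auto
  also have "\<dots> = P * M" using assms by simp
  finally show "P * M = L' * (L * P * M)" by simp
qed

definition cst :: "complex mat \<Rightarrow> ('a \<Rightarrow> complex) mat" where
  "cst a = map_mat (\<lambda>x _. x) a"

lemma cst_carrier: "a \<in> carrier_mat n k \<Longrightarrow> cst a \<in> carrier_mat n k"
  unfolding cst_def by simp

lemma mat_rel_cst: "part_hom H \<Longrightarrow> mat_rel H (cst a) a"
  unfolding mat_rel_def cst_def by (auto intro: part_hom_const)

text \<open>In Smith bases the action multiplies entry (i, j) of slot k by a product of three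
  diagonal entries. The hypothesis gives scaled entries of value 0, so the product has value 0
  wherever the unscaled entry has nonzero value. The same products scale the permutation
  tuple.\<close>

lemma driven_to_zero:
  fixes P Q R :: "('a \<Rightarrow> complex) mat"
  assumes H: "place H" and P: "P \<in> carrier_mat n n" and Q: "Q \<in> carrier_mat n n" and R: "R \<in> carrier_mat m m"
    and n: "n \<ge> 1" and X: "\<And>c. c < m \<Longrightarrow> X c \<in> carrier_mat n n"
    and val: "\<And>k. k < m \<Longrightarrow> mat_rel H (mix n m R (\<lambda>c. P * cst (X c) * Q) k) (0\<^sub>m n n)"
    and trv: "\<And>b c b' c'. b \<in> carrier_mat n n \<Longrightarrow> c \<in> carrier_mat n n \<Longrightarrow> b * c = 1\<^sub>m n \<Longrightarrow>
      b' \<in> carrier_mat n n \<Longrightarrow> c' \<in> carrier_mat n n \<Longrightarrow> b' * c' = 1\<^sub>m n \<Longrightarrow>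
      \<exists>\<sigma>. inj_on \<sigma> {..<n} \<and> \<sigma> ` {..<n} \<subseteq> {..<n} \<and> (\<forall>i<n. \<exists>k<m. (b * X k * b') $$ (i, \<sigma> i) \<noteq> 0)"
  shows "\<exists>Y y. (\<forall>k<m. Y k \<in> carrier_mat n n \<and> mat_rel H (Y k) (y k)) \<and>
    (\<forall>k<m. mat_rel H (mix n m R (\<lambda>c. P * Y c * Q) k) (0\<^sub>m n n)) \<and>
    (\<exists>A\<in>carrier_mat m m. \<exists>k<m. det (mix n m A y k) \<noteq> 0)"
proof -
  have ph: "part_hom H" using H by (rule place_part_hom)
  obtain DP where DP: "rel_equiv H n P DP" "diag_upto H n n DP" using place_smith[OF H P] by blast
  obtain DQ where DQ: "rel_equiv H n Q DQ" "diag_upto H n n DQ" using place_smith[OF H Q] by blast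
  obtain DR where DR: "rel_equiv H m R DR" "diag_upto H m m DR" using place_smith[OF H R] by blast
  obtain LP LP' lp lp' MP MP' mp mp' where iP: "rel_inverses H n LP LP' lp lp' \<and> rel_inverses H n MP MP' mp mp' \<and> DP = LP * P * MP"
    using DP(1) unfolding rel_equiv_def by (elim exE)
  obtain LQ LQ' lq lq' MQ MQ' mq mq' where iQ: "rel_inverses H n LQ LQ' lq lq' \<and> rel_inverses H n MQ MQ' mq mq' \<and> DQ = LQ * Q * MQ"
    using DQ(1) unfolding rel_equiv_def by (elim exE)
  obtain LR LR' lr lr' MR MR' mr mr' where iR: "rel_inverses H m LR LR' lr lr' \<and> rel_inverses H m MR MR' mr mr' \<and> DR = LR * R * MR"
    using DR(1) unfolding rel_equiv_def by (elim exE)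
  have iLP: "rel_inverses H n LP LP' lp lp'" and iMP: "rel_inverses H n MP MP' mp mp'" and eP: "DP = LP * P * MP"
    and iLQ: "rel_inverses H n LQ LQ' lq lq'" and iMQ: "rel_inverses H n MQ MQ' mq mq'" and eQ: "DQ = LQ * Q * MQ"
    and iLR: "rel_inverses H m LR LR' lr lr'" and iMR: "rel_inverses H m MR MR' mr mr'" and eR: "DR = LR * R * MR"
    using iP iQ iR by blast+
  note cs = iLP[unfolded rel_inverses_def] iMP[unfolded rel_inverses_def] iLQ[unfolded rel_inverses_def]
    iMQ[unfolded rel_inverses_def] iLR[unfolded rel_inverses_def] iMR[unfolded rel_inverses_def]
  have car: "LP \<in> carrier_mat n n" "LP' \<in> carrier_mat n n" "MP \<in> carrier_mat n n" "MP' \<in> carrier_mat n n"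
    "LQ \<in> carrier_mat n n" "LQ' \<in> carrier_mat n n" "MQ \<in> carrier_mat n n" "MQ' \<in> carrier_mat n n"
    "LR \<in> carrier_mat m m" "LR' \<in> carrier_mat m m" "MR \<in> carrier_mat m m" "MR' \<in> carrier_mat m m"
    using cs by blast+
  have rel: "mat_rel H LP lp" "mat_rel H LP' lp'" "mat_rel H MP mp" "mat_rel H MP' mp'"
    "mat_rel H LQ lq" "mat_rel H LQ' lq'" "mat_rel H MQ mq" "mat_rel H MQ' mq'"
    "mat_rel H LR lr" "mat_rel H LR' lr'" "mat_rel H MR mr" "mat_rel H MR' mr'"
    using cs by blast+
  note carv = rel_inverses_value[OF ph iLP] rel_inverses_value[OF ph iMP] rel_inverses_value[OF ph iLQ]
    rel_inverses_value[OF ph iMQ] rel_inverses_value[OF ph iLR] rel_inverses_value[OF ph iMR]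
  have cD: "DP \<in> carrier_mat n n" "DQ \<in> carrier_mat n n" "DR \<in> carrier_mat m m"
    using rel_equiv_carrier P Q R DP(1) DQ(1) DR(1) by blast+
  have ones: "LP' * LP = 1\<^sub>m n" "MP * MP' = 1\<^sub>m n" "LQ' * LQ = 1\<^sub>m n" "MQ * MQ' = 1\<^sub>m n"
    "LR' * LR = 1\<^sub>m m" "MR * MR' = 1\<^sub>m m"
    using cs by blast+
  have sP: "LP * P = DP * MP'" "P * MP = LP' * DP"
    unfolding eP by (rule smith_sides[OF P car(1-4) ones(1,2)])+
  have sQ: "LQ * Q = DQ * MQ'" "Q * MQ = LQ' * DQ"
    unfolding eQ by (rule smith_sides[OF Q car(5-8) ones(3,4)])+
  have sR: "LR * R = DR * MR'" "R * MR = LR' * DR"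
    unfolding eR by (rule smith_sides[OF R car(9-12) ones(5,6)])+
  \<comment> \<open>The tuple in the inner bases: \<open>P\<close> is LP' DP MP', \<open>Q\<close>
    is LQ' DQ MQ', and \<open>R\<close> is LR' DR MR', so MP', LQ' and MR' meet \<open>X\<close>
    first.\<close>
  define W where "W = mix n m MR' (\<lambda>c. MP' * cst (X c) * LQ')"
  define w where "w = mix n m mr' (\<lambda>c. mp' * X c * lq')"
  have cW: "W c \<in> carrier_mat n n" "w c \<in> carrier_mat n n" for c unfolding W_def w_def by simp_all
  have rel_mult3: "mat_rel H (A * Z * B) (a * z * b)"
    if "mat_rel H A a" "A \<in> carrier_mat n n" "mat_rel H Z z" "Z \<in> carrier_mat n n" "mat_rel H B b" "B \<in> carrier_mat n n"
    for A Z B a z b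
  proof -
    have "A * Z \<in> carrier_mat n n" using that(2,4) by simp
    then show ?thesis by (rule mat_rel_mult[OF ph mat_rel_mult[OF ph that(1-4)] _ that(5,6)])
  qed
  have carrier3: "A * Z * B \<in> carrier_mat n n"
    if "A \<in> carrier_mat n n" "Z \<in> carrier_mat n n" "B \<in> carrier_mat n n" for A Z B :: "('a \<Rightarrow> complex) mat"
    using mult_carrier_mat[OF mult_carrier_mat[OF that(1,2)] that(3)] .
  note cX = cst_carrier[OF X]
  have Ww: "mat_rel H (W k) (w k)" if "k < m" for k
    unfolding W_def w_def
    by (rule mat_rel_mix[OF ph rel(12) car(12) that rel_mult3[OF rel(4) car(4) mat_rel_cst[OF ph] cX rel(6) car(6)]
      carrier3[OF car(4) cX car(6)]])
  have DWD: "mix n m LR (\<lambda>k. LP * mix n m R (\<lambda>c. P * cst (X c) * Q) k * MQ) k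
      = mix n m DR (\<lambda>k. DP * W k * DQ) k" if k: "k < m" for k
  proof -
    have "mix n m LR (\<lambda>k. LP * mix n m R (\<lambda>c. P * cst (X c) * Q) k * MQ) k
        = mix n m (LR * R) (\<lambda>c. (LP * P) * cst (X c) * (Q * MQ)) k"
      by (rule mix_compose[OF car(9) R car(1) P car(7) Q cX k])
    also have "\<dots> = mix n m DR (\<lambda>k. DP * W k * DQ) k"
      unfolding W_def sP(1) sQ(2) sR(1)
      by (rule mix_compose[symmetric, OF cD(3) car(12) cD(1) car(4) cD(2) car(6) cX k])
    finally show ?thesis .
  qed
  have zero_entry: "((mix n m DR (\<lambda>k. DP * W k * DQ) k) $$ (i, j), 0) \<in> H" if ijk: "i < n" "j < n" "k < m" for i j k
  proof -
    have "mat_rel H (mix n m LR (\<lambda>k. LP * mix n m R (\<lambda>c. P * cst (X c) * Q) k * MQ) k)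
       (mix n m lr (\<lambda>k. lp * 0\<^sub>m n n * mq) k)"
      by (rule mat_rel_mix[OF ph rel(9) car(9) ijk(3) rel_mult3[OF rel(1) car(1) val mix_carrier rel(7) car(7)]
        carrier3[OF car(1) mix_carrier car(7)]])
    from mat_rel_index[OF this mix_carrier ijk(1,2)]
    have "((mix n m DR (\<lambda>k. DP * W k * DQ) k) $$ (i, j), (mix n m lr (\<lambda>k. lp * 0\<^sub>m n n * mq) k) $$ (i, j)) \<in> H"
      unfolding DWD[OF ijk(3)] .
    moreover have "lp * 0\<^sub>m n n * mq = 0\<^sub>m n n" using carv(1,13) by simp
    then have "(mix n m lr (\<lambda>k. lp * 0\<^sub>m n n * mq) k) $$ (i, j) = 0" using ijk by (simp add: mix_index)
    ultimately show ?thesis by simp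
  qed
  \<comment> \<open>The entry of \<open>W\<close> has a nonzero value, hence is a unit up to a
    function of value 1 and can be divided out.\<close>
  have diag_zero: "(DR $$ (k, k) * (DP $$ (i, i) * DQ $$ (j, j)), 0) \<in> H"
    if ijk: "i < n" "j < n" "k < m" and nz: "w k $$ (i, j) \<noteq> 0" for i j k
  proof -
    let ?f = "DR $$ (k, k) * (DP $$ (i, i) * DQ $$ (j, j))" and ?W = "W k $$ (i, j)"
    have "ae_eq H (mix n m DR (\<lambda>k. DP * W k * DQ) k $$ (i, j)) (DR $$ (k, k) * (DP $$ (i, i) * W k $$ (i, j) * DQ $$ (j, j)))"
      using mix_diagonal_value[OF H DP(2) cD(1) DQ(2) cD(2) DR(2) cD(3) cW(1) ijk] .
    from ae_eq_value[OF H ae_eq_sym[OF this] zero_entry[OF ijk]]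
    have "(DR $$ (k, k) * (DP $$ (i, i) * W k $$ (i, j) * DQ $$ (j, j)), 0) \<in> H" .
    moreover have "(?W, w k $$ (i, j)) \<in> H" using mat_rel_index[OF Ww[OF ijk(3)] cW(1) ijk(1,2)] .
    note unit = place_unit[OF H this nz]
    ultimately have "(DR $$ (k, k) * (DP $$ (i, i) * W k $$ (i, j) * DQ $$ (j, j)) * pinv ?W, 0 * inverse (w k $$ (i, j))) \<in> H"
      by (intro part_hom_mult[OF ph])
    moreover have "DR $$ (k, k) * (DP $$ (i, i) * W k $$ (i, j) * DQ $$ (j, j)) * pinv ?W = (?W * pinv ?W) * ?f"
      by (simp only: ac_simps)
    ultimately have "((?W * pinv ?W) * ?f, 0) \<in> H" by simp
    then show ?thesis by (rule place_ae_value[OF H unit(2)])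
  qed
  obtain \<sigma> where \<sigma>: "inj_on \<sigma> {..<n}" "\<sigma> ` {..<n} \<subseteq> {..<n}" "\<forall>i<n. \<exists>k<m. (mp' * X k * lq') $$ (i, \<sigma> i) \<noteq> 0"
    using trv[OF carv(6,5,8) carv(10,9,12)] by blast
  have \<sigma>n: "\<sigma> i < n" if "i < n" for i using \<sigma>(2) that by auto
  \<comment> \<open>The slot change \<open>mr'\<close> is invertible, so it cannot annihilate
    position (i, \<sigma> i) in all slots at once; the slot that survives may depend on
    \<open>i\<close>.\<close>
  have w\<sigma>: "\<exists>k<m. w k $$ (i, \<sigma> i) \<noteq> 0" if i: "i < n" for i
  proof (rule ccontr)
    assume neg: "\<not> ?thesis"
    obtain k where k: "k < m" "(mp' * X k * lq') $$ (i, \<sigma> i) \<noteq> 0" using \<sigma>(3) i by blast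
    have "mix n m mr w k = mix n m (mr * mr') (\<lambda>c. mp' * X c * lq') k"
      unfolding w_def by (rule mix_mix[OF carv(21,22) k(1)])
    also have "\<dots> = mp' * X k * lq'"
      unfolding carv(23) using carv(6,10) X[OF k(1)] k(1) by (intro mix_one) auto
    finally have "(mp' * X k * lq') $$ (i, \<sigma> i) = (\<Sum>c<m. mr $$ (k, c) * w c $$ (i, \<sigma> i))"
      using mix_index[OF i \<sigma>n[OF i], of m mr w k] by simp
    also have "\<dots> = 0" using neg by (intro sum.neutral) auto
    finally show False using k(2) by simp
  qed
  \<comment> \<open>Divisibility is read backwards: \<open>DR $$ (K, K)\<close> is a multiple of
    every diagonal entry, so slot \<open>K\<close> inherits the zero values found in varying
    slots.\<close>
  have "\<exists>K\<in>{..<m}. \<forall>k\<in>{..<m}. \<exists>c\<in>fst ` H. ae_eq H (DR $$ (K, K)) (c * DR $$ (k, k))"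
  proof (rule total_preorder_minimum)
    show "{..<m} \<noteq> {}" using w\<sigma>[of 0] n by auto
    show "(\<exists>c\<in>fst ` H. ae_eq H (DR $$ (a, a)) (c * DR $$ (b, b))) \<or> (\<exists>c\<in>fst ` H. ae_eq H (DR $$ (b, b)) (c * DR $$ (a, a)))" for a b
      by (rule place_divides_total[OF H])
    show "\<exists>c\<in>fst ` H. ae_eq H (DR $$ (a, a)) (c * DR $$ (d, d))"
      if ab: "\<exists>c\<in>fst ` H. ae_eq H (DR $$ (a, a)) (c * DR $$ (b, b))"
        and bd: "\<exists>c\<in>fst ` H. ae_eq H (DR $$ (b, b)) (c * DR $$ (d, d))" for a b d
      using place_divides_trans[OF ph ab bd] .
  qed simp
  then obtain K where K: "K < m" "\<forall>k\<in>{..<m}. \<exists>c\<in>fst ` H. ae_eq H (DR $$ (K, K)) (c * DR $$ (k, k))" by auto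
  have K_zero: "(DR $$ (K, K) * (DP $$ (i, i) * DQ $$ (\<sigma> i, \<sigma> i)), 0) \<in> H" if i: "i < n" for i
  proof -
    obtain k where k: "k < m" "w k $$ (i, \<sigma> i) \<noteq> 0" using w\<sigma>[OF i] by blast
    obtain c u where c: "(c, u) \<in> H" "ae_eq H (DR $$ (K, K)) (c * DR $$ (k, k))" using K(2) k(1) by force
    have "ae_eq H (DR $$ (K, K) * (DP $$ (i, i) * DQ $$ (\<sigma> i, \<sigma> i)))
        ((c * DR $$ (k, k)) * (DP $$ (i, i) * DQ $$ (\<sigma> i, \<sigma> i)))"
      by (rule ae_eq_mult[OF ph c(2) ae_eq_refl[OF ph]])
    moreover have "(c * (DR $$ (k, k) * (DP $$ (i, i) * DQ $$ (\<sigma> i, \<sigma> i))), u * 0) \<in> H"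
      using part_hom_mult[OF ph c(1) diag_zero[OF i \<sigma>n[OF i] k]] .
    then have "((c * DR $$ (k, k)) * (DP $$ (i, i) * DQ $$ (\<sigma> i, \<sigma> i)), 0) \<in> H" by (simp only: mult.assoc mult_zero_right)
    ultimately show ?thesis by (rule ae_eq_value[OF H])
  qed
  define S where "S = mat n n (\<lambda>(i, j). if j = \<sigma> i then 1 else 0 :: complex)"
  define v where "v k = (if k = K then S else 0\<^sub>m n n)" for k
  have cv: "v k \<in> carrier_mat n n" "cst (v k) \<in> carrier_mat n n" for k
    unfolding v_def S_def cst_def by auto
  define Y where "Y = mix n m MR (\<lambda>c. MP * cst (v c) * LQ)"
  define y where "y = mix n m mr (\<lambda>c. mp * v c * lq)"
  have cY: "Y k \<in> carrier_mat n n" for k unfolding Y_def by simp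
  have Yy: "mat_rel H (Y k) (y k)" if "k < m" for k
    unfolding Y_def y_def
    by (rule mat_rel_mix[OF ph rel(11) car(11) that rel_mult3[OF rel(3) car(3) mat_rel_cst[OF ph] cv(2) rel(5) car(5)]
      carrier3[OF car(3) cv(2) car(5)]])
  have "mat_rel H (mix n m R (\<lambda>c. P * Y c * Q) k) (0\<^sub>m n n)" if k: "k < m" for k
  proof -
    have e: "mix n m R (\<lambda>c. P * Y c * Q) k = mix n m LR' (\<lambda>k. LP' * mix n m DR (\<lambda>c. DP * cst (v c) * DQ) k * MQ') k"
      unfolding Y_def
      unfolding mix_compose[OF R car(11) P car(3) Q car(5) cv(2) k] mix_compose[OF car(10) cD(3) car(2) cD(1) car(8) cD(2) cv(2) k]
        sP(2) sQ(1) sR(2) ..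
    have z: "mat_rel H (mix n m DR (\<lambda>c. DP * cst (v c) * DQ) k) (0\<^sub>m n n)" if k: "k < m" for k
    proof -
      have "(mix n m DR (\<lambda>c. DP * cst (v c) * DQ) k $$ (i, j), 0) \<in> H" if ij: "i < n" "j < n" for i j
      proof (rule ae_eq_value[OF H mix_diagonal_value[OF H DP(2) cD(1) DQ(2) cD(2) DR(2) cD(3) cv(2) ij k]])
        have cs: "cst (v k) $$ (i, j) = (if k = K \<and> j = \<sigma> i then 1 else 0)"
          using ij unfolding cst_def v_def S_def by (auto simp: fun_eq_iff fun_apply)
        show "(DR $$ (k, k) * (DP $$ (i, i) * cst (v k) $$ (i, j) * DQ $$ (j, j)), 0) \<in> H"
          unfolding cs using K_zero[OF ij(1)] part_hom_0[OF ph] by auto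
      qed
      then show ?thesis unfolding mat_rel_def by (auto simp: mix_def)
    qed
    have "mat_rel H (mix n m LR' (\<lambda>k. LP' * mix n m DR (\<lambda>c. DP * cst (v c) * DQ) k * MQ') k)
       (mix n m lr' (\<lambda>k. lp' * 0\<^sub>m n n * mq') k)"
      by (rule mat_rel_mix[OF ph rel(10) car(10) k rel_mult3[OF rel(2) car(2) z mix_carrier rel(8) car(8)]
        carrier3[OF car(2) mix_carrier car(8)]])
    moreover have "mix n m lr' (\<lambda>k. lp' * 0\<^sub>m n n * mq') k = 0\<^sub>m n n"
    proof -
      have "lp' * 0\<^sub>m n n * mq' = 0\<^sub>m n n" using carv(2,14) by simp
      then show ?thesis by (intro eq_matI) (auto simp: mix_def)
    qed
    ultimately show ?thesis unfolding e by simp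
  qed
  \<comment> \<open>Undoing the slot change on values isolates slot \<open>K\<close>, which is the
    permutation matrix between two invertible matrices.\<close>
  moreover have "det (mix n m mr' y K) \<noteq> 0"
  proof -
    have "mix n m mr' y K = mix n m (mr' * mr) (\<lambda>c. mp * v c * lq) K"
      unfolding y_def by (rule mix_mix[OF carv(22,21) K(1)])
    also have "\<dots> = mp * v K * lq"
      unfolding carv(24) using carv(5,9) cv K(1) by (intro mix_one) auto
    finally have e: "mix n m mr' y K = mp * S * lq" by (simp add: v_def)
    have cS: "S \<in> carrier_mat n n" unfolding S_def by simp
    have "det mp * det mp' = 1" "det lq * det lq' = 1"
      using det_mult[OF carv(5,6)] det_mult[OF carv(9,10)] carv(7,11) by simp_all
    then have "det mp \<noteq> 0" "det lq \<noteq> 0" by auto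
    moreover have "det S \<noteq> 0" unfolding S_def by (rule perm_mat_det[OF \<sigma>(1,2)])
    moreover have "det (mp * S * lq) = det mp * det S * det lq"
      using det_mult[OF carv(5) cS] det_mult[of "mp * S" n lq] carv(5,9) cS by simp
    ultimately show ?thesis unfolding e by simp
  qed
  ultimately show ?thesis using cY Yy K(1) carv(22) by blast
qed

section \<open>Families of matrices over the group, and the contradiction\<close>

lemma choice4:
  assumes "\<forall>x. \<exists>a b c d. W x a b c d"
  shows "\<exists>a b c d. \<forall>x. W x (a x) (b x) (c x) (d x)"
  using assms by (simp only: choice_iff)

text \<open>Turns a function with matrix values into a matrix of functions, to which the results
  over a place apply.\<close>

definition mat_fun :: "nat \<Rightarrow> ('a \<Rightarrow> complex mat) \<Rightarrow> ('a \<Rightarrow> complex) mat" where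
  "mat_fun n A = mat n n (\<lambda>ij g. A g $$ ij)"

lemma mat_fun_carrier [simp]: "mat_fun n A \<in> carrier_mat n n"
  unfolding mat_fun_def by simp

lemma map_mat_fun: "A g \<in> carrier_mat n n \<Longrightarrow> map_mat (\<lambda>f. f g) (mat_fun n A) = A g"
  unfolding mat_fun_def by (intro eq_matI) auto

lemma mix_eval:
  fixes A P Q :: "('a \<Rightarrow> complex) mat"
  assumes "A \<in> carrier_mat m m" "P \<in> carrier_mat n n" "Q \<in> carrier_mat n n" "\<And>c. c < m \<Longrightarrow> Z c \<in> carrier_mat n n"
    and ijk: "i < n" "j < n" "k < m"
  shows "(mix n m A (\<lambda>c. P * Z c * Q) k $$ (i, j)) g
    = (\<Sum>c<m. map_mat (\<lambda>f. f g) A $$ (k, c) *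
        (map_mat (\<lambda>f. f g) P * map_mat (\<lambda>f. f g) (Z c) * map_mat (\<lambda>f. f g) Q) $$ (i, j))"
proof -
  interpret comm_ring_hom "\<lambda>f :: 'a \<Rightarrow> complex. f g" by (rule eval_hom)
  have "((P * Z c * Q) $$ (i, j)) g
      = (map_mat (\<lambda>f. f g) P * map_mat (\<lambda>f. f g) (Z c) * map_mat (\<lambda>f. f g) Q) $$ (i, j)" if c: "c < m" for c
  proof -
    have cc: "P * Z c \<in> carrier_mat n n" "P * Z c * Q \<in> carrier_mat n n"
      using mult_carrier_mat[OF assms(2) assms(4)[OF c]] mult_carrier_mat[OF _ assms(3)] by blast+
    have "((P * Z c * Q) $$ (i, j)) g = map_mat (\<lambda>f. f g) (P * Z c * Q) $$ (i, j)"
      using carrier_matD[OF cc(2)] ijk(1,2) by (simp only: index_map_mat(1))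
    then show ?thesis
      unfolding mat_hom_mult[OF cc(1) assms(3)] mat_hom_mult[OF assms(2) assms(4)[OF c]] .
  qed
  then show ?thesis
    using assms(1) ijk(3) unfolding mix_index[OF ijk(1,2)] hom_sum hom_mult by (intro sum.cong refl) auto
qed

context sing_action
begin

text \<open>Membership in the null cone is what makes the assignment well defined: a polynomial that
  is zero on the orbit is zero at the zero tuple. The map \<open>\<gamma>\<close> fixes
  \<open>G\<close> and lets functions of group elements be total on the matrix type.\<close>

lemma null_cone_part_hom:
  fixes \<gamma> :: "complex mat \<Rightarrow> complex mat"
  assumes X: "X \<in> null_cone N G n m \<phi>" and \<gamma>: "\<And>g. g \<in> G \<Longrightarrow> \<gamma> g = g"
  shows "part_hom {((\<lambda>g. p (\<phi> (\<gamma> g) X)), p (tuple_zero n m)) | p. p \<in> poly_funs (tuple_coords n m)}"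
  (is "part_hom ?H")
proof -
  have zero: "p (tuple_zero n m) = 0" if p: "p \<in> poly_funs (tuple_coords n m)" "\<And>g. g \<in> G \<Longrightarrow> p (\<phi> g X) = 0" for p
    using X p unfolding null_cone_def zariski_closure_def orbit_def by auto
  have memI: "((\<lambda>g. p (\<phi> (\<gamma> g) X)), p (tuple_zero n m)) \<in> ?H" if "p \<in> poly_funs (tuple_coords n m)" for p
    using that by auto
  have const: "((\<lambda>_. c), c) \<in> ?H" for c using memI[OF poly_funs.const[of c]] .
  have closed: "(f + g, a + b) \<in> ?H \<and> (f * g, a * b) \<in> ?H" if fg: "(f, a) \<in> ?H" "(g, b) \<in> ?H" for f a g b
  proof -
    obtain p where p: "p \<in> poly_funs (tuple_coords n m)" "f = (\<lambda>g. p (\<phi> (\<gamma> g) X))" "a = p (tuple_zero n m)"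
      using fg(1) by auto
    obtain q where q: "q \<in> poly_funs (tuple_coords n m)" "g = (\<lambda>g. q (\<phi> (\<gamma> g) X))" "b = q (tuple_zero n m)"
      using fg(2) by auto
    show ?thesis
      unfolding p(2,3) q(2,3) plus_fun_def times_fun_def
      using memI[OF poly_funs.add[OF p(1) q(1)]] memI[OF poly_funs.mult[OF p(1) q(1)]] by (rule conjI)
  qed
  have cz: "c = 0" if c: "(0, c) \<in> ?H" for c
  proof -
    obtain p where p: "p \<in> poly_funs (tuple_coords n m)" "0 = (\<lambda>g. p (\<phi> (\<gamma> g) X))" "c = p (tuple_zero n m)"
      using c by auto
    have "p (\<phi> g X) = 0" if "g \<in> G" for g using fun_cong[OF p(2), of g] \<gamma>[OF that] by (simp add: fun_apply)
    then show ?thesis using zero[OF p(1)] p(3) by simp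
  qed
  show ?thesis by (rule part_homI[OF const closed cz])
qed

theorem null_cone_subset_NSING:
  assumes red: "reductive_group N G" and nc: "null_cone N G n m \<phi> \<subseteq> SING n m"
    and F: "skew_field F" "f \<in> Ring.ring_hom (free_algebra m) F"
  shows "null_cone N G n m \<phi> \<subseteq> NSING F f n m"
proof (rule subsetI, rule ccontr)
  fix X assume X: "X \<in> null_cone N G n m \<phi>" and neg: "X \<notin> NSING F f n m"
  have Xm: "X \<in> mat_tuples n m" using X unfolding null_cone_def by blast
  \<comment> \<open>Matrices outside \<open>G\<close> are sent to the identity, so
    \<open>\<gamma> g\<close> is always a group element.\<close>
  define \<gamma> where "\<gamma> g = (if g \<in> G then g else 1\<^sub>m N)" for g
  have \<gamma>: "\<gamma> g \<in> G" for g unfolding \<gamma>_def using one_mem by simp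
  define W where "W g s P Q R \<longleftrightarrow> P \<in> carrier_mat n n \<and> Q \<in> carrier_mat n n \<and> R \<in> carrier_mat m m \<and>
    (\<forall>X\<in>mat_tuples n m. \<forall>i<n. \<forall>j<n. \<forall>k<m. entry (\<phi> (\<gamma> g) X) (k, if s then (j, i) else (i, j))
      = (\<Sum>c<m. R $$ (k, c) * (P * X c * Q) $$ (i, j)))" for g s P Q R
  have "\<forall>g. \<exists>s P Q R. W g s P Q R"
    unfolding W_def by (intro allI sing_preserver \<gamma>)
  then have "\<exists>s P Q R. \<forall>g. W g (s g) (P g) (Q g) (R g)" by (rule choice4)
  then obtain s P Q R where W: "\<forall>g. W g (s g) (P g) (Q g) (R g)" by (elim exE)
  have car: "P g \<in> carrier_mat n n" "Q g \<in> carrier_mat n n" "R g \<in> carrier_mat m m" for g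
    using spec[OF W, of g] unfolding W_def by blast+
  have form: "entry (\<phi> (\<gamma> g) X) (k, if s g then (j, i) else (i, j)) = (\<Sum>c<m. R g $$ (k, c) * (P g * X c * Q g) $$ (i, j))"
    if "X \<in> mat_tuples n m" "i < n" "j < n" "k < m" for g X i j k
    using spec[OF W, of g, unfolded W_def, THEN conjunct2, THEN conjunct2, THEN conjunct2, THEN bspec, OF that(1)]
      that(2-4) by (elim allE impE)
  define PP QQ RR where "PP = mat_fun n P" and "QQ = mat_fun n Q" and "RR = mat_fun m R"
  have cPQR: "PP \<in> carrier_mat n n" "QQ \<in> carrier_mat n n" "RR \<in> carrier_mat m m"
    unfolding PP_def QQ_def RR_def by simp_all
  have eval: "(mix n m RR (\<lambda>c. PP * Z c * QQ) k $$ (i, j)) g = entry (\<phi> (\<gamma> g) Y) (k, if s g then (j, i) else (i, j))"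
    if Z: "\<And>c. c < m \<Longrightarrow> Z c \<in> carrier_mat n n" and Y: "Y \<in> mat_tuples n m"
      and YZ: "\<And>c. c < m \<Longrightarrow> map_mat (\<lambda>f. f g) (Z c) = Y c"
      and ijk: "i < n" "j < n" "k < m" for Z Y g i j k
  proof -
    have "(mix n m RR (\<lambda>c. PP * Z c * QQ) k $$ (i, j)) g
        = (\<Sum>c<m. R g $$ (k, c) * (P g * map_mat (\<lambda>f. f g) (Z c) * Q g) $$ (i, j))"
      using mix_eval[OF cPQR(3,1,2) Z ijk, where g = g] unfolding PP_def QQ_def RR_def
        map_mat_fun[of P, OF car(1)] map_mat_fun[of Q, OF car(2)] map_mat_fun[of R, OF car(3)] .
    also have "\<dots> = entry (\<phi> (\<gamma> g) Y) (k, if s g then (j, i) else (i, j))"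
      unfolding form[OF Y ijk] using YZ by (intro sum.cong refl) (simp only: lessThan_iff)
    finally show ?thesis .
  qed
  let ?O = "tuple_zero n m"
  obtain H where H: "place H"
    and HX: "{((\<lambda>g. p (\<phi> (\<gamma> g) X)), p ?O) | p. p \<in> poly_funs (tuple_coords n m)} \<subseteq> H"
    using place_extending[OF null_cone_part_hom[OF X, of \<gamma>]] unfolding \<gamma>_def by auto
  have ph: "part_hom H" using H by (rule place_part_hom)
  have HXp: "((\<lambda>g. p (\<phi> (\<gamma> g) X)), p ?O) \<in> H" if "p \<in> poly_funs (tuple_coords n m)" for p
    by (rule subsetD[OF HX]) (use that in auto)
  have HX0: "((\<lambda>g. entry (\<phi> (\<gamma> g) X) b), 0) \<in> H" if b: "b \<in> idx n m" for b
    using HXp[OF entry_poly_funs[OF b]] by (simp only: entry_tuple_zero[OF b])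
  have idxI: "(k, i, j) \<in> idx n m" if "i < n" "j < n" "k < m" for i j k using that unfolding idx_def by simp
  have val: "mat_rel H (mix n m RR (\<lambda>c. PP * cst (X c) * QQ) k) (0\<^sub>m n n)" if k: "k < m" for k
  proof -
    have "(mix n m RR (\<lambda>c. PP * cst (X c) * QQ) k $$ (i, j), 0) \<in> H" if ij: "i < n" "j < n" for i j
    proof -
      have "mix n m RR (\<lambda>c. PP * cst (X c) * QQ) k $$ (i, j)
          = (\<lambda>g. entry (\<phi> (\<gamma> g) X) (k, if s g then (j, i) else (i, j)))"
        by (rule ext, rule eval[OF cst_carrier[OF mat_tuples_carrier[OF Xm]] Xm _ ij k])
          (auto simp: cst_def)
      also have "\<dots> = (\<lambda>g. if s g then entry (\<phi> (\<gamma> g) X) (k, j, i) else entry (\<phi> (\<gamma> g) X) (k, i, j))" by auto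
      finally show ?thesis
        using place_if_value[OF H HX0[OF idxI[OF ij(2,1) k]] HX0[OF idxI[OF ij k]], of s] by simp
    qed
    then show ?thesis unfolding mat_rel_def by (auto simp: mix_def)
  qed
  have "\<exists>Y y. (\<forall>k<m. Y k \<in> carrier_mat n n \<and> mat_rel H (Y k) (y k)) \<and>
    (\<forall>k<m. mat_rel H (mix n m RR (\<lambda>c. PP * Y c * QQ) k) (0\<^sub>m n n)) \<and>
    (\<exists>A\<in>carrier_mat m m. \<exists>k<m. det (mix n m A y k) \<noteq> 0)"
  proof (rule driven_to_zero[OF H cPQR])
    show "n \<ge> 1" using n2 by simp
  qed (fact mat_tuples_carrier[OF Xm] val NSING_transversal[OF F Xm neg])+
  then obtain Y y where Yy: "\<forall>k<m. Y k \<in> carrier_mat n n \<and> mat_rel H (Y k) (y k)"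
    and Y0: "\<forall>k<m. mat_rel H (mix n m RR (\<lambda>c. PP * Y c * QQ) k) (0\<^sub>m n n)"
    and yA: "\<exists>A\<in>carrier_mat m m. \<exists>k<m. det (mix n m A y k) \<noteq> 0" by (elim exE conjE)
  define YT where "YT g = tuple_of n m (\<lambda>(k, ij). (Y k $$ ij) g)" for g
  define yT where "yT = tuple_of n m (\<lambda>(k, ij). y k $$ ij)"
  have YTm: "YT g \<in> mat_tuples n m" "yT \<in> mat_tuples n m" for g unfolding YT_def yT_def by simp_all
  have YTy: "((\<lambda>g. entry (YT g) b), entry yT b) \<in> H" if b: "b \<in> idx n m" for b
  proof -
    obtain k i j where bk: "b = (k, i, j)" by (cases b) auto
    then have ijk: "i < n" "j < n" "k < m" using b unfolding idx_def by auto
    have "(Y k $$ (i, j), y k $$ (i, j)) \<in> H" using Yy mat_rel_index ijk by blast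
    then show ?thesis using b unfolding YT_def yT_def bk by simp
  qed
  have GY0: "((\<lambda>g. entry (\<phi> (\<gamma> g) (YT g)) b), 0) \<in> H" if b: "b \<in> idx n m" for b
  proof -
    obtain k i j where bk: "b = (k, i, j)" by (cases b) auto
    then have ijk: "i < n" "j < n" "k < m" using b unfolding idx_def by auto
    have *: "((\<lambda>g. entry (\<phi> (\<gamma> g) (YT g)) (k, if s g then (j, i) else (i, j))), 0) \<in> H"
      if ij: "i < n" "j < n" for i j
    proof -
      have "mix n m RR (\<lambda>c. PP * Y c * QQ) k $$ (i, j)
          = (\<lambda>g. entry (\<phi> (\<gamma> g) (YT g)) (k, if s g then (j, i) else (i, j)))"
      proof (rule ext, rule eval[OF _ YTm(1) _ ij ijk(3)])
        fix g c assume c: "c < m"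
        have "Y c \<in> carrier_mat n n" using Yy c by blast
        then show "map_mat (\<lambda>f. f g) (Y c) = YT g c" using c unfolding YT_def tuple_of_def by (intro eq_matI) auto
      qed (use Yy in blast)
      moreover have "(mix n m RR (\<lambda>c. PP * Y c * QQ) k $$ (i, j), 0\<^sub>m n n $$ (i, j)) \<in> H"
        using mat_rel_index[OF Y0[rule_format, OF ijk(3)] mix_carrier ij] .
      ultimately show ?thesis using ij by simp
    qed
    \<comment> \<open>When \<open>s g\<close> holds, the formula for position (j, i) yields the
      entry at (i, j); both branches have value 0.\<close>
    have "(\<lambda>g. entry (\<phi> (\<gamma> g) (YT g)) b) = (\<lambda>g. if s g
        then entry (\<phi> (\<gamma> g) (YT g)) (k, if s g then (i, j) else (j, i))
        else entry (\<phi> (\<gamma> g) (YT g)) (k, if s g then (j, i) else (i, j)))"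
      unfolding bk by auto
    then show ?thesis using place_if_value[OF H *[OF ijk(2,1)] *[OF ijk(1,2)], of s] by simp
  qed
  \<comment> \<open>An invariant takes the same values on \<open>YT g\<close> and on its image under
    \<open>\<gamma> g\<close>. The place sends the former to the invariant at \<open>yT\<close> and
    the latter to the invariant at the zero tuple.\<close>
  have "yT \<in> null_cone N G n m \<phi>"
  proof (rule ccontr)
    assume "yT \<notin> null_cone N G n m \<phi>"
    then obtain q where q: "q \<in> poly_funs (tuple_coords n m)" "\<forall>g\<in>G. \<forall>Y\<in>mat_tuples n m. q (\<phi> g Y) = q Y" "q yT \<noteq> q ?O"
      using separating_invariant[OF red YTm(2)] by blast
    have "((\<lambda>g. q (YT g)), q yT) \<in> H" by (rule place_poly_value[OF ph q(1) YTy])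
    moreover have "((\<lambda>g. q (\<phi> (\<gamma> g) (YT g))), q ?O) \<in> H"
      using GY0 entry_tuple_zero by (intro place_poly_value[OF ph q(1)]) auto
    moreover have "q (\<phi> (\<gamma> g) (YT g)) = q (YT g)" for g using q(2) \<gamma> YTm(1) by blast
    ultimately show False using part_hom_unique[OF ph] q(3) by simp
  qed
  then have "yT \<in> SING n m" using nc by blast
  then have sing: "det (pencil_at n m yT c) = 0" for c using SING_iff[OF YTm(2)] by blast
  \<comment> \<open>Row \<open>k\<close> of \<open>A\<close> gives the weights at which the pencil
    of \<open>yT\<close> is invertible.\<close>
  obtain A k where "det (mix n m A y k) \<noteq> 0" using yA by blast
  moreover have "mix n m A y k = pencil_at n m yT (\<lambda>c. A $$ (k, c))"
    unfolding mix_def pencil_at_def yT_def tuple_of_def by (intro eq_matI) auto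
  ultimately show False using sing by simp
qed

end

text \<open>A one by one pencil is a linear form. Outside \<open>NSING\<close> the transversal gives
  it a nonzero coefficient, and weight 1 on that slot makes the determinant nonzero.\<close>

lemma SING_subset_NSING_one:
  assumes F: "skew_field F" "f \<in> Ring.ring_hom (free_algebra m) F"
  shows "SING 1 m \<subseteq> NSING F f 1 m"
proof (rule subsetI, rule ccontr)
  fix X assume X: "X \<in> SING 1 m" and neg: "X \<notin> NSING F f 1 m"
  have Xm: "X \<in> mat_tuples 1 m" using X unfolding SING_def by blast
  have one: "1\<^sub>m 1 \<in> carrier_mat 1 1" "1\<^sub>m 1 * 1\<^sub>m 1 = (1\<^sub>m 1 :: complex mat)" by simp_all
  obtain \<sigma> where \<sigma>: "\<sigma> ` {..<1} \<subseteq> {..<1::nat}" "\<forall>i<1. \<exists>k<m. (1\<^sub>m 1 * X k * 1\<^sub>m 1) $$ (i, \<sigma> i) \<noteq> 0"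
    using NSING_transversal[OF F Xm neg one(1,1,2) one(1,1,2)] by blast
  obtain k where k: "k < m" "(1\<^sub>m 1 * X k * 1\<^sub>m 1) $$ (0, \<sigma> 0) \<noteq> 0" using \<sigma>(2) by blast
  have "\<sigma> 0 = 0" using \<sigma>(1) by auto
  then have nz: "X k $$ (0, 0) \<noteq> 0" using k mat_tuples_carrier[OF Xm k(1)] by simp
  have "det (pencil_at 1 m X (\<lambda>c. if c = k then 1 else 0)) = X k $$ (0, 0)"
    using k(1) unfolding pencil_at_def by (subst det_single) (auto simp: if_distrib[of "\<lambda>x. x * _"] cong: if_cong)
  then show False using nz SING_iff[OF Xm] X by simp
qed

theorem theorem1p9:
  fixes n m N :: nat
    and G :: "complex mat set"
    and \<phi> :: "complex mat \<Rightarrow> (nat \<Rightarrow> complex mat) \<Rightarrow> nat \<Rightarrow> complex mat"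
    and F :: "'f ring"
    and f :: "ncpoly \<Rightarrow> 'f"
  assumes "n \<ge> 1" and "m \<ge> 1"
    and "free_skew_field m F f"
    and "reductive_group N G"
    and "algebraic_linear_action N G n m \<phi>"
    and "\<And>g. g \<in> G \<Longrightarrow> \<phi> g ` SING n m = SING n m"
    and "null_cone N G n m \<phi> \<subseteq> SING n m"
  shows "null_cone N G n m \<phi> \<subseteq> NSING F f n m"
proof -
  have F: "skew_field F" "f \<in> Ring.ring_hom (free_algebra m) F"
    using assms(3) unfolding free_skew_field_def epic_field_def by blast+
  show ?thesis
  \<comment> \<open>The tensor argument uses two different row indices; one by one matrices are
    treated directly.\<close>
  proof (cases "n = 1")
    case True
    then show ?thesis using SING_subset_NSING_one[OF F] assms(7) by blast
  next
    case False
    interpret sing_action N G n m \<phi>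
    proof (intro sing_action.intro lin_action.intro sing_action_axioms.intro)
      show "subgroup G (GL N)" using assms(4) unfolding reductive_group_def linear_algebraic_group_def by blast
      show "n \<ge> 2" using assms(1) False by simp
    qed (fact assms)+
    show ?thesis by (rule null_cone_subset_NSING[OF assms(4,7) F])
  qed
qed

end
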